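(* Let $M$ be a minimal surface of $\mathbb{R}^4$ such that the second fundamental form of $M$ spans the normal space of $M$ at each point. Then for any unit normal section $\eta$ of $M$ the Gauss map $$\gamma_\eta:M\to\mathbb{S}^3,\qquad p\mapsto\eta(p),$$ is not a harmonic map.
   Context: $M$ is an immersed surface. A map from $M$ to a unit sphere $\mathbb{S}^{m-1}$ is harmonic if it is a critical point of $f\mapsto\int_D\|df\|^2$ on compact subdomains $D\subset M$ among maps into $\mathbb{S}^{m-1}$ (equivalently $\Delta f=-\|df\|^2 f$). The second fundamental form $B$ spans the normal space at $p$ if $\mathrm{span}\{B(X,Y): X,Y\in T_pM\}=T_pM^\perp$. *)

theory Defs
  imports "HOL-Analysis.Analysis"
begin

section \<open>Smooth maps between Euclidean spaces\<close>

text \<open>These are only used for open \<open>S\<close>, since the derivatives are two-sided ones.\<close>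

primrec Ck_on :: "nat \<Rightarrow> 'a::euclidean_space set \<Rightarrow> ('a \<Rightarrow> 'b::euclidean_space) \<Rightarrow> bool" where
  "Ck_on 0 S f \<longleftrightarrow> continuous_on S f"
| "Ck_on (Suc k) S f \<longleftrightarrow>
     (\<forall>x\<in>S. f differentiable (at x)) \<and>
     (\<forall>v. Ck_on k S (\<lambda>x. frechet_derivative f (at x) v))"

definition smooth_on :: "'a::euclidean_space set \<Rightarrow> ('a \<Rightarrow> 'b::euclidean_space) \<Rightarrow> bool" where
  "smooth_on S f \<longleftrightarrow> (\<forall>k. Ck_on k S f)"

definition pd :: "'n::finite \<Rightarrow> (real^'n \<Rightarrow> 'b::euclidean_space) \<Rightarrow> real^'n \<Rightarrow> 'b" where
  "pd i h u = frechet_derivative h (at u) (axis i 1)"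


section \<open>Surfaces\<close>

text \<open>
  A surface is a second countable Hausdorff space, here a type, with an atlas of local
  parametrizations \<open>(U, x)\<close>, where \<open>U\<close> is open in the plane and \<open>x\<close> maps \<open>U\<close>
  homeomorphically onto an open set.  The values of \<open>x\<close> outside \<open>U\<close> are irrelevant.
\<close>

type_synonym 'm atlas = "((real^2) set \<times> (real^2 \<Rightarrow> 'm)) set"

definition smooth_atlas :: "'m::{t2_space,second_countable_topology} atlas \<Rightarrow> bool" where
  "smooth_atlas A \<longleftrightarrow>
     (\<forall>(U, x)\<in>A. open U \<and> open (x ` U) \<and> homeomorphism U (x ` U) x (inv_into U x)) \<and>
     (\<Union>(U, x)\<in>A. x ` U) = UNIV \<and>
     (\<forall>(U, x)\<in>A. \<forall>(V, y)\<in>A. smooth_on (U \<inter> x -` (y ` V)) (inv_into V y \<circ> x))"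

definition smooth_map :: "'m::{t2_space,second_countable_topology} atlas \<Rightarrow> ('m \<Rightarrow> 'b::euclidean_space) \<Rightarrow> bool" where
  "smooth_map A f \<longleftrightarrow> (\<forall>(U, x)\<in>A. smooth_on U (f \<circ> x))"

definition immersion :: "'m::{t2_space,second_countable_topology} atlas \<Rightarrow> ('m \<Rightarrow> 'b::euclidean_space) \<Rightarrow> bool" where
  "immersion A F \<longleftrightarrow>
     smooth_map A F \<and>
     (\<forall>(U, x)\<in>A. \<forall>u\<in>U. inj (frechet_derivative (F \<circ> x) (at u)))"


section \<open>Local geometry of a parametrized surface\<close>

text \<open>
  In this section \<open>X\<close> is an immersion of an open subset of the plane, later \<open>F \<circ> x\<close>
  for an immersion \<open>F\<close> and a local parametrization \<open>x\<close>.  A vector \<open>a\<close> of the plane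
  stands for the tangent vector \<open>dX(a)\<close>.
\<close>

definition first_form :: "(real^2 \<Rightarrow> 'b::euclidean_space) \<Rightarrow> real^2 \<Rightarrow> real^2^2" where
  "first_form X u = (\<chi> i j. pd i X u \<bullet> pd j X u)"

definition tangent_plane :: "(real^2 \<Rightarrow> 'b::euclidean_space) \<Rightarrow> real^2 \<Rightarrow> 'b set" where
  "tangent_plane X u = range (frechet_derivative X (at u))"

definition normal_space :: "(real^2 \<Rightarrow> 'b::euclidean_space) \<Rightarrow> real^2 \<Rightarrow> 'b set" where
  "normal_space X u = (tangent_plane X u)\<^sup>\<bottom>"

definition normal_part :: "(real^2 \<Rightarrow> 'b::euclidean_space) \<Rightarrow> real^2 \<Rightarrow> 'b \<Rightarrow> 'b" where
  "normal_part X u v = (THE w. w \<in> normal_space X u \<and> v - w \<in> tangent_plane X u)"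

definition second_form :: "(real^2 \<Rightarrow> 'b::euclidean_space) \<Rightarrow> real^2 \<Rightarrow> real^2 \<Rightarrow> real^2 \<Rightarrow> 'b" where
  "second_form X u a b =
     normal_part X u (frechet_derivative (\<lambda>w. frechet_derivative X (at w) b) (at u) a)"

text \<open>The trace of a bilinear form with coefficients \<open>b i j\<close> with respect to the induced metric.\<close>

definition metric_trace ::
    "(real^2 \<Rightarrow> 'b::euclidean_space) \<Rightarrow> real^2 \<Rightarrow> (2 \<Rightarrow> 2 \<Rightarrow> 'c::real_vector) \<Rightarrow> 'c" where
  "metric_trace X u b = (\<Sum>i\<in>UNIV. \<Sum>j\<in>UNIV. matrix_inv (first_form X u) $ i $ j *\<^sub>R b i j)"

definition mean_curvature :: "(real^2 \<Rightarrow> 'b::euclidean_space) \<Rightarrow> real^2 \<Rightarrow> 'b" where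
  "mean_curvature X u =
     (1/2) *\<^sub>R metric_trace X u (\<lambda>i j. second_form X u (axis i 1) (axis j 1))"


section \<open>Immersed surfaces\<close>

definition minimal :: "'m::{t2_space,second_countable_topology} atlas \<Rightarrow> ('m \<Rightarrow> 'b::euclidean_space) \<Rightarrow> bool" where
  "minimal A F \<longleftrightarrow> (\<forall>(U, x)\<in>A. \<forall>u\<in>U. mean_curvature (F \<circ> x) u = 0)"

definition second_form_spans_normal ::
    "'m::{t2_space,second_countable_topology} atlas \<Rightarrow> ('m \<Rightarrow> 'b::euclidean_space) \<Rightarrow> bool" where
  "second_form_spans_normal A F \<longleftrightarrow>
     (\<forall>(U, x)\<in>A. \<forall>u\<in>U.
        span {second_form (F \<circ> x) u a b | a b. True} = normal_space (F \<circ> x) u)"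

definition unit_normal_section ::
    "'m::{t2_space,second_countable_topology} atlas \<Rightarrow> ('m \<Rightarrow> 'b::euclidean_space) \<Rightarrow> ('m \<Rightarrow> 'b) \<Rightarrow> bool" where
  "unit_normal_section A F \<eta> \<longleftrightarrow>
     smooth_map A \<eta> \<and> (\<forall>p. norm (\<eta> p) = 1) \<and>
     (\<forall>(U, x)\<in>A. \<forall>u\<in>U. \<eta> (x u) \<in> normal_space (F \<circ> x) u)"

text \<open>
  Each local parametrization \<open>(U, x)\<close> gives a measure on the surface, concentrated on \<open>x ` U\<close>,
  which is the area there.  The area measure is the supremum of these in the complete lattice
  of measures, that is, the Borel measure which agrees with each of them on the Borel subsets
  of \<open>x ` U\<close>.
\<close>

definition area_measure ::
    "'m::{t2_space,second_countable_topology} atlas \<Rightarrow> ('m \<Rightarrow> 'b::euclidean_space) \<Rightarrow> 'm measure" where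
  "area_measure A F =
     (SUP (U, x)\<in>A.
        distr (density (restrict_space lborel U) (\<lambda>u. ennreal (sqrt (det (first_form (F \<circ> x) u)))))
              borel x)"

text \<open>
  The squared norm of the differential of \<open>f\<close> at \<open>p\<close>, for the metric induced by \<open>F\<close>.
  By the chain rule its expression does not depend on the local parametrization around \<open>p\<close>;
  the definite description picks the common value.
\<close>

definition norm_diff_sq ::
    "'m::{t2_space,second_countable_topology} atlas \<Rightarrow> ('m \<Rightarrow> 'b::euclidean_space) \<Rightarrow>
     ('m \<Rightarrow> 'c::euclidean_space) \<Rightarrow> 'm \<Rightarrow> real" where
  "norm_diff_sq A F f p =
     (THE e. \<forall>(U, x)\<in>A. \<forall>u\<in>U. x u = p \<longrightarrow>
        e = metric_trace (F \<circ> x) u (\<lambda>i j. pd i (f \<circ> x) u \<bullet> pd j (f \<circ> x) u))"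

definition energy ::
    "'m::{t2_space,second_countable_topology} atlas \<Rightarrow> ('m \<Rightarrow> 'b::euclidean_space) \<Rightarrow> 'm set \<Rightarrow>
     ('m \<Rightarrow> 'c::euclidean_space) \<Rightarrow> real" where
  "energy A F D f = (LINT p:D|area_measure A F. norm_diff_sq A F f p)"

definition compact_subdomain :: "'m::topological_space set \<Rightarrow> bool" where
  "compact_subdomain D \<longleftrightarrow> compact D \<and> (\<exists>W. open W \<and> connected W \<and> D = closure W)"

text \<open>
  A smooth variation of \<open>f\<close> through maps into the unit sphere, fixed outside \<open>D\<close>.
\<close>

definition sphere_variation ::
    "'m::{t2_space,second_countable_topology} atlas \<Rightarrow> 'm set \<Rightarrow> ('m \<Rightarrow> 'c::euclidean_space) \<Rightarrow>
     real \<Rightarrow> (real \<Rightarrow> 'm \<Rightarrow> 'c) \<Rightarrow> bool" where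
  "sphere_variation A D f \<epsilon> G \<longleftrightarrow>
     (\<forall>(U, x)\<in>A. smooth_on ({-\<epsilon><..<\<epsilon>} \<times> U) (\<lambda>(t, u). G t (x u))) \<and>
     (\<forall>t\<in>{-\<epsilon><..<\<epsilon>}. \<forall>p. norm (G t p) = 1) \<and>
     G 0 = f \<and>
     (\<forall>t\<in>{-\<epsilon><..<\<epsilon>}. \<forall>p. p \<notin> D \<longrightarrow> G t p = f p)"

definition harmonic_to_sphere ::
    "'m::{t2_space,second_countable_topology} atlas \<Rightarrow> ('m \<Rightarrow> 'b::euclidean_space) \<Rightarrow>
     ('m \<Rightarrow> 'c::euclidean_space) \<Rightarrow> bool" where
  "harmonic_to_sphere A F f \<longleftrightarrow>
     smooth_map A f \<and> (\<forall>p. norm (f p) = 1) \<and>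
     (\<forall>D \<epsilon> G. compact_subdomain D \<and> \<epsilon> > 0 \<and> sphere_variation A D f \<epsilon> G \<longrightarrow>
        ((\<lambda>t. energy A F D (G t)) has_real_derivative 0) (at 0))"

end

theory Submission
  imports Defs
begin

text \<open>
  Suppose that the Gauss map \<open>\<eta>\<close> were harmonic. The argument is local, in one chart, with the
  immersion \<open>X\<close> and the unit normal \<open>N\<close> as functions on an open subset of the plane.

  \<^item> Harmonicity makes the tension \<open>\<Delta>N\<close> a multiple of \<open>N\<close>, so it has no tangential part. For a
    minimal surface the Codazzi equation turns that tangential part into \<open>-2 A\<^sub>\<xi>(\<omega>)\<close>, where \<open>\<xi>\<close> is the
    second unit normal, \<open>A\<^sub>\<xi>\<close> its shape operator and \<open>\<omega> = \<langle>dN, \<xi>\<rangle>\<close> the connection form of the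
    normal bundle. Now \<open>A\<^sub>\<xi>\<close> is symmetric and trace-free, and it is nonzero because the second
    fundamental form spans the normal space; in dimension two this makes it invertible. Hence
    \<open>\<omega> = 0\<close>, that is, \<open>N\<close> is parallel in the normal bundle (\<open>pd_N_tangential\<close>).

  \<^item> Then the normal bundle is flat, and the Ricci equation says that \<open>A\<^sub>N\<close> and \<open>A\<^sub>\<xi>\<close> commute. Two
    commuting trace-free symmetric operators of the plane are proportional, so some nonzero normal
    vector is orthogonal to the whole second fundamental form, against the spanning
    hypothesis (\<open>empty_domain\<close>).

  The coordinates are arbitrary, not isothermal. The computation is kept short by the Hodge star:
  with \<open>*df\<close> the differential rotated by a right angle (\<open>star_pd\<close>), the tension of \<open>N\<close> is
  \<open>d(*dN)\<close> up to sign, minimality becomes \<open>\<langle>*dN(a), dX(b)\<rangle> = \<langle>dN(a), *dX(b)\<rangle>\<close> (\<open>star_N_inner\<close>), and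
  differentiating that identity replaces the Codazzi equation. Only second derivatives of \<open>X\<close> occur.

  Most of the text serves to obtain the Euler-Lagrange equation from the energy
  (\<open>harmonic_tension_orthogonal\<close>). The test fields are \<open>h = \<phi>V\<close> with \<open>V\<close> orthogonal to \<open>N\<close> and \<open>\<phi>\<close> a
  smooth bump supported in a small coordinate box, and the variation is \<open>(\<eta> + th) / |\<eta> + th|\<close>.
  Since \<open>|\<eta> + th| \<ge> 1\<close>, radial projection to the sphere does not increase the energy, so the energy
  of the variation lies below that of \<open>\<eta> + th\<close>, a quadratic polynomial in \<open>t\<close>, with equality at
  \<open>t = 0\<close>. Two functions of \<open>t\<close> in this position have the same derivative at \<open>0\<close>, which gives the
  first variation without differentiating an integral. The energy itself is an integral for a
  supremum of measures; that it can be computed in a single chart rests on the change of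
  variables formula (\<open>emeasure_area_measure\<close>).
\<close>

section \<open>Smooth functions\<close>

lemma Ck_on_cong:
  assumes "open S" "\<And>x. x \<in> S \<Longrightarrow> f x = g x" "Ck_on k S f"
  shows "Ck_on k S g"
  using assms(2,3)
proof (induction k arbitrary: f g)
  case 0
  then show ?case by (metis Ck_on.simps(1) continuous_on_cong)
next
  case (Suc k)
  have d: "g differentiable (at x)" and e: "frechet_derivative f (at x) = frechet_derivative g (at x)"
    if "x \<in> S" for x
  proof -
    have fd: "f differentiable (at x)" using Suc.prems(2) that by simp
    then show "g differentiable (at x)"
      by (metis Suc.prems(1) assms(1) differentiable_def has_derivative_transform_within_open that)
    show "frechet_derivative f (at x) = frechet_derivative g (at x)"
      using frechet_derivative_transform_within_open[OF fd assms(1) that] Suc.prems(1) by blast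
  qed
  have "Ck_on k S (\<lambda>x. frechet_derivative g (at x) v)" for v
  proof (rule Suc.IH)
    show "Ck_on k S (\<lambda>x. frechet_derivative f (at x) v)" using Suc.prems(2) by simp
  qed (simp add: e)
  with d show ?case by simp
qed

lemma Ck_on_local:
  assumes "\<And>x. x \<in> S \<Longrightarrow> \<exists>T. open T \<and> x \<in> T \<and> Ck_on k T f"
  shows "Ck_on k S f"
  using assms
proof (induction k arbitrary: f)
  case 0
  then show ?case
    by (metis Ck_on.simps(1) continuous_at_imp_continuous_on continuous_on_eq_continuous_at)
next
  case (Suc k)
  then show ?case
    by (simp, metis)
qed

lemma Ck_on_subset: "Ck_on k S f \<Longrightarrow> T \<subseteq> S \<Longrightarrow> Ck_on k T f"
  by (induction k arbitrary: f) (auto intro: continuous_on_subset)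

lemma Ck_on_SucD: "Ck_on (Suc k) S f \<Longrightarrow> Ck_on k S f"
proof (induction k arbitrary: f)
  case 0
  then show ?case
    by (simp add: continuous_at_imp_continuous_on differentiable_imp_continuous_within)
qed auto

lemma Ck_on_const: "Ck_on k S (\<lambda>x. c)"
  by (induction k arbitrary: c) auto

lemma Ck_on_bounded_linear: "bounded_linear f \<Longrightarrow> Ck_on k S f"
proof (cases k)
  case 0
  assume "bounded_linear f" then show ?thesis using 0 by (simp add: linear_continuous_on)
next
  case (Suc n)
  assume f: "bounded_linear f"
  then have "frechet_derivative f (at x) = f" for x
    by (metis bounded_linear_imp_has_derivative frechet_derivative_at)
  with f show ?thesis
    by (simp add: Suc Ck_on_const bounded_linear_imp_differentiable)
qed

lemma Ck_on_add:
  assumes "open S" "Ck_on k S f" "Ck_on k S g"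
  shows "Ck_on k S (\<lambda>x. f x + g x)"
  using assms(2,3)
proof (induction k arbitrary: f g)
  case 0
  then show ?case by (simp add: continuous_on_add)
next
  case (Suc k)
  have d: "((\<lambda>x. f x + g x) has_derivative
     (\<lambda>v. frechet_derivative f (at x) v + frechet_derivative g (at x) v)) (at x)" if "x \<in> S" for x
    using Suc.prems that by (auto intro!: has_derivative_add simp: frechet_derivative_works[symmetric])
  have "Ck_on k S (\<lambda>x. frechet_derivative (\<lambda>x. f x + g x) (at x) v)" for v
    by (rule Ck_on_cong[OF assms(1) _ Suc.IH[of "\<lambda>x. frechet_derivative f (at x) v" "\<lambda>x. frechet_derivative g (at x) v"]])
      (use Suc.prems d[THEN frechet_derivative_at] in \<open>auto simp: fun_eq_iff\<close>)
  with d show ?case by (auto simp: differentiable_def)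
qed

lemma Ck_on_bilinear:
  assumes "bounded_bilinear B" "open S" "Ck_on k S f" "Ck_on k S g"
  shows "Ck_on k S (\<lambda>x. B (f x) (g x))"
  using assms(3,4)
proof (induction k arbitrary: f g)
  case 0
  then show ?case by (simp add: bounded_bilinear.continuous_on[OF assms(1)])
next
  case (Suc k)
  have d: "((\<lambda>x. B (f x) (g x)) has_derivative
     (\<lambda>v. B (f x) (frechet_derivative g (at x) v) + B (frechet_derivative f (at x) v) (g x))) (at x)" if "x \<in> S" for x
    using Suc.prems that by (auto intro!: bounded_bilinear.FDERIV[OF assms(1)] simp: frechet_derivative_works[symmetric])
  have "Ck_on k S (\<lambda>x. frechet_derivative (\<lambda>x. B (f x) (g x)) (at x) v)" for v
  proof (rule Ck_on_cong[OF assms(2) _ Ck_on_add[OF assms(2)]])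
    show "Ck_on k S (\<lambda>x. B (f x) (frechet_derivative g (at x) v))"
         "Ck_on k S (\<lambda>x. B (frechet_derivative f (at x) v) (g x))"
      using Suc.prems by (auto intro!: Suc.IH dest: Ck_on_SucD simp del: Ck_on.simps) (auto)
  qed (use d[THEN frechet_derivative_at] in \<open>auto simp: fun_eq_iff\<close>)
  with d show ?case by (auto simp: differentiable_def)
qed

lemma Ck_on_sum:
  assumes "open S" "finite I" "\<And>i. i \<in> I \<Longrightarrow> Ck_on k S (f i)"
  shows "Ck_on k S (\<lambda>x. \<Sum>i\<in>I. f i x)"
  using assms(2,3) by (induction I) (auto intro!: Ck_on_add Ck_on_const assms(1))

text \<open>
  The derivative of the composition is expanded in a basis, so that it becomes a sum of products of
  functions to which the induction hypothesis applies.
\<close>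

lemma Ck_on_compose:
  fixes f :: "'a::euclidean_space \<Rightarrow> 'b::euclidean_space" and g :: "'b \<Rightarrow> 'c::euclidean_space"
  assumes "open S" "open T" "f ` S \<subseteq> T" "Ck_on k S f" "Ck_on k T g"
  shows "Ck_on k S (\<lambda>x. g (f x))"
  using assms(4,5)
proof (induction k arbitrary: g)
  case 0
  then show ?case using assms(3) by (auto intro: continuous_on_compose2)
next
  case (Suc k)
  have d: "((\<lambda>x. g (f x)) has_derivative
     (\<lambda>v. frechet_derivative g (at (f x)) (frechet_derivative f (at x) v))) (at x)" if "x \<in> S" for x
  proof -
    have "f differentiable (at x)" "g differentiable (at (f x))"
      using Suc.prems that assms(3) by auto
    then show ?thesis
      unfolding frechet_derivative_works by (rule diff_chain_at[unfolded o_def])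
  qed
  have e: "frechet_derivative g (at (f x)) (frechet_derivative f (at x) v) =
    (\<Sum>b\<in>Basis. (frechet_derivative f (at x) v \<bullet> b) *\<^sub>R frechet_derivative g (at (f x)) b)" (is "_ = ?R v x")
    if "x \<in> S" for x v
  proof -
    have "g differentiable (at (f x))"
      using Suc.prems(2) that assms(3) by auto
    then have "linear (frechet_derivative g (at (f x)))"
      by (rule linear_frechet_derivative)
    then have "frechet_derivative g (at (f x)) (\<Sum>b\<in>Basis. (frechet_derivative f (at x) v \<bullet> b) *\<^sub>R b)
      = ?R v x" by (simp add: linear_sum linear_scale)
    then show ?thesis by (simp add: euclidean_representation)
  qed
  have "Ck_on k S (\<lambda>x. frechet_derivative (\<lambda>x. g (f x)) (at x) v)" for v
  proof (rule Ck_on_cong[OF assms(1)])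
    show "?R v x = frechet_derivative (\<lambda>x. g (f x)) (at x) v" if "x \<in> S" for x
      using d[OF that, THEN frechet_derivative_at] e[OF that] by (simp add: fun_eq_iff)
    have "Ck_on k S (\<lambda>x. frechet_derivative f (at x) v \<bullet> b)" for b
      using Suc.prems by (auto intro!: Ck_on_bilinear[OF bounded_bilinear_inner assms(1)] Ck_on_const)
    moreover have "Ck_on k S (\<lambda>x. frechet_derivative g (at (f x)) b)" for b
      by (rule Suc.IH) (use Suc.prems Ck_on_SucD in \<open>auto simp del: Ck_on.simps\<close>, use Suc.prems in auto)
    ultimately show "Ck_on k S (?R v)"
      by (intro Ck_on_sum[OF assms(1)] Ck_on_bilinear[OF bounded_bilinear_scaleR assms(1)]) auto
  qed
  with d show ?case by (auto simp: differentiable_def)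
qed

lemma Ck_on_Suc_real:
  fixes f :: "real \<Rightarrow> real"
  assumes "open S" "\<And>x. x \<in> S \<Longrightarrow> (f has_real_derivative f' x) (at x)" "Ck_on k S f'"
  shows "Ck_on (Suc k) S f"
proof -
  have d: "(f has_derivative (\<lambda>v. f' x * v)) (at x)" if "x \<in> S" for x
    using assms(2)[OF that] by (simp add: has_field_derivative_def)
  have "Ck_on k S (\<lambda>x. frechet_derivative f (at x) v)" for v
    by (rule Ck_on_cong[OF assms(1) _ Ck_on_bilinear[OF bounded_bilinear_mult assms(1,3) Ck_on_const[of k S v]]])
      (use d[THEN frechet_derivative_at] in \<open>auto simp: fun_eq_iff\<close>)
  with d show ?thesis by (auto simp: differentiable_def)
qed

text \<open>
  The derivative is again a multiple of a power, so induction over the order of differentiability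
  works for all exponents at once. Reciprocals and square roots are special cases.
\<close>

lemma smooth_on_powr: "smooth_on {0<..} (\<lambda>s::real. s powr a)"
proof -
  have "Ck_on k {0<..} (\<lambda>s::real. s powr a)" for k
  proof (induction k arbitrary: a)
    case 0
    then show ?case by (auto intro!: continuous_intros)
  next
    case (Suc k)
    show ?case
    proof (rule Ck_on_Suc_real[where f' = "\<lambda>s. a * s powr (a - 1)"])
      show "Ck_on k {0<..} (\<lambda>s. a * s powr (a - 1))"
        by (intro Ck_on_bilinear[OF bounded_bilinear_mult] Ck_on_const Suc) auto
    qed (auto intro!: derivative_eq_intros)
  qed
  then show ?thesis by (simp add: smooth_on_def)
qed

lemma smooth_on_cong: "open S \<Longrightarrow> (\<And>x. x \<in> S \<Longrightarrow> f x = g x) \<Longrightarrow> smooth_on S f \<Longrightarrow> smooth_on S g"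
  unfolding smooth_on_def by (metis Ck_on_cong)

text \<open>
  Smoothness of functions that are defined by cases on an open cover, such as extensions by zero,
  is checked on each piece.
\<close>

lemma smooth_on_local:
  assumes "\<And>x. x \<in> S \<Longrightarrow> \<exists>T. open T \<and> x \<in> T \<and> smooth_on T f"
  shows "smooth_on S f"
  unfolding smooth_on_def
proof
  show "Ck_on k S f" for k by (rule Ck_on_local) (use assms in \<open>auto simp: smooth_on_def\<close>)
qed

lemma smooth_on_subset: "smooth_on S f \<Longrightarrow> T \<subseteq> S \<Longrightarrow> smooth_on T f"
  unfolding smooth_on_def by (metis Ck_on_subset)

lemma smooth_on_const: "smooth_on S (\<lambda>x. c)"
  by (simp add: smooth_on_def Ck_on_const)

lemma smooth_on_bounded_linear: "bounded_linear f \<Longrightarrow> smooth_on S f"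
  by (simp add: smooth_on_def Ck_on_bounded_linear)

lemma smooth_on_add: "open S \<Longrightarrow> smooth_on S f \<Longrightarrow> smooth_on S g \<Longrightarrow> smooth_on S (\<lambda>x. f x + g x)"
  by (simp add: smooth_on_def Ck_on_add)

lemma smooth_on_bilinear:
  "bounded_bilinear B \<Longrightarrow> open S \<Longrightarrow> smooth_on S f \<Longrightarrow> smooth_on S g \<Longrightarrow> smooth_on S (\<lambda>x. B (f x) (g x))"
  by (simp add: smooth_on_def Ck_on_bilinear)

lemmas smooth_on_inner = smooth_on_bilinear[OF bounded_bilinear_inner]
lemmas smooth_on_scaleR = smooth_on_bilinear[OF bounded_bilinear_scaleR]
lemmas smooth_on_mult = smooth_on_bilinear[OF bounded_bilinear_mult[where 'a=real]]

lemma smooth_on_diff: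
  assumes "open S" "smooth_on S f" "smooth_on S g"
  shows "smooth_on S (\<lambda>x. f x - g x)"
  using smooth_on_add[OF assms(1,2) smooth_on_scaleR[OF assms(1) smooth_on_const[of S "-1"] assms(3)]] by simp

lemma smooth_on_compose:
  "open S \<Longrightarrow> open T \<Longrightarrow> f ` S \<subseteq> T \<Longrightarrow> smooth_on S f \<Longrightarrow> smooth_on T g \<Longrightarrow> smooth_on S (\<lambda>x. g (f x))"
  unfolding smooth_on_def by (metis Ck_on_compose)

lemma smooth_on_powr_compose:
  fixes f :: "'a::euclidean_space \<Rightarrow> real"
  assumes "open S" "smooth_on S f" "\<And>x. x \<in> S \<Longrightarrow> f x > 0"
  shows "smooth_on S (\<lambda>x. f x powr a)"
  by (rule smooth_on_compose[where T = "{0::real<..}" and g = "\<lambda>s. s powr a"]) (use assms in \<open>auto intro!: smooth_on_powr\<close>)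

lemma smooth_on_differentiable: "smooth_on S f \<Longrightarrow> x \<in> S \<Longrightarrow> f differentiable (at x)"
  unfolding smooth_on_def by (metis Ck_on.simps(2))

lemma smooth_on_frechet_derivative:
  "smooth_on S f \<Longrightarrow> smooth_on S (\<lambda>x. frechet_derivative f (at x) v)"
  unfolding smooth_on_def by (metis Ck_on.simps(2))

lemma smooth_on_pd: "smooth_on S f \<Longrightarrow> smooth_on S (pd i f)"
  unfolding pd_def[abs_def] by (rule smooth_on_frechet_derivative)

lemma smooth_on_continuous_on: "smooth_on S f \<Longrightarrow> continuous_on S f"
  unfolding smooth_on_def by (metis Ck_on.simps(1))

lemma smooth_on_prod:
  fixes f :: "'i \<Rightarrow> 'a::euclidean_space \<Rightarrow> real"
  assumes "open S" "finite I" "\<And>i. i \<in> I \<Longrightarrow> smooth_on S (f i)"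
  shows "smooth_on S (\<lambda>x. \<Prod>i\<in>I. f i x)"
  using assms(2,3) by (induction I) (auto intro!: smooth_on_mult smooth_on_const assms(1))

lemma smooth_on_extend_by_zero:
  assumes "open U" "closed K" "smooth_on U h" "\<And>u. u \<in> U - K \<Longrightarrow> h u = 0" "K \<subseteq> U"
  shows "smooth_on UNIV (\<lambda>u. if u \<in> U then h u else 0)"
proof (rule smooth_on_local)
  fix u
  show "\<exists>T. open T \<and> u \<in> T \<and> smooth_on T (\<lambda>u. if u \<in> U then h u else 0)"
  proof (cases "u \<in> U")
    case True
    then show ?thesis
      using assms(1) smooth_on_cong[OF assms(1) _ assms(3)] by (intro exI[of _ U]) auto
  next
    case False
    have "smooth_on (- K) (\<lambda>u. if u \<in> U then h u else 0)"
      by (rule smooth_on_cong[OF _ _ smooth_on_const[of _ 0]]) (use assms in auto)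
    then show ?thesis using False assms by (intro exI[of _ "- K"]) auto
  qed
qed

section \<open>Smooth bump functions on boxes\<close>

text \<open>
  The family \<open>exp(-1/s) / s^n\<close>, extended by zero. It is closed under differentiation up to linear
  combinations, which makes smoothness at the origin an induction.
\<close>

definition flat :: "nat \<Rightarrow> real \<Rightarrow> real" where
  "flat n s = (if s > 0 then exp (- (1 / s)) / s ^ n else 0)"

lemma exp_inverse_tendsto_0: "((\<lambda>s::real. exp (- (1 / s)) / s ^ n) \<longlongrightarrow> 0) (at_right 0)"
proof -
  have "((\<lambda>x::real. x ^ n / exp x) \<longlongrightarrow> 0) at_top" by (rule tendsto_power_div_exp_0)
  then have "((\<lambda>s::real. inverse s ^ n / exp (inverse s)) \<longlongrightarrow> 0) (at_right 0)"
    by (rule filterlim_compose) (rule filterlim_inverse_at_top_right)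
  moreover have "(\<lambda>s::real. inverse s ^ n / exp (inverse s)) = (\<lambda>s. exp (- (1 / s)) / s ^ n)"
    by (simp add: fun_eq_iff exp_minus field_simps)
  ultimately show ?thesis by simp
qed

lemma flat_tendsto_0: "(flat n \<longlongrightarrow> 0) (at 0)"
  unfolding at_eq_sup_left_right
proof (rule filterlim_sup)
  show "(flat n \<longlongrightarrow> 0) (at_left 0)"
    by (rule tendsto_eventually) (auto simp: flat_def eventually_at_filter)
  show "(flat n \<longlongrightarrow> 0) (at_right 0)"
    using exp_inverse_tendsto_0[of n]
    by (rule Lim_transform_eventually) (auto simp: flat_def eventually_at_filter)
qed

text \<open>
  At the origin the difference quotient is the next member of the family, which tends to zero.
\<close>

lemma DERIV_flat: "(flat n has_real_derivative (flat (n + 2) s - n * flat (n + 1) s)) (at s)"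
proof (cases s "0::real" rule: linorder_cases)
  case less
  have "((\<lambda>_. 0) has_real_derivative 0) (at s)" by simp
  moreover have "\<forall>\<^sub>F x in nhds s. flat n x = 0"
    using less by (intro eventually_nhds_in_open[of "{..<0}", THEN eventually_mono]) (auto simp: flat_def)
  ultimately show ?thesis using less by (subst DERIV_cong_ev[OF refl _ refl]) (auto simp: flat_def)
next
  case equal
  have "((\<lambda>h. flat n h / h) \<longlongrightarrow> 0) (at 0)"
    by (rule Lim_transform_eventually[OF flat_tendsto_0[of "Suc n"]])
      (auto simp: flat_def eventually_at_filter)
  then show ?thesis using equal by (simp add: DERIV_def) (simp add: flat_def)
next
  case greater
  have "((\<lambda>s. exp (- (1 / s)) / s ^ n) has_real_derivative (flat (n + 2) s - n * flat (n + 1) s)) (at s)"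
    using greater
    by (auto intro!: derivative_eq_intros simp: flat_def field_simps power2_eq_square)
      (cases n; simp add: field_simps)
  moreover have ev: "\<forall>\<^sub>F x in nhds s. flat n x = exp (- (1 / x)) / x ^ n"
    using greater by (intro eventually_nhds_in_open[of "{0<..}", THEN eventually_mono]) (auto simp: flat_def)
  ultimately show ?thesis using DERIV_cong_ev[OF refl ev refl] by blast
qed

lemma smooth_on_flat: "smooth_on UNIV (flat n)"
proof -
  have "Ck_on k UNIV (flat n)" for k
  proof (induction k arbitrary: n)
    case 0
    have "continuous_on UNIV (flat n)"
      by (rule DERIV_continuous_on) (rule DERIV_flat)
    then show ?case by simp
  next
    case (Suc k)
    have "Ck_on k UNIV (\<lambda>s. flat (n + 2) s + (- real n) * flat (n + 1) s)"
      by (intro Ck_on_add Ck_on_bilinear[OF bounded_bilinear_mult] Ck_on_const Suc) auto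
    then show ?case
      by (intro Ck_on_Suc_real[OF _ DERIV_flat]) auto
  qed
  then show ?thesis by (simp add: smooth_on_def)
qed

definition bump :: "'a::euclidean_space \<Rightarrow> 'a \<Rightarrow> 'a \<Rightarrow> real" where
  "bump a b u = (\<Prod>i\<in>Basis. flat 0 (u \<bullet> i - a \<bullet> i) * flat 0 (b \<bullet> i - u \<bullet> i))"

lemma smooth_on_bump: "smooth_on UNIV (bump a b)"
  unfolding bump_def[abs_def]
  by (intro smooth_on_prod smooth_on_mult open_UNIV finite_Basis
      smooth_on_compose[OF open_UNIV open_UNIV _ _ smooth_on_flat]
      smooth_on_diff smooth_on_inner smooth_on_const smooth_on_bounded_linear bounded_linear_ident) auto

lemma flat_nonneg: "0 \<le> flat n s" and flat_pos_iff: "0 < flat n s \<longleftrightarrow> 0 < s"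
  by (auto simp: flat_def)

lemma bump_nonneg: "0 \<le> bump a b u"
  by (simp add: bump_def prod_nonneg flat_nonneg)

lemma bump_pos: "u \<in> box a b \<Longrightarrow> 0 < bump a b u"
  unfolding bump_def by (intro prod_pos mult_pos_pos) (auto simp: mem_box flat_pos_iff)

lemma bump_outside: "u \<notin> cbox a b \<Longrightarrow> bump a b u = 0"
proof -
  assume "u \<notin> cbox a b"
  then obtain i where i: "i \<in> Basis" "\<not> a \<bullet> i \<le> u \<bullet> i \<or> \<not> u \<bullet> i \<le> b \<bullet> i" by (auto simp: mem_box)
  then have "flat 0 (u \<bullet> i - a \<bullet> i) * flat 0 (b \<bullet> i - u \<bullet> i) = 0" by (auto simp: flat_def)
  with i(1) show ?thesis unfolding bump_def by (intro prod_zero) auto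
qed

section \<open>Partial derivatives\<close>

lemma pd_scaleR:
  assumes "r differentiable (at u)" "f differentiable (at u)"
  shows "pd i (\<lambda>u. r u *\<^sub>R f u) u = r u *\<^sub>R pd i f u + pd i r u *\<^sub>R f u"
  using frechet_derivative_at[OF has_derivative_scaleR[OF assms[unfolded frechet_derivative_works]]]
  by (simp add: pd_def fun_eq_iff)

lemma pd_inner:
  assumes "f differentiable (at u)" "g differentiable (at u)"
  shows "pd i (\<lambda>u. f u \<bullet> g u) u = f u \<bullet> pd i g u + pd i f u \<bullet> g u"
  using frechet_derivative_at[OF has_derivative_inner[OF assms[unfolded frechet_derivative_works]]]
  by (simp add: pd_def fun_eq_iff)

lemma pd_add:
  assumes "f differentiable (at u)" "g differentiable (at u)"
  shows "pd i (\<lambda>u. f u + g u) u = pd i f u + pd i g u"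
  using frechet_derivative_at[OF has_derivative_add[OF assms[unfolded frechet_derivative_works]]]
  by (simp add: pd_def fun_eq_iff)

lemma pd_cong:
  assumes "open S" "u \<in> S" "\<And>v. v \<in> S \<Longrightarrow> f v = g v" "f differentiable (at u)"
  shows "pd i f u = pd i g u"
  unfolding pd_def using frechet_derivative_transform_within_open[OF assms(4,1,2,3)] by simp

lemma pd_const: "pd i (\<lambda>u. c) u = 0"
  by (simp add: pd_def)

lemma pd_diff:
  assumes "f differentiable (at u)" "g differentiable (at u)"
  shows "pd i (\<lambda>u. f u - g u) u = pd i f u - pd i g u"
  using frechet_derivative_at[OF has_derivative_diff[OF assms[unfolded frechet_derivative_works]]]
  by (simp add: pd_def fun_eq_iff)

lemma pd_mult:
  fixes f g :: "real^'n \<Rightarrow> real"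
  assumes "f differentiable (at u)" "g differentiable (at u)"
  shows "pd i (\<lambda>u. f u * g u) u = f u * pd i g u + pd i f u * g u"
  using pd_scaleR[OF assms] by simp

text \<open>
  The second difference over a small parallelogram does not depend on the order of its sides, whereas
  the mean value theorem, applied first in one direction and then in the other, writes it as an
  iterated derivative. Symmetry of second derivatives follows by exchanging \<open>v\<close> and \<open>w\<close>.
\<close>

lemma second_difference_mvt:
  fixes f :: "'a::real_normed_vector \<Rightarrow> real"
  assumes f: "\<And>z. z \<in> S \<Longrightarrow> (f has_derivative f' z) (at z)"
    and fv: "\<And>z. z \<in> S \<Longrightarrow> ((\<lambda>z. f' z v) has_derivative g z) (at z)"
    and inS: "\<And>s t. 0 \<le> s \<Longrightarrow> s \<le> h \<Longrightarrow> 0 \<le> t \<Longrightarrow> t \<le> h \<Longrightarrow> x + s *\<^sub>R v + t *\<^sub>R w \<in> S"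
    and h: "h > 0"
  obtains s t where "0 < s" "s < h" "0 < t" "t < h"
    "f (x + h *\<^sub>R v + h *\<^sub>R w) - f (x + h *\<^sub>R v) - f (x + h *\<^sub>R w) + f x
       = h * (h * g (x + s *\<^sub>R v + t *\<^sub>R w) w)"
proof -
  define d where "d = (\<lambda>s. f (x + s *\<^sub>R v + h *\<^sub>R w) - f (x + s *\<^sub>R v + 0 *\<^sub>R w))"
  define d' where "d' = (\<lambda>s. f' (x + s *\<^sub>R v + h *\<^sub>R w) v - f' (x + s *\<^sub>R v + 0 *\<^sub>R w) v)"
  have D1: "((\<lambda>s. f (x + s *\<^sub>R v + t *\<^sub>R w)) has_real_derivative f' (x + s *\<^sub>R v + t *\<^sub>R w) v) (at s)"
    if "0 \<le> s" "s \<le> h" "0 \<le> t" "t \<le> h" for s t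
  proof -
    have "((\<lambda>s. x + s *\<^sub>R v + t *\<^sub>R w) has_derivative (\<lambda>r. r *\<^sub>R v)) (at s)"
      by (auto intro!: derivative_eq_intros)
    from diff_chain_at[OF this f[OF inS[OF that]]]
    have "((\<lambda>s. f (x + s *\<^sub>R v + t *\<^sub>R w)) has_derivative (\<lambda>r. f' (x + s *\<^sub>R v + t *\<^sub>R w) (r *\<^sub>R v))) (at s)"
      by (simp add: o_def)
    moreover have "linear (f' (x + s *\<^sub>R v + t *\<^sub>R w))"
      using f[OF inS[OF that]] has_derivative_linear by blast
    ultimately show ?thesis
      by (simp add: has_field_derivative_def linear_scale mult_commute_abs)
  qed
  have D2: "((\<lambda>t. f' (x + s *\<^sub>R v + t *\<^sub>R w) v) has_real_derivative g (x + s *\<^sub>R v + t *\<^sub>R w) w) (at t)"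
    if "0 \<le> s" "s \<le> h" "0 \<le> t" "t \<le> h" for s t
  proof -
    have "((\<lambda>t. x + s *\<^sub>R v + t *\<^sub>R w) has_derivative (\<lambda>r. r *\<^sub>R w)) (at t)"
      by (auto intro!: derivative_eq_intros)
    from diff_chain_at[OF this fv[OF inS[OF that]]]
    have "((\<lambda>t. f' (x + s *\<^sub>R v + t *\<^sub>R w) v) has_derivative (\<lambda>r. g (x + s *\<^sub>R v + t *\<^sub>R w) (r *\<^sub>R w))) (at t)"
      by (simp add: o_def)
    moreover have "linear (g (x + s *\<^sub>R v + t *\<^sub>R w))"
      using fv[OF inS[OF that]] has_derivative_linear by blast
    ultimately show ?thesis
      by (simp add: has_field_derivative_def linear_scale mult_commute_abs)
  qed
  have d: "(d has_real_derivative d' s) (at s)" if "0 \<le> s" "s \<le> h" for s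
    using DERIV_diff[OF D1[of s h] D1[of s 0]] that h by (simp add: d_def d'_def)
  obtain s where s: "0 < s" "s < h" "d h - d 0 = h * d' s"
    using MVT2[of 0 h d d', OF h d] by auto
  define k where "k = (\<lambda>t. f' (x + s *\<^sub>R v + t *\<^sub>R w) v)"
  have k: "(k has_real_derivative g (x + s *\<^sub>R v + t *\<^sub>R w) w) (at t)" if "0 \<le> t" "t \<le> h" for t
    using D2[of s t] s that by (simp add: k_def)
  obtain t where "0 < t" "t < h" "k h - k 0 = h * g (x + s *\<^sub>R v + t *\<^sub>R w) w"
    using MVT2[of 0 h k "\<lambda>t. g (x + s *\<^sub>R v + t *\<^sub>R w) w", OF h k] by auto
  with s show ?thesis by (intro that[of s t]) (auto simp: k_def d_def d'_def)
qed

lemma frechet_derivative_inner_left: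
  "f differentiable (at x) \<Longrightarrow>
    frechet_derivative (\<lambda>z. f z \<bullet> b) (at x) v = frechet_derivative f (at x) v \<bullet> b"
  using has_derivative_inner_left[of f "frechet_derivative f (at x)" "at x" b, THEN frechet_derivative_at]
  by (simp add: frechet_derivative_works fun_eq_iff)

lemma smooth_on_commute_frechet_real:
  fixes f :: "'a::euclidean_space \<Rightarrow> real"
  assumes S: "open S" "x \<in> S" and f: "smooth_on S f"
  shows "frechet_derivative (\<lambda>z. frechet_derivative f (at z) v) (at x) w
       = frechet_derivative (\<lambda>z. frechet_derivative f (at z) w) (at x) v" (is "?A x = ?B x")
proof (rule ccontr)
  assume ne: "?A x \<noteq> ?B x"
  define e where "e = \<bar>?A x - ?B x\<bar> / 2"
  have e: "e > 0" using ne by (simp add: e_def)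
  have cA: "continuous_on S ?A" and cB: "continuous_on S ?B"
    by (intro smooth_on_continuous_on smooth_on_frechet_derivative f)+
  obtain d1 where d1: "d1 > 0" "\<And>z. z \<in> S \<Longrightarrow> dist z x < d1 \<Longrightarrow> dist (?A z) (?A x) < e"
    using cA[unfolded continuous_on_iff, rule_format, OF S(2) e] by auto
  obtain d2 where d2: "d2 > 0" "\<And>z. z \<in> S \<Longrightarrow> dist z x < d2 \<Longrightarrow> dist (?B z) (?B x) < e"
    using cB[unfolded continuous_on_iff, rule_format, OF S(2) e] by auto
  obtain r where r: "r > 0" "ball x r \<subseteq> S" using S open_contains_ball by blast
  define q where "q = min r (min d1 d2)"
  define c where "c = norm v + norm w + 1"
  \<comment> \<open>the parallelogram at \<open>x\<close> with sides \<open>h v\<close> and \<open>h w\<close> stays within distance \<open>q\<close> of \<open>x\<close>\<close>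
  define h where "h = q / (2 * c)"
  have q: "q > 0" using r d1 d2 by (simp add: q_def)
  have nn: "c > 0" by (simp add: c_def add_nonneg_pos)
  then have h: "h > 0" using q by (simp add: h_def)
  have near: "dist (x + s *\<^sub>R v + t *\<^sub>R w) x < q" if "0 \<le> s" "s \<le> h" "0 \<le> t" "t \<le> h" for s t
  proof -
    have "norm (s *\<^sub>R v + t *\<^sub>R w) \<le> s * norm v + t * norm w"
      using that norm_triangle_ineq[of "s *\<^sub>R v" "t *\<^sub>R w"] by simp
    also have "\<dots> \<le> h * norm v + h * norm w"
      using that by (intro add_mono mult_right_mono) auto
    also have "\<dots> < 2 * h * c" using h by (auto simp: c_def algebra_simps intro!: add_nonneg_pos)
    also have "\<dots> = q" using nn by (simp add: h_def)
    finally show ?thesis by (simp add: dist_norm add.assoc)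
  qed
  have inS: "x + s *\<^sub>R v + t *\<^sub>R w \<in> S" if "0 \<le> s" "s \<le> h" "0 \<le> t" "t \<le> h" for s t
    using near[OF that] r(2) by (auto simp: q_def dist_commute subset_iff)
  have inS': "x + s *\<^sub>R w + t *\<^sub>R v \<in> S" if "0 \<le> s" "s \<le> h" "0 \<le> t" "t \<le> h" for s t
    using inS[of t s] that by (simp add: algebra_simps)
  have D: "(f has_derivative frechet_derivative f (at z)) (at z)" if "z \<in> S" for z
    using smooth_on_differentiable[OF f that] by (simp add: frechet_derivative_works)
  have D': "((\<lambda>z. frechet_derivative f (at z) v) has_derivative
      frechet_derivative (\<lambda>z. frechet_derivative f (at z) v) (at z)) (at z)" if "z \<in> S" for z v
    using smooth_on_differentiable[OF smooth_on_frechet_derivative[OF f] that] by (simp add: frechet_derivative_works)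
  obtain s t where st: "0 < s" "s < h" "0 < t" "t < h"
    "f (x + h *\<^sub>R v + h *\<^sub>R w) - f (x + h *\<^sub>R v) - f (x + h *\<^sub>R w) + f x = h * (h * ?A (x + s *\<^sub>R v + t *\<^sub>R w))"
    using second_difference_mvt[where f = f and f' = "\<lambda>z. frechet_derivative f (at z)" and v = v and w = w
      and g = "\<lambda>z. frechet_derivative (\<lambda>z. frechet_derivative f (at z) v) (at z)", OF D D' inS h] by blast
  obtain s' t' where st': "0 < s'" "s' < h" "0 < t'" "t' < h"
    "f (x + h *\<^sub>R w + h *\<^sub>R v) - f (x + h *\<^sub>R w) - f (x + h *\<^sub>R v) + f x = h * (h * ?B (x + s' *\<^sub>R w + t' *\<^sub>R v))"
    using second_difference_mvt[where f = f and f' = "\<lambda>z. frechet_derivative f (at z)" and v = w and w = v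
      and g = "\<lambda>z. frechet_derivative (\<lambda>z. frechet_derivative f (at z) w) (at z)", OF D D' inS' h] by blast
  have "h * (h * ?A (x + s *\<^sub>R v + t *\<^sub>R w)) = h * (h * ?B (x + t' *\<^sub>R v + s' *\<^sub>R w))"
    using st(5) st'(5) by (simp add: algebra_simps)
  then have "?A (x + s *\<^sub>R v + t *\<^sub>R w) = ?B (x + t' *\<^sub>R v + s' *\<^sub>R w)" using h by simp
  moreover have "dist (?A (x + s *\<^sub>R v + t *\<^sub>R w)) (?A x) < e"
    using inS[of s t] near[of s t] st by (intro d1(2)) (auto simp: q_def)
  moreover have "dist (?B (x + t' *\<^sub>R v + s' *\<^sub>R w)) (?B x) < e"
    using inS[of t' s'] near[of t' s'] st' by (intro d2(2)) (auto simp: q_def)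
  ultimately have "dist (?A x) (?B x) < 2 * e"
    using dist_triangle_less_add[of "?A x" "?A (x + s *\<^sub>R v + t *\<^sub>R w)" e "?B x" e]
    by (simp add: dist_commute)
  then show False by (simp add: e_def dist_real_def)
qed

lemma smooth_on_commute_frechet:
  fixes f :: "'a::euclidean_space \<Rightarrow> 'b::euclidean_space"
  assumes S: "open S" "x \<in> S" and f: "smooth_on S f"
  shows "frechet_derivative (\<lambda>z. frechet_derivative f (at z) v) (at x) w
       = frechet_derivative (\<lambda>z. frechet_derivative f (at z) w) (at x) v"
proof (rule euclidean_eqI)
  fix b :: 'b assume "b \<in> Basis"
  have eq: "frechet_derivative (\<lambda>z. frechet_derivative f (at z) v) (at x) w \<bullet> b
    = frechet_derivative (\<lambda>z. frechet_derivative (\<lambda>z. f z \<bullet> b) (at z) v) (at x) w" for v w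
  proof -
    have "frechet_derivative (\<lambda>z. frechet_derivative f (at z) v) (at x) w \<bullet> b
      = frechet_derivative (\<lambda>z. frechet_derivative f (at z) v \<bullet> b) (at x) w"
      by (rule frechet_derivative_inner_left[symmetric], rule smooth_on_differentiable)
        (auto intro: smooth_on_frechet_derivative f S)
    also have "\<dots> = frechet_derivative (\<lambda>z. frechet_derivative (\<lambda>z. f z \<bullet> b) (at z) v) (at x) w"
    proof (rule fun_cong[OF frechet_derivative_transform_within_open[OF _ S]])
      show "(\<lambda>z. frechet_derivative f (at z) v \<bullet> b) differentiable at x"
        by (rule smooth_on_differentiable[OF smooth_on_inner])
          (auto intro: smooth_on_frechet_derivative f S smooth_on_const)
    qed (simp add: frechet_derivative_inner_left smooth_on_differentiable[OF f])
    finally show ?thesis .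
  qed
  show "frechet_derivative (\<lambda>z. frechet_derivative f (at z) v) (at x) w \<bullet> b
    = frechet_derivative (\<lambda>z. frechet_derivative f (at z) w) (at x) v \<bullet> b"
    unfolding eq by (rule smooth_on_commute_frechet_real[OF S smooth_on_inner[OF S(1) f smooth_on_const]])
qed

lemma pd_commute: "open S \<Longrightarrow> u \<in> S \<Longrightarrow> smooth_on S f \<Longrightarrow> pd i (pd j f) u = pd j (pd i f) u"
  unfolding pd_def[abs_def] by (rule smooth_on_commute_frechet)

section \<open>Charts, transition maps and the area density\<close>

lemma atlas_chart:
  assumes "smooth_atlas A" "(U, x) \<in> A"
  shows "open U" "open (x ` U)" "inj_on x U" "continuous_on U x" "continuous_on (x ` U) (inv_into U x)"
proof -
  have *: "open U" "open (x ` U)" "homeomorphism U (x ` U) x (inv_into U x)"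
    using assms unfolding smooth_atlas_def by blast+
  then show "open U" "open (x ` U)" "continuous_on U x" "continuous_on (x ` U) (inv_into U x)"
    by (auto simp: homeomorphism_def)
  show "inj_on x U" using *(3) by (metis homeomorphism_def inj_on_inverseI)
qed

lemma atlas_overlap:
  assumes "smooth_atlas A" "(U, x) \<in> A" "(V, y) \<in> A"
  shows "open (U \<inter> x -` (y ` V))"
    and "smooth_on (U \<inter> x -` (y ` V)) (inv_into V y \<circ> x)"
proof -
  show "open (U \<inter> x -` (y ` V))"
    using atlas_chart[OF assms(1,2)] atlas_chart[OF assms(1,3)] by (simp add: continuous_open_preimage)
  show "smooth_on (U \<inter> x -` (y ` V)) (inv_into V y \<circ> x)"
    using assms unfolding smooth_atlas_def by blast
qed

text \<open>
  The chain rule for \<open>f \<circ> x = (f \<circ> y) \<circ> T\<close>, where \<open>T\<close> is the transition map. The equation holds only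
  on the overlap of the charts, which is open.
\<close>

lemma frechet_derivative_transition:
  assumes A: "smooth_atlas A" "(U, x) \<in> A" "(V, y) \<in> A" and f: "smooth_on V (f \<circ> y)"
    and u: "u \<in> U" "x u \<in> y ` V"
  defines "T \<equiv> inv_into V y \<circ> x"
  shows "T u \<in> V" "y (T u) = x u" "(T has_derivative frechet_derivative T (at u)) (at u)"
    "((f \<circ> x) has_derivative frechet_derivative (f \<circ> y) (at (T u)) \<circ> frechet_derivative T (at u)) (at u)"
proof -
  let ?O = "U \<inter> x -` (y ` V)"
  have TV: "T w \<in> V" "y (T w) = x w" if "w \<in> ?O" for w
    using that by (auto simp: T_def inv_into_into f_inv_into_f)
  show TuV: "T u \<in> V" and "y (T u) = x u" using TV[of u] u by auto
  show dT: "(T has_derivative frechet_derivative T (at u)) (at u)"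
    using smooth_on_differentiable[OF atlas_overlap(2)[OF A], of u] u
    by (simp add: T_def frechet_derivative_works[symmetric])
  have "((f \<circ> y) has_derivative frechet_derivative (f \<circ> y) (at (T u))) (at (T u))"
    using smooth_on_differentiable[OF f TuV] by (simp add: frechet_derivative_works[symmetric])
  from diff_chain_at[OF dT this]
  show "((f \<circ> x) has_derivative frechet_derivative (f \<circ> y) (at (T u)) \<circ> frechet_derivative T (at u)) (at u)"
    by (rule has_derivative_transform_within_open[OF _ atlas_overlap(1)[OF A]]) (use u TV in auto)
qed

lemma pd_transition:
  assumes A: "smooth_atlas A" "(U, x) \<in> A" "(V, y) \<in> A" and f: "smooth_on V (f \<circ> y)"
    and u: "u \<in> U" "x u \<in> y ` V"
  defines "T \<equiv> inv_into V y \<circ> x"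
  shows "pd i (f \<circ> x) u = frechet_derivative T (at u) (axis i 1) $ 1 *\<^sub>R pd 1 (f \<circ> y) (T u)
    + frechet_derivative T (at u) (axis i 1) $ 2 *\<^sub>R pd 2 (f \<circ> y) (T u)"
proof -
  note d = frechet_derivative_transition[OF A f u, folded T_def]
  define a where "a = frechet_derivative T (at u) (axis i 1)"
  have "(f \<circ> y) differentiable (at (T u))" using smooth_on_differentiable[OF f d(1)] .
  then have lin: "linear (frechet_derivative (f \<circ> y) (at (T u)))" by (rule linear_frechet_derivative)
  have a: "a = a $ 1 *\<^sub>R axis 1 1 + a $ 2 *\<^sub>R axis 2 1"
    by (simp add: vec_eq_iff forall_2 axis_def)
  have "frechet_derivative (f \<circ> y) (at (T u)) (a $ 1 *\<^sub>R axis 1 1 + a $ 2 *\<^sub>R axis 2 1) =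
    a $ 1 *\<^sub>R pd 1 (f \<circ> y) (T u) + a $ 2 *\<^sub>R pd 2 (f \<circ> y) (T u)"
    by (simp only: linear_add[OF lin] linear_scale[OF lin] pd_def)
  then have "frechet_derivative (f \<circ> y) (at (T u)) a =
    a $ 1 *\<^sub>R pd 1 (f \<circ> y) (T u) + a $ 2 *\<^sub>R pd 2 (f \<circ> y) (T u)"
    unfolding a[symmetric] .
  moreover have "pd i (f \<circ> x) u = frechet_derivative (f \<circ> y) (at (T u)) a"
    using frechet_derivative_at[OF d(4), THEN fun_cong, of "axis i 1"] by (simp add: pd_def a_def)
  ultimately show ?thesis by (simp add: a_def)
qed

definition area_density :: "(real^2 \<Rightarrow> 'b::euclidean_space) \<Rightarrow> real^2 \<Rightarrow> real" where
  "area_density X u = sqrt (det (first_form X u))"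

lemma det_first_form:
  "det (first_form X u) = (pd 1 X u \<bullet> pd 1 X u) * (pd 2 X u \<bullet> pd 2 X u) - (pd 1 X u \<bullet> pd 2 X u)\<^sup>2"
  by (simp add: first_form_def det_2 power2_eq_square inner_commute)

text \<open>
  Strict Cauchy-Schwarz inequality: the determinant is the squared length of the component of the
  first coordinate vector orthogonal to the second, up to a positive factor.
\<close>

lemma det_first_form_pos:
  assumes "X differentiable (at u)" "inj (frechet_derivative X (at u))"
  shows "det (first_form X u) > 0"
proof -
  let ?X1 = "pd 1 X u" and ?X2 = "pd 2 X u"
  let ?D = "frechet_derivative X (at u)"
  \<comment> \<open>the plane vector whose image is the first coordinate vector made orthogonal to the second\<close>
  define a where "a = (?X2 \<bullet> ?X2) *\<^sub>R axis 1 1 - (?X1 \<bullet> ?X2) *\<^sub>R (axis 2 1 :: real^2)"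
  have lin: "linear ?D" using assms(1) by (rule linear_frechet_derivative)
  have inj0: "?D v = 0 \<Longrightarrow> v = 0" for v using assms(2) lin by (metis injD linear_0)
  have "axis 2 1 \<noteq> (0::real^2)" by simp
  then have X2: "?X2 \<noteq> 0" using inj0[of "axis 2 1"] by (auto simp: pd_def)
  then have "a $ 1 \<noteq> 0" by (simp add: a_def axis_def)
  then have "a \<noteq> 0" by auto
  then have "?D a \<noteq> 0" using inj0[of a] by auto
  moreover have "?D a = (?X2 \<bullet> ?X2) *\<^sub>R ?X1 - (?X1 \<bullet> ?X2) *\<^sub>R ?X2"
    by (simp add: a_def linear_diff[OF lin] linear_scale[OF lin] pd_def)
  ultimately have "0 < ((?X2 \<bullet> ?X2) *\<^sub>R ?X1 - (?X1 \<bullet> ?X2) *\<^sub>R ?X2) \<bullet> ((?X2 \<bullet> ?X2) *\<^sub>R ?X1 - (?X1 \<bullet> ?X2) *\<^sub>R ?X2)"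
    by simp
  also have "\<dots> = (?X2 \<bullet> ?X2) * det (first_form X u)"
    unfolding det_first_form by (simp add: inner_diff_left inner_diff_right inner_commute algebra_simps power2_eq_square)
  finally show ?thesis using inner_ge_zero[of ?X2] by (simp add: zero_less_mult_iff)
qed

lemma immersion_chart:
  assumes "immersion A F" "(U, x) \<in> A"
  shows "smooth_on U (F \<circ> x)" "\<And>u. u \<in> U \<Longrightarrow> det (first_form (F \<circ> x) u) > 0"
    "\<And>u. u \<in> U \<Longrightarrow> area_density (F \<circ> x) u > 0"
proof -
  show s: "smooth_on U (F \<circ> x)" using assms unfolding immersion_def smooth_map_def by blast
  show *: "det (first_form (F \<circ> x) u) > 0" if "u \<in> U" for u
    by (rule det_first_form_pos)
      (use assms that smooth_on_differentiable[OF s] in \<open>auto simp: immersion_def\<close>)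
  then show "area_density (F \<circ> x) u > 0" if "u \<in> U" for u
    using that by (simp add: area_density_def)
qed

lemma smooth_on_det_first_form:
  "open U \<Longrightarrow> smooth_on U X \<Longrightarrow> smooth_on U (\<lambda>u. det (first_form X u))"
  unfolding det_first_form power2_eq_square
  by (intro smooth_on_diff smooth_on_mult smooth_on_inner smooth_on_pd)

lemma continuous_on_area_density:
  "open U \<Longrightarrow> smooth_on U X \<Longrightarrow> continuous_on U (area_density X)"
  unfolding area_density_def[abs_def]
  by (intro continuous_on_real_sqrt smooth_on_continuous_on smooth_on_det_first_form)

text \<open>
  The metric transforms as \<open>J\<^sup>T g J\<close> with the Jacobian matrix \<open>J\<close> of the transition map.
\<close>

lemma det_first_form_transition:
  assumes A: "smooth_atlas A" "(U, x) \<in> A" "(V, y) \<in> A" and F: "smooth_on V (F \<circ> y)"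
    and u: "u \<in> U" "x u \<in> y ` V"
  defines "T \<equiv> inv_into V y \<circ> x"
  shows "det (first_form (F \<circ> x) u) = (det (matrix (frechet_derivative T (at u))))\<^sup>2 * det (first_form (F \<circ> y) (T u))"
  unfolding det_first_form pd_transition[OF A F u, folded T_def]
  unfolding det_2 matrix_def inner_add_left inner_add_right inner_scaleR_left inner_scaleR_right
  by (simp add: inner_commute power2_eq_square algebra_simps)

lemma area_density_transition:
  assumes A: "smooth_atlas A" "(U, x) \<in> A" "(V, y) \<in> A" and F: "smooth_on V (F \<circ> y)"
    and u: "u \<in> U" "x u \<in> y ` V"
  shows "area_density (F \<circ> x) u = \<bar>det (matrix (frechet_derivative (inv_into V y \<circ> x) (at u)))\<bar>
    * area_density (F \<circ> y) ((inv_into V y \<circ> x) u)"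
  unfolding area_density_def det_first_form_transition[OF A F u]
  by (simp add: real_sqrt_mult)

lemma area_density_sq: "det (first_form X u) > 0 \<Longrightarrow> (area_density X u)\<^sup>2 = det (first_form X u)"
  by (simp add: area_density_def)

lemma smooth_on_inverse_area_density:
  assumes "open U" "smooth_on U X" "\<And>u. u \<in> U \<Longrightarrow> det (first_form X u) > 0"
  shows "smooth_on U (\<lambda>u. 1 / area_density X u)"
proof -
  have s: "smooth_on U (\<lambda>u. det (first_form X u) powr (- (1/2)))"
    by (rule smooth_on_powr_compose[OF assms(1) smooth_on_det_first_form[OF assms(1,2)] assms(3)])
  have "det (first_form X u) powr (- (1/2)) = 1 / area_density X u" if "u \<in> U" for u
    using assms(3)[OF that] by (simp add: area_density_def powr_minus_divide powr_half_sqrt)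
  from smooth_on_cong[OF assms(1) this s] show ?thesis .
qed

lemma smooth_on_area_density:
  assumes "open U" "smooth_on U X" "\<And>u. u \<in> U \<Longrightarrow> det (first_form X u) > 0"
  shows "smooth_on U (area_density X)"
proof -
  have s: "smooth_on U (\<lambda>u. det (first_form X u) powr (1/2))"
    by (rule smooth_on_powr_compose[OF assms(1) smooth_on_det_first_form[OF assms(1,2)] assms(3)])
  have "det (first_form X u) powr (1/2) = area_density X u" if "u \<in> U" for u
    using assms(3)[OF that] by (simp add: area_density_def powr_half_sqrt)
  from smooth_on_cong[OF assms(1) this s] show ?thesis .
qed

section \<open>The area measure in a chart\<close>

text \<open>
  Lets the change of variables formula, which is about gauge integrals of integrable functions, be
  used for measures, whose values may be infinite.
\<close>

lemma nn_integral_lborel_eq_henstock: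
  fixes h :: "'a::euclidean_space \<Rightarrow> real"
  assumes "h \<in> borel_measurable borel" "\<And>u. 0 \<le> h u"
  shows "(\<integral>\<^sup>+u. ennreal (h u) \<partial>lborel) = (if h integrable_on UNIV then ennreal (integral UNIV h) else \<infinity>)"
proof (cases "h integrable_on UNIV")
  case True
  then show ?thesis
    using nn_integral_has_integral_lborel[OF assms, of "integral UNIV h"] by (simp add: has_integral_integral)
next
  case False
  then have "\<not> (\<integral>\<^sup>+u. ennreal (h u) \<partial>lborel) < \<infinity>"
    using nn_integral_integrable_on[OF assms] by blast
  with False show ?thesis by (simp add: less_top[symmetric])
qed

lemma nn_integral_change_of_variables:
  fixes g :: "real^'n::{finite,wellorder} \<Rightarrow> real^'n::_" and f :: "real^'n::_ \<Rightarrow> real"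
  assumes E: "E \<in> sets borel" and der: "\<And>u. u \<in> E \<Longrightarrow> (g has_derivative g' u) (at u within E)"
    and inj: "inj_on g E"
    and m1: "(\<lambda>u. indicator E u * (\<bar>det (matrix (g' u))\<bar> * f (g u))) \<in> borel_measurable borel"
    and m2: "(\<lambda>v. indicator (g ` E) v * f v) \<in> borel_measurable borel"
    and nonneg: "\<And>v. v \<in> g ` E \<Longrightarrow> 0 \<le> f v"
  shows "(\<integral>\<^sup>+u. ennreal (indicator E u * (\<bar>det (matrix (g' u))\<bar> * f (g u))) \<partial>lborel)
    = (\<integral>\<^sup>+v. ennreal (indicator (g ` E) v * f v) \<partial>lborel)"
proof -
  let ?l = "\<lambda>u. \<bar>det (matrix (g' u))\<bar> * f (g u)"
  have UN: "(\<lambda>u. indicator S u * k u) integrable_on UNIV \<longleftrightarrow> k absolutely_integrable_on S"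
       "integral UNIV (\<lambda>u. indicator S u * k u) = integral S k"
    if "\<And>u. u \<in> S \<Longrightarrow> 0 \<le> k u" for S and k :: "real^'n::_ \<Rightarrow> real"
  proof -
    have e: "(\<lambda>u. indicator S u * k u) = (\<lambda>u. if u \<in> S then k u else 0)" by (auto simp: fun_eq_iff)
    show "(\<lambda>u. indicator S u * k u) integrable_on UNIV \<longleftrightarrow> k absolutely_integrable_on S"
      unfolding e integrable_restrict_UNIV
      using that absolutely_integrable_on_def nonnegative_absolutely_integrable_1 by blast
    show "integral UNIV (\<lambda>u. indicator S u * k u) = integral S k"
      unfolding e integral_restrict_UNIV ..
  qed
  have l0: "0 \<le> ?l u" if "u \<in> E" for u using nonneg that by simp
  have cov: "(?l absolutely_integrable_on E \<and> integral E ?l = b) \<longleftrightarrow>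
     (f absolutely_integrable_on (g ` E) \<and> integral (g ` E) f = b)" for b
  proof -
    have "E \<in> sets lebesgue" using E by simp
    from has_absolute_integral_change_of_variables[OF this der inj, of "\<lambda>v. vec (f v) :: real^1" "vec b"]
    show ?thesis
      unfolding absolutely_integrable_on_1_iff integral_on_1_eq
      by (simp add: absolutely_integrable_on_1_iff vec_eq_iff)
  qed
  have "?l absolutely_integrable_on E \<longleftrightarrow> f absolutely_integrable_on (g ` E)"
    and "f absolutely_integrable_on (g ` E) \<Longrightarrow> integral E ?l = integral (g ` E) f"
    using cov by blast+
  then show ?thesis
    using UN[OF l0] UN[of "g ` E" f, OF nonneg] m1 m2 l0 nonneg
    by (subst (1 2) nn_integral_lborel_eq_henstock) (auto simp: indicator_def split: if_splits)
qed

text \<open>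
  The members of the family whose supremum is the area measure.
\<close>

definition chart_area_measure :: "('m::{t2_space,second_countable_topology} \<Rightarrow> 'b::euclidean_space) \<Rightarrow>
    (real^2) set \<Rightarrow> (real^2 \<Rightarrow> 'm) \<Rightarrow> 'm measure" where
  "chart_area_measure F U x =
     distr (density (restrict_space lborel U) (\<lambda>u. ennreal (area_density (F \<circ> x) u))) borel x"

lemma area_measure_eq: "area_measure A F = (SUP (U, x)\<in>A. chart_area_measure F U x)"
  by (simp add: area_measure_def chart_area_measure_def area_density_def)

lemma sets_chart_area_measure [simp]: "sets (chart_area_measure F U x) = sets borel"
  and space_chart_area_measure [simp]: "space (chart_area_measure F U x) = UNIV"
  by (simp_all add: chart_area_measure_def)

lemma measurable_chart:
  assumes "smooth_atlas A" "immersion A F" "(U, x) \<in> A"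
  shows "x \<in> restrict_space lborel U \<rightarrow>\<^sub>M borel"
    and "area_density (F \<circ> x) \<in> borel_measurable (restrict_space lborel U)"
proof -
  have *: "restrict_space lborel U \<rightarrow>\<^sub>M (borel :: 'z::topological_space measure) = restrict_space borel U \<rightarrow>\<^sub>M borel"
    by (rule measurable_cong_sets) (simp_all add: sets_restrict_space)
  show "x \<in> restrict_space lborel U \<rightarrow>\<^sub>M borel"
    unfolding * by (rule borel_measurable_continuous_on_restrict[OF atlas_chart(4)[OF assms(1,3)]])
  show "area_density (F \<circ> x) \<in> borel_measurable (restrict_space lborel U)"
    unfolding * by (intro borel_measurable_continuous_on_restrict continuous_on_area_density
      atlas_chart(1)[OF assms(1,3)] immersion_chart(1)[OF assms(2,3)])
qed

lemma borel_chart_preimage: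
  assumes "smooth_atlas A" "(U, x) \<in> A" "S \<in> sets borel"
  shows "U \<inter> x -` S \<in> sets borel"
proof -
  have "x \<in> restrict_space borel U \<rightarrow>\<^sub>M borel"
    by (rule borel_measurable_continuous_on_restrict[OF atlas_chart(4)[OF assms(1,2)]])
  from measurable_sets[OF this assms(3)] have "x -` S \<inter> U \<in> sets (restrict_space borel U)"
    by (simp add: space_restrict_space)
  then show ?thesis
    using atlas_chart(1)[OF assms(1,2)] by (simp add: sets_restrict_space_iff Int_commute)
qed

lemma emeasure_chart_area_measure:
  assumes "smooth_atlas A" "immersion A F" "(U, x) \<in> A" and S: "S \<in> sets borel"
  shows "emeasure (chart_area_measure F U x) S =
    (\<integral>\<^sup>+u. ennreal (indicator (U \<inter> x -` S) u * area_density (F \<circ> x) u) \<partial>lborel)"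
proof -
  let ?R = "restrict_space lborel U"
  note [measurable] = measurable_chart[OF assms(1-3)]
  have U: "open U" using atlas_chart(1)[OF assms(1,3)] .
  have "emeasure (chart_area_measure F U x) S =
      emeasure (density ?R (\<lambda>u. ennreal (area_density (F \<circ> x) u))) (x -` S \<inter> U)"
    unfolding chart_area_measure_def using S by (subst emeasure_distr) (auto simp: space_restrict_space)
  also have "\<dots> = (\<integral>\<^sup>+u. ennreal (area_density (F \<circ> x) u) * indicator (x -` S \<inter> U) u \<partial>?R)"
    using measurable_sets[OF measurable_chart(1)[OF assms(1-3)] S]
    by (subst emeasure_density) (auto simp: space_restrict_space)
  also have "\<dots> = (\<integral>\<^sup>+u. ennreal (area_density (F \<circ> x) u) * indicator (x -` S \<inter> U) u * indicator U u \<partial>lborel)"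
    using U by (subst nn_integral_restrict_space) auto
  also have "\<dots> = (\<integral>\<^sup>+u. ennreal (indicator (U \<inter> x -` S) u * area_density (F \<circ> x) u) \<partial>lborel)"
    by (intro nn_integral_cong) (auto simp: indicator_def)
  finally show ?thesis .
qed

text \<open>
  The densities are related by the absolute value of the Jacobian determinant of the transition
  map, so this is the change of variables formula on the overlap.
\<close>

lemma chart_area_measure_agree:
  assumes A: "smooth_atlas A" "(U, x) \<in> A" "(V, y) \<in> A" and F: "immersion A F"
    and S: "S \<in> sets borel" "S \<subseteq> x ` U \<inter> y ` V"
  shows "emeasure (chart_area_measure F U x) S = emeasure (chart_area_measure F V y) S"
proof -
  define T where "T = inv_into V y \<circ> x"
  let ?E = "U \<inter> x -` S"
  note cx = atlas_chart[OF A(1,2)] and cy = atlas_chart[OF A(1,3)]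
  have inE: "u \<in> U" "x u \<in> y ` V" if "u \<in> ?E" for u using that S(2) by auto
  note tr = frechet_derivative_transition[OF A immersion_chart(1)[OF F A(3)], folded T_def]
  have E: "?E \<in> sets borel" "V \<inter> y -` S \<in> sets borel"
    using borel_chart_preimage[OF A(1,2) S(1)] borel_chart_preimage[OF A(1,3) S(1)] by auto
  have TE: "T ` ?E = V \<inter> y -` S"
  proof
    show "T ` ?E \<subseteq> V \<inter> y -` S" using tr(1,2) inE by auto
    show "V \<inter> y -` S \<subseteq> T ` ?E"
    proof
      fix v assume v: "v \<in> V \<inter> y -` S"
      then obtain u where u: "u \<in> U" "x u = y v" using S(2) by fastforce
      then have "T u = v" using v cy(3) by (simp add: T_def)
      then show "v \<in> T ` ?E" using u v by force
    qed
  qed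
  have inj: "inj_on T ?E"
  proof (rule inj_onI)
    fix u w assume "u \<in> ?E" "w \<in> ?E" "T u = T w"
    then have "x u = x w" using tr(2) inE by metis
    then show "u = w" using \<open>u \<in> ?E\<close> \<open>w \<in> ?E\<close> cx(3) by (auto dest: inj_onD)
  qed
  have rel: "area_density (F \<circ> x) u = \<bar>det (matrix (frechet_derivative T (at u)))\<bar> * area_density (F \<circ> y) (T u)"
    if "u \<in> ?E" for u
    using area_density_transition[OF A immersion_chart(1)[OF F A(3)] inE[OF that]] by (simp add: T_def)
  have m: "(\<lambda>u. indicator D u * area_density (F \<circ> z) u) \<in> borel_measurable borel"
    if "D \<in> sets borel" "D \<subseteq> Z" "(Z, z) \<in> A" for D Z z
    using borel_measurable_continuous_on_indicator[OF that(1)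
        continuous_on_subset[OF continuous_on_area_density that(2)], OF atlas_chart(1) immersion_chart(1)]
      A(1) F that(3) by simp
  have eq: "indicator ?E u * area_density (F \<circ> x) u =
     indicator ?E u * (\<bar>det (matrix (frechet_derivative T (at u)))\<bar> * area_density (F \<circ> y) (T u))" for u
    using rel by (auto simp: indicator_def)
  have "(\<integral>\<^sup>+u. ennreal (indicator ?E u * area_density (F \<circ> x) u) \<partial>lborel) =
    (\<integral>\<^sup>+v. ennreal (indicator (T ` ?E) v * area_density (F \<circ> y) v) \<partial>lborel)"
    unfolding eq
  proof (rule nn_integral_change_of_variables[OF E(1) _ inj])
    show "(T has_derivative frechet_derivative T (at u)) (at u within ?E)" if "u \<in> ?E" for u
      using tr(3)[OF inE[OF that]] by (rule has_derivative_at_withinI)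
    show "(\<lambda>u. indicator ?E u * (\<bar>det (matrix (frechet_derivative T (at u)))\<bar> * area_density (F \<circ> y) (T u))) \<in> borel_measurable borel"
      unfolding eq[symmetric] using m[OF E(1) _ A(2)] by simp
    show "(\<lambda>v. indicator (T ` ?E) v * area_density (F \<circ> y) v) \<in> borel_measurable borel"
      unfolding TE using m[OF E(2) _ A(3)] by simp
    show "0 \<le> area_density (F \<circ> y) v" if "v \<in> T ` ?E" for v
      using that immersion_chart(3)[OF F A(3), of v] unfolding TE by auto
  qed
  then show ?thesis
    unfolding TE emeasure_chart_area_measure[OF A(1) F A(2) S(1)] emeasure_chart_area_measure[OF A(1) F A(3) S(1)] .
qed

lemma emeasure_chart_area_measure_restrict:
  assumes "smooth_atlas A" "immersion A F" "(U, x) \<in> A" and S: "S \<in> sets borel"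
  shows "emeasure (chart_area_measure F U x) S = emeasure (chart_area_measure F U x) (S \<inter> x ` U)"
proof -
  have "x ` U \<in> sets borel" using atlas_chart(2)[OF assms(1,3)] by simp
  then have S': "S \<inter> x ` U \<in> sets borel" using S by simp
  have "U \<inter> x -` (S \<inter> x ` U) = U \<inter> x -` S" by auto
  then show ?thesis
    unfolding emeasure_chart_area_measure[OF assms] emeasure_chart_area_measure[OF assms(1-3) S'] by simp
qed

text \<open>
  Such a measure is an upper bound for every measure that is at most \<open>M\<close> on subsets of \<open>Q\<close>. It bounds
  a supremum of measures from above on subsets of \<open>Q\<close>.
\<close>

lemma ex_measure_infinite_outside:
  fixes M :: "'a measure"
  assumes Q: "Q \<in> sets M"
  shows "\<exists>N. sets N = sets M \<and> (\<forall>S\<in>sets M. emeasure N S = emeasure M S + (if S \<subseteq> Q then 0 else \<infinity>))"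
proof -
  define \<mu> where "\<mu> = (\<lambda>S. emeasure M S + (if S \<subseteq> Q then 0 else \<infinity> :: ennreal))"
  \<comment> \<open>a countable union lies in \<open>Q\<close> iff all its members do, so both summands are countably additive\<close>
  define N where "N = measure_of (space M) (sets M) \<mu>"
  have sN: "sets N = sets M" by (simp add: N_def)
  have ca: "countably_additive (sets M) \<mu>"
  proof (rule countably_additiveI)
    fix B :: "nat \<Rightarrow> 'a set"
    assume B: "range B \<subseteq> sets M" "disjoint_family B" "(\<Union>i. B i) \<in> sets M"
    have s: "(\<Sum>i. emeasure M (B i)) = emeasure M (\<Union>i. B i)" by (rule suminf_emeasure[OF B(1,2)])
    show "(\<Sum>i. \<mu> (B i)) = \<mu> (\<Union>i. B i)"
    proof (cases "\<forall>i. B i \<subseteq> Q")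
      case True
      then have "(\<Union>i. B i) \<subseteq> Q" by blast
      with True s show ?thesis by (simp add: \<mu>_def)
    next
      case False
      then obtain i where i: "\<not> B i \<subseteq> Q" by blast
      have "\<mu> (B i) \<le> (\<Sum>i. \<mu> (B i))" 
        using sum_le_suminf[of "\<lambda>i. \<mu> (B i)" "{i}"] by (simp add: summableI)
      moreover have "\<mu> (B i) = \<infinity>" using i by (simp add: \<mu>_def)
      moreover have "\<mu> (\<Union>i. B i) = \<infinity>" using i by (auto simp: \<mu>_def)
      ultimately show ?thesis by (simp add: top_unique)
    qed
  qed
  have "emeasure N S = \<mu> S" if "S \<in> sets M" for S
    using emeasure_measure_of_sigma[OF sets.sigma_algebra_axioms _ ca that]
    by (simp add: N_def positive_def \<mu>_def)
  with sN show ?thesis unfolding \<mu>_def by blast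
qed

text \<open>
  Every other chart measure agrees with the one of \<open>(U, x)\<close> on the overlap and vanishes on the rest
  of \<open>x ` U\<close>. Thus all of them lie below the chart measure of \<open>(U, x)\<close> made infinite outside \<open>x ` U\<close>, and
  so does their supremum.
\<close>

lemma emeasure_area_measure:
  assumes A: "smooth_atlas A" "(U, x) \<in> A" and F: "immersion A F"
    and S: "S \<in> sets borel" "S \<subseteq> x ` U"
  shows "emeasure (area_measure A F) S = emeasure (chart_area_measure F U x) S"
proof (rule antisym)
  let ?\<nu> = "\<lambda>(U, x). chart_area_measure F U x"
  have sets_area: "sets (area_measure A F) = sets borel"
    unfolding area_measure_eq using A(2) by (intro sets_SUP) auto
  have "?\<nu> (U, x) \<le> area_measure A F" unfolding area_measure_eq using A(2) by (rule SUP_upper)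
  then show "emeasure (chart_area_measure F U x) S \<le> emeasure (area_measure A F) S"
    by (intro le_measureD3) (auto simp: sets_area)
  have "x ` U \<in> sets (chart_area_measure F U x)" using atlas_chart(2)[OF A] by simp
  from ex_measure_infinite_outside[OF this] obtain N where N: "sets N = sets borel"
    "\<And>S. S \<in> sets borel \<Longrightarrow> emeasure N S = emeasure (chart_area_measure F U x) S + (if S \<subseteq> x ` U then 0 else \<infinity>)"
    by auto
  have "area_measure A F \<le> N"
    unfolding area_measure_eq
  proof (rule SUP_least, clarify)
    fix V y assume V: "(V, y) \<in> A"
    have "emeasure (chart_area_measure F V y) B \<le> emeasure N B" if B: "B \<in> sets borel" for B
    proof (cases "B \<subseteq> x ` U")
      case True
      let ?B = "B \<inter> y ` V"
      have b: "?B \<in> sets borel" using B atlas_chart(2)[OF A(1) V] by simp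
      have "emeasure (chart_area_measure F V y) B = emeasure (chart_area_measure F V y) ?B"
        by (rule emeasure_chart_area_measure_restrict[OF A(1) F V B])
      also have "\<dots> = emeasure (chart_area_measure F U x) ?B"
        by (rule chart_area_measure_agree[OF A(1) V A(2) F b]) (use True in auto)
      also have "\<dots> \<le> emeasure (chart_area_measure F U x) B"
        using B b by (intro emeasure_mono) auto
      finally show ?thesis using True N(2)[OF B] by simp
    qed (simp add: N(2)[OF B])
    then show "chart_area_measure F V y \<le> N" by (simp add: le_measure N(1))
  qed
  then have "emeasure (area_measure A F) S \<le> emeasure N S"
    by (intro le_measureD3) (auto simp: sets_area N(1))
  then show "emeasure (area_measure A F) S \<le> emeasure (chart_area_measure F U x) S"
    using N(2)[OF S(1)] S(2) by simp
qed

text \<open>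
  The restrictions of the area measure and of the chart measure to the compact set \<open>x ` K\<close>
  coincide, and the integral for the latter is pulled back to the plane.
\<close>

lemma area_integral_chart:
  fixes c :: "real^2 \<Rightarrow> real"
  assumes A: "smooth_atlas A" "(U, x) \<in> A" and F: "immersion A F"
    and K: "compact K" "K \<subseteq> U" and c: "continuous_on K c" "\<And>u. u \<in> K \<Longrightarrow> f (x u) = c u"
  shows "set_integrable (area_measure A F) (x ` K) f"
    and "(LINT p:x ` K|area_measure A F. f p) = integral K (\<lambda>u. area_density (F \<circ> x) u * c u)"
proof -
  let ?D = "x ` K"
  let ?M = "area_measure A F" and ?N = "chart_area_measure F U x"
  let ?R = "restrict_space lborel U"
  let ?W = "area_density (F \<circ> x)"
  note ch = atlas_chart[OF A]
  have D: "?D \<subseteq> x ` U" using K by auto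
  have cD: "compact ?D" using K ch(4) by (meson compact_continuous_image continuous_on_subset)
  then have bD: "?D \<in> sets borel" by (simp add: borel_compact)
  have sM: "sets ?M = sets borel" "space ?M = UNIV"
  proof -
    show *: "sets (area_measure A F) = sets borel"
      unfolding area_measure_eq using A(2) by (intro sets_SUP) auto
    show "space ?M = UNIV" using sets_eq_imp_space_eq[OF *] by simp
  qed
  have restr: "restrict_space ?M ?D = restrict_space ?N ?D"
  proof (rule measure_eqI)
    show "sets (restrict_space ?M ?D) = sets (restrict_space ?N ?D)"
      by (simp add: sets_restrict_space sM)
    fix B assume "B \<in> sets (restrict_space ?M ?D)"
    then have B: "B \<in> sets borel" "B \<subseteq> ?D" using bD by (auto simp: sets_restrict_space_iff sM)
    then show "emeasure (restrict_space ?M ?D) B = emeasure (restrict_space ?N ?D) B"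
      using emeasure_area_measure[OF A F B(1)] D bD by (subst (1 2) emeasure_restrict_space) (auto simp: sM)
  qed
  have fD: "continuous_on ?D f"
  proof -
    have "continuous_on ?D (c \<circ> inv_into U x)"
    proof (rule continuous_on_compose)
      show "continuous_on ?D (inv_into U x)" using ch(5) D by (rule continuous_on_subset)
      have "inv_into U x ` ?D = K" using K(2) ch(3) by (auto simp: image_image subset_iff)
      then show "continuous_on (inv_into U x ` ?D) c" using c(1) by simp
    qed
    then show ?thesis
      by (rule continuous_on_eq) (use c(2) K(2) ch(3) in auto)
  qed
  note [measurable] = measurable_chart[OF A(1) F A(2)]
  define h where "h = (\<lambda>p. indicator ?D p *\<^sub>R f p)"
  have h[measurable]: "h \<in> borel_measurable borel"
    unfolding h_def by (rule borel_measurable_continuous_on_indicator[OF bD fD])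
  have hx: "indicator U u * (?W u * h (x u)) = indicator K u * (?W u * c u)" for u
    using K(2) ch(3) c(2) by (auto simp: h_def indicator_def inj_on_eq_iff subset_iff image_iff)
  have cont: "continuous_on K (\<lambda>u. ?W u * c u)"
    using K(2) c(1) continuous_on_area_density[OF ch(1) immersion_chart(1)[OF F A(2)]]
    by (intro continuous_on_mult) (auto intro: continuous_on_subset)
  have iK: "set_integrable lborel K (\<lambda>u. ?W u * c u)" by (rule borel_integrable_compact[OF K(1) cont, folded set_integrable_def])
  have nn: "AE u in ?R. 0 \<le> ?W u"
    using immersion_chart(3)[OF F A(2)] by (intro AE_I2) (auto simp: space_restrict_space less_imp_le)
  have hxm: "(\<lambda>u. h (x u)) \<in> borel_measurable ?R" by measurable
  have "integrable ?R (\<lambda>u. ?W u *\<^sub>R h (x u))"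
    using iK ch(1) by (subst integrable_restrict_space) (auto simp: hx set_integrable_def)
  then have "integrable ?N h"
    unfolding chart_area_measure_def using nn hxm by (subst integrable_distr_eq) (auto simp: integrable_density)
  then have "integrable (restrict_space ?N ?D) f"
    using bD by (subst integrable_restrict_space) (auto simp: h_def)
  then show "set_integrable ?M ?D f"
    using integrable_restrict_space[of ?D ?M f] bD by (simp add: set_integrable_def sM restr)
  have "(LINT p:?D|?M. f p) = integral\<^sup>L (restrict_space ?M ?D) f"
    unfolding set_lebesgue_integral_def using bD by (subst integral_restrict_space) (auto simp: sM)
  also have "\<dots> = integral\<^sup>L ?N h"
    unfolding restr h_def using bD by (subst integral_restrict_space) auto
  also have "\<dots> = integral\<^sup>L (density ?R (\<lambda>u. ennreal (?W u))) (\<lambda>u. h (x u))"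
    unfolding chart_area_measure_def by (subst integral_distr) auto
  also have "\<dots> = integral\<^sup>L ?R (\<lambda>u. ?W u *\<^sub>R h (x u))"
    using nn hxm by (subst integral_density) auto
  also have "\<dots> = (LINT u:K|lborel. ?W u * c u)"
    using ch(1) by (subst integral_restrict_space) (auto simp: hx set_lebesgue_integral_def)
  also have "\<dots> = integral K (\<lambda>u. ?W u * c u)" by (rule set_borel_integral_eq_integral(2)[OF iK])
  finally show "(LINT p:?D|?M. f p) = integral K (\<lambda>u. ?W u * c u)" .
qed

section \<open>The energy density in a chart\<close>

lemma matrix_inv_2x2:
  fixes G :: "real^2^2"
  assumes "det G \<noteq> 0"
  shows "matrix_inv G = (\<chi> i j. (if i = j then (if i = 1 then G $ 2 $ 2 else G $ 1 $ 1) else - G $ i $ j) / det G)"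
    (is "_ = ?H")
proof -
  have d: "G $ 1 $ 1 * G $ 2 $ 2 - G $ 1 $ 2 * G $ 2 $ 1 = det G" by (simp add: det_2)
  have "G ** ?H = mat 1"
    using assms d by (simp add: vec_eq_iff forall_2 matrix_matrix_mult_def sum_2 mat_def field_simps)
  then have HG: "?H ** G = mat 1" by (simp only: matrix_left_right_inverse)
  with \<open>G ** ?H = mat 1\<close> have GI: "G ** matrix_inv G = mat 1 \<and> matrix_inv G ** G = mat 1"
    unfolding matrix_inv_def by (intro someI[where P = "\<lambda>H. G ** H = mat 1 \<and> H ** G = mat 1"]) blast
  have "matrix_inv G = (?H ** G) ** matrix_inv G" by (simp only: HG matrix_mul_lid)
  also have "\<dots> = ?H" by (simp only: matrix_mul_assoc[symmetric] GI matrix_mul_rid)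
  finally show ?thesis .
qed

lemma metric_trace_2:
  assumes "det (first_form X u) \<noteq> 0"
  shows "metric_trace X u b = (1 / det (first_form X u)) *\<^sub>R
    ((pd 2 X u \<bullet> pd 2 X u) *\<^sub>R b 1 1 - (pd 1 X u \<bullet> pd 2 X u) *\<^sub>R (b 1 2 + b 2 1) + (pd 1 X u \<bullet> pd 1 X u) *\<^sub>R b 2 2)"
  unfolding metric_trace_def matrix_inv_2x2[OF assms] sum_2
  by (simp add: first_form_def inner_commute scaleR_add_right scaleR_diff_right divide_inverse mult.commute)

text \<open>
  The polarized energy density \<open>g\<^sup>i\<^sup>j \<langle>\<partial>\<^sub>i f, \<partial>\<^sub>j h\<rangle>\<close>, with the inverse of the metric \<open>g\<close>
  induced by \<open>X\<close> written out.
\<close>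

definition dirichlet_form :: "(real^2 \<Rightarrow> 'b::euclidean_space) \<Rightarrow> (real^2 \<Rightarrow> 'c::euclidean_space) \<Rightarrow> (real^2 \<Rightarrow> 'c) \<Rightarrow> real^2 \<Rightarrow> real" where
  "dirichlet_form X f h u =
    ((pd 2 X u \<bullet> pd 2 X u) * (pd 1 f u \<bullet> pd 1 h u)
      - (pd 1 X u \<bullet> pd 2 X u) * (pd 1 f u \<bullet> pd 2 h u + pd 2 f u \<bullet> pd 1 h u)
      + (pd 1 X u \<bullet> pd 1 X u) * (pd 2 f u \<bullet> pd 2 h u)) / det (first_form X u)"

lemma metric_trace_dirichlet:
  "det (first_form X u) \<noteq> 0 \<Longrightarrow>
    metric_trace X u (\<lambda>i j. pd i f u \<bullet> pd j f u) = dirichlet_form X f f u"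
  by (simp add: metric_trace_2 dirichlet_form_def)

lemma dirichlet_form_transition:
  assumes A: "smooth_atlas A" "(U, x) \<in> A" "(V, y) \<in> A"
    and F: "immersion A F" and f: "smooth_map A f"
    and u: "u \<in> U" "v \<in> V" "y v = x u"
  shows "dirichlet_form (F \<circ> x) (f \<circ> x) (f \<circ> x) u = dirichlet_form (F \<circ> y) (f \<circ> y) (f \<circ> y) v"
proof -
  define T where "T = inv_into V y \<circ> x"
  have T: "T u = v" using u atlas_chart(3)[OF A(1,3)] by (simp add: T_def flip: u(3))
  have xu: "x u \<in> y ` V" using u by force
  have f': "smooth_on V (f \<circ> y)" using f A(3) unfolding smooth_map_def by blast
  note F' = immersion_chart(1)[OF F A(3)]
  let ?d = "frechet_derivative T (at u)"
  have d: "det (first_form (F \<circ> x) u) = (det (matrix ?d))\<^sup>2 * det (first_form (F \<circ> y) v)"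
    using det_first_form_transition[OF A F' u(1) xu] by (simp add: T_def[symmetric] T)
  have nz: "det (matrix ?d) \<noteq> 0"
    using d immersion_chart(2)[OF F A(2) u(1)] by auto
  have nz': "det (first_form (F \<circ> y) v) \<noteq> 0" using immersion_chart(2)[OF F A(3) u(2)] by auto
  have num: "(pd 2 (F \<circ> x) u \<bullet> pd 2 (F \<circ> x) u) * (pd 1 (f \<circ> x) u \<bullet> pd 1 (f \<circ> x) u)
      - (pd 1 (F \<circ> x) u \<bullet> pd 2 (F \<circ> x) u) * (pd 1 (f \<circ> x) u \<bullet> pd 2 (f \<circ> x) u + pd 2 (f \<circ> x) u \<bullet> pd 1 (f \<circ> x) u)
      + (pd 1 (F \<circ> x) u \<bullet> pd 1 (F \<circ> x) u) * (pd 2 (f \<circ> x) u \<bullet> pd 2 (f \<circ> x) u)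
    = (det (matrix ?d))\<^sup>2 * ((pd 2 (F \<circ> y) v \<bullet> pd 2 (F \<circ> y) v) * (pd 1 (f \<circ> y) v \<bullet> pd 1 (f \<circ> y) v)
      - (pd 1 (F \<circ> y) v \<bullet> pd 2 (F \<circ> y) v) * (pd 1 (f \<circ> y) v \<bullet> pd 2 (f \<circ> y) v + pd 2 (f \<circ> y) v \<bullet> pd 1 (f \<circ> y) v)
      + (pd 1 (F \<circ> y) v \<bullet> pd 1 (F \<circ> y) v) * (pd 2 (f \<circ> y) v \<bullet> pd 2 (f \<circ> y) v))"
    unfolding pd_transition[OF A F' u(1) xu, folded T_def] pd_transition[OF A f' u(1) xu, folded T_def] T
    unfolding det_2 matrix_def inner_add_left inner_add_right inner_scaleR_left inner_scaleR_right
    by (simp add: inner_commute[of "pd 2 (F \<circ> y) v" "pd 1 (F \<circ> y) v"] inner_commute[of "pd 2 (f \<circ> y) v" "pd 1 (f \<circ> y) v"])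
       algebra
  show ?thesis
    unfolding dirichlet_form_def num unfolding d using nz nz' by simp
qed

text \<open>
  The definite description denotes the value in any chart, because the energy density is invariant
  under transition maps.
\<close>

lemma norm_diff_sq_chart:
  assumes A: "smooth_atlas A" "(U, x) \<in> A"
    and F: "immersion A F" and f: "smooth_map A f" and u: "u \<in> U"
  shows "norm_diff_sq A F f (x u) = dirichlet_form (F \<circ> x) (f \<circ> x) (f \<circ> x) u"
  unfolding norm_diff_sq_def
proof (rule the_equality)
  have "dirichlet_form (F \<circ> x) (f \<circ> x) (f \<circ> x) u
      = metric_trace (F \<circ> y) v (\<lambda>i j. pd i (f \<circ> y) v \<bullet> pd j (f \<circ> y) v)"
    if "(V, y) \<in> A" "v \<in> V" "y v = x u" for V y v
    using dirichlet_form_transition[OF A that(1) F f u that(2,3)]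
      immersion_chart(2)[OF F that(1,2)] by (simp add: metric_trace_dirichlet)
  then show "\<forall>(V, y)\<in>A. \<forall>v\<in>V. y v = x u \<longrightarrow> dirichlet_form (F \<circ> x) (f \<circ> x) (f \<circ> x) u
      = metric_trace (F \<circ> y) v (\<lambda>i j. pd i (f \<circ> y) v \<bullet> pd j (f \<circ> y) v)"
    by blast
next
  fix e assume "\<forall>(V, y)\<in>A. \<forall>v\<in>V. y v = x u \<longrightarrow> e = metric_trace (F \<circ> y) v (\<lambda>i j. pd i (f \<circ> y) v \<bullet> pd j (f \<circ> y) v)"
  then have "e = metric_trace (F \<circ> x) u (\<lambda>i j. pd i (f \<circ> x) u \<bullet> pd j (f \<circ> x) u)"
    using A(2) u by blast
  then show "e = dirichlet_form (F \<circ> x) (f \<circ> x) (f \<circ> x) u"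
    using immersion_chart(2)[OF F A(2) u] by (simp add: metric_trace_dirichlet)
qed

text \<open>
  The metric is positive definite, hence so is its adjugate, also on pairs of vectors; completing the
  square exhibits this.
\<close>

lemma first_form_semidefinite:
  fixes P Q :: "'c::real_inner"
  assumes "det (first_form X u) > 0"
  shows "0 \<le> (pd 2 X u \<bullet> pd 2 X u) * (P \<bullet> P) - (pd 1 X u \<bullet> pd 2 X u) * (P \<bullet> Q + Q \<bullet> P) + (pd 1 X u \<bullet> pd 1 X u) * (Q \<bullet> Q)"
    (is "0 \<le> ?q")
proof -
  let ?E = "pd 1 X u \<bullet> pd 1 X u" and ?F = "pd 1 X u \<bullet> pd 2 X u" and ?G = "pd 2 X u \<bullet> pd 2 X u"
  have d: "?E * ?G - ?F\<^sup>2 > 0" using assms by (simp add: det_first_form)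
  have G: "?G > 0"
  proof -
    have "?E * ?G > 0" using d zero_le_power2[of ?F] by linarith
    then have "pd 2 X u \<noteq> 0" by (metis inner_zero_left mult_zero_right less_irrefl)
    then show ?thesis by simp
  qed
  have "?G * ?q = (?G *\<^sub>R P - ?F *\<^sub>R Q) \<bullet> (?G *\<^sub>R P - ?F *\<^sub>R Q) + (?E * ?G - ?F\<^sup>2) * (Q \<bullet> Q)"
    unfolding inner_diff_left inner_diff_right inner_scaleR_left inner_scaleR_right
      inner_commute[of Q P] by algebra
  also have "\<dots> \<ge> 0" using d by (intro add_nonneg_nonneg mult_nonneg_nonneg) auto
  finally show ?thesis using G by (simp add: zero_le_mult_iff)
qed

lemma dirichlet_form_nonneg: "det (first_form X u) > 0 \<Longrightarrow> 0 \<le> dirichlet_form X f f u"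
  unfolding dirichlet_form_def
  using first_form_semidefinite[of X u "pd 1 f u" "pd 2 f u"] by (simp add: inner_commute)

text \<open>
  As \<open>G\<close> has unit length it is orthogonal to its own derivatives, so the energy density of \<open>rG\<close>
  splits into those of \<open>G\<close>, times \<open>r\<^sup>2 \<ge> 1\<close>, and of \<open>r\<close>.
\<close>

lemma dirichlet_form_radial_projection:
  assumes X: "det (first_form X u) > 0"
    and r: "r differentiable (at u)" "r u \<ge> 1" and G: "G differentiable (at u)"
    and S: "open S" "u \<in> S" "\<And>v. v \<in> S \<Longrightarrow> G v \<bullet> G v = (1::real)"
  shows "dirichlet_form X G G u \<le> dirichlet_form X (\<lambda>u. r u *\<^sub>R G u) (\<lambda>u. r u *\<^sub>R G u) u"
proof -
  have o: "G u \<bullet> pd i G u = 0" for i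
  proof -
    have "pd i (\<lambda>v. G v \<bullet> G v) u = pd i (\<lambda>v. 1) u"
      by (rule pd_cong[OF S(1,2)]) (simp_all add: S(3) differentiable_inner G)
    then show ?thesis by (simp add: pd_inner[OF G G] pd_const inner_commute)
  qed
  have [simp]: "pd i G u \<bullet> G u = 0" for i using o by (simp add: inner_commute)
  have "dirichlet_form X (\<lambda>u. r u *\<^sub>R G u) (\<lambda>u. r u *\<^sub>R G u) u
     = (r u)\<^sup>2 * dirichlet_form X G G u + dirichlet_form X r r u"
    unfolding dirichlet_form_def pd_scaleR[OF r(1) G] using S(3)[OF S(2)] o
    by (simp add: inner_add_left inner_add_right power2_eq_square add_divide_distrib[symmetric] algebra_simps diff_divide_distrib)
  moreover have "dirichlet_form X G G u \<le> (r u)\<^sup>2 * dirichlet_form X G G u"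
    using mult_right_mono[OF one_le_power[OF r(2)] dirichlet_form_nonneg[OF X, of G], of 2] by simp
  moreover have "0 \<le> dirichlet_form X r r u" by (rule dirichlet_form_nonneg[OF X])
  ultimately show ?thesis by linarith
qed

lemma dirichlet_form_add_scaled:
  assumes "f differentiable (at u)" "h differentiable (at u)"
  shows "dirichlet_form X (\<lambda>u. f u + t *\<^sub>R h u) (\<lambda>u. f u + t *\<^sub>R h u) u
    = dirichlet_form X f f u + 2 * t * dirichlet_form X f h u + t\<^sup>2 * dirichlet_form X h h u"
proof -
  have p: "pd i (\<lambda>u. f u + t *\<^sub>R h u) u = pd i f u + t *\<^sub>R pd i h u" for i
    using assms by (simp add: pd_add pd_scaleR pd_const)
  show ?thesis
    unfolding dirichlet_form_def p
      by (simp add: inner_add_left inner_add_right inner_commute power2_eq_square algebra_simps add_divide_distrib diff_divide_distrib)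
qed

lemma continuous_on_dirichlet_form:
  assumes "open U" "smooth_on U X" "smooth_on U f" "smooth_on U h" "\<And>u. u \<in> U \<Longrightarrow> det (first_form X u) \<noteq> 0"
  shows "continuous_on U (dirichlet_form X f h)"
  unfolding dirichlet_form_def[abs_def]
  by (intro continuous_intros smooth_on_continuous_on smooth_on_pd smooth_on_det_first_form assms ballI)

section \<open>The first variation of the energy\<close>

definition extend_chart :: "(real^2) set \<Rightarrow> (real^2 \<Rightarrow> 'm) \<Rightarrow> (real^2 \<Rightarrow> 'c::euclidean_space) \<Rightarrow> 'm \<Rightarrow> 'c" where
  "extend_chart U x h p = (if p \<in> x ` U then h (inv_into U x p) else 0)"

lemma extend_chart_chart: "inj_on x U \<Longrightarrow> u \<in> U \<Longrightarrow> extend_chart U x h (x u) = h u"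
  by (simp add: extend_chart_def)

text \<open>
  In another chart the extension is the composition with the transition map on the part
  overlapping \<open>x ` U\<close>, and zero on the complement of the compact set \<open>x ` K\<close>. These two open sets
  cover.
\<close>

lemma smooth_map_extend_chart:
  assumes A: "smooth_atlas A" "(U, x) \<in> A" and K: "compact K" "K \<subseteq> U"
    and h: "smooth_on U h" "\<And>u. u \<in> U - K \<Longrightarrow> h u = 0"
  shows "smooth_map A (extend_chart U x h)"
  unfolding smooth_map_def
proof clarify
  fix V y assume V: "(V, y) \<in> A"
  note cx = atlas_chart[OF A] and cy = atlas_chart[OF A(1) V]
  have "compact (x ` K)" using K cx(4) by (meson compact_continuous_image continuous_on_subset)
  then have cK: "closed (x ` K)" by (rule compact_imp_closed)
  show "smooth_on V (extend_chart U x h \<circ> y)"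
  proof (rule smooth_on_local)
    fix v assume v: "v \<in> V"
    show "\<exists>T. open T \<and> v \<in> T \<and> smooth_on T (extend_chart U x h \<circ> y)"
    proof (cases "y v \<in> x ` U")
      case True
      let ?T = "V \<inter> y -` (x ` U)"
      have o: "open ?T" by (rule atlas_overlap(1)[OF A(1) V A(2)])
      have "smooth_on ?T (\<lambda>v. h ((inv_into U x \<circ> y) v))"
        by (rule smooth_on_compose[OF o cx(1) _ atlas_overlap(2)[OF A(1) V A(2)] h(1)])
          (auto simp: inv_into_into)
      then have "smooth_on ?T (extend_chart U x h \<circ> y)"
        by (rule smooth_on_cong[OF o, rotated]) (auto simp: extend_chart_def)
      then show ?thesis using o v True by blast
    next
      case False
      let ?T = "V \<inter> y -` (- x ` K)"
      have o: "open ?T"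
        using cy(1,4) cK by (intro continuous_open_preimage) auto
      have z: "0 = (extend_chart U x h \<circ> y) w" if "w \<in> ?T" for w
      proof (cases "y w \<in> x ` U")
        case True
        then obtain u where u: "u \<in> U" "y w = x u" by blast
        then have "u \<notin> K" using that by auto
        then show ?thesis using u h(2) cx(3) by (simp add: extend_chart_def)
      qed (simp add: extend_chart_def)
      have "smooth_on ?T (extend_chart U x h \<circ> y)"
        by (rule smooth_on_cong[OF o z smooth_on_const])
      moreover have "v \<in> ?T" using False v K(2) by auto
      ultimately show ?thesis using o by blast
    qed
  qed
qed

lemma compact_subdomain_chart:
  assumes A: "smooth_atlas A" "(U, x) \<in> A" and K: "cbox a b \<subseteq> U" "box a b \<noteq> {}"
  shows "compact_subdomain (x ` cbox a b)"
proof -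
  note cx = atlas_chart[OF A]
  have c: "continuous_on (cbox a b) x" using cx(4) K(1) by (rule continuous_on_subset)
  then have comp: "compact (x ` cbox a b)" by (rule compact_continuous_image) (rule compact_cbox)
  have bU: "box a b \<subseteq> U" using K(1) box_subset_cbox by blast
  have "open (x ` box a b)"
  proof -
    have eq: "x ` box a b = x ` U \<inter> inv_into U x -` box a b"
    proof
      show "x ` box a b \<subseteq> x ` U \<inter> inv_into U x -` box a b" using bU cx(3) by auto
      show "x ` U \<inter> inv_into U x -` box a b \<subseteq> x ` box a b" using cx(3) by auto
    qed
    show ?thesis unfolding eq by (rule continuous_open_preimage[OF cx(5,2) open_box])
  qed
  moreover have "connected (x ` box a b)"
    using cx(4) bU by (intro connected_continuous_image) (auto intro: continuous_on_subset convex_connected)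
  moreover have "x ` cbox a b = closure (x ` box a b)"
  proof
    show "x ` cbox a b \<subseteq> closure (x ` box a b)"
      using image_closure_subset[of "box a b" x "closure (x ` box a b)"] c K(2) closure_subset[of "x ` box a b"]
      by (simp add: closure_box)
    show "closure (x ` box a b) \<subseteq> x ` cbox a b"
      by (rule closure_minimal[OF image_mono[OF box_subset_cbox] compact_imp_closed[OF comp]])
  qed
  ultimately show ?thesis using comp unfolding compact_subdomain_def by blast
qed

text \<open>
  The projection of \<open>f + tw\<close> to the sphere when \<open>f\<close> has unit length and \<open>w\<close> is orthogonal to \<open>f\<close>;
  then \<open>|f + tw|\<^sup>2 = 1 + t\<^sup>2 |w|\<^sup>2\<close>, so there is no singularity for any \<open>t\<close>.
\<close>

definition normalized_variation :: "('m \<Rightarrow> 'c::euclidean_space) \<Rightarrow> ('m \<Rightarrow> 'c) \<Rightarrow> real \<Rightarrow> 'm \<Rightarrow> 'c" where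
  "normalized_variation f w t p = ((1 + t\<^sup>2 * (w p \<bullet> w p)) powr (- (1/2))) *\<^sub>R (f p + t *\<^sub>R w p)"

lemma one_plus_square_inner_pos: "(0::real) < 1 + t\<^sup>2 * (v \<bullet> v)"
  by (simp add: add_pos_nonneg)

lemma smooth_on_normalized_variation:
  fixes f :: "'m \<Rightarrow> 'c::euclidean_space" and y :: "'a::euclidean_space \<Rightarrow> 'm"
  assumes V: "open V" and f: "smooth_on V (f \<circ> y)" and w: "smooth_on V (w \<circ> y)"
  shows "smooth_on ({-\<epsilon><..<\<epsilon>} \<times> V) (\<lambda>(t, v). normalized_variation f w t (y v))"
proof -
  let ?S = "{-\<epsilon><..<\<epsilon>} \<times> V"
  have o: "open ?S" using V by (intro open_Times) auto
  have snd: "smooth_on ?S (\<lambda>z. (g \<circ> y) (snd z))" if "smooth_on V (g \<circ> y)" for g :: "'m \<Rightarrow> 'c"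
    by (rule smooth_on_compose[OF o V _ smooth_on_bounded_linear[OF bounded_linear_snd] that]) auto
  have fst: "smooth_on ?S fst" by (rule smooth_on_bounded_linear[OF bounded_linear_fst])
  have "smooth_on ?S (\<lambda>z. ((1 + (fst z * fst z) * ((w \<circ> y) (snd z) \<bullet> (w \<circ> y) (snd z))) powr (- (1/2)))
      *\<^sub>R ((f \<circ> y) (snd z) + fst z *\<^sub>R (w \<circ> y) (snd z)))"
    by (intro smooth_on_scaleR[OF o] smooth_on_powr_compose[OF o] smooth_on_add[OF o] smooth_on_mult[OF o]
        smooth_on_inner[OF o] smooth_on_const snd f w fst)
      (use one_plus_square_inner_pos in \<open>auto simp: power2_eq_square\<close>)
  then show ?thesis
    by (simp add: normalized_variation_def case_prod_unfold power2_eq_square)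
qed

lemma normalized_variation_scaled:
  "sqrt (1 + t\<^sup>2 * (w p \<bullet> w p)) *\<^sub>R normalized_variation f w t p = f p + t *\<^sub>R w p"
  using one_plus_square_inner_pos[of t "w p"]
  by (simp add: normalized_variation_def powr_minus powr_half_sqrt)

lemma norm_normalized_variation:
  assumes "norm (f p) = 1" "w p \<bullet> f p = 0"
  shows "norm (normalized_variation f w t p) = 1"
proof -
  let ?s = "1 + t\<^sup>2 * (w p \<bullet> w p)"
  have "(norm (f p + t *\<^sub>R w p))\<^sup>2 = ?s"
    using assms unfolding power2_norm_eq_inner
    by (simp add: inner_add_left inner_add_right inner_commute norm_eq_1 power2_eq_square)
  then have "norm (f p + t *\<^sub>R w p) = sqrt ?s"
    by (metis abs_norm_cancel real_sqrt_abs)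
  then have "sqrt ?s * norm (normalized_variation f w t p) = sqrt ?s"
    unfolding normalized_variation_scaled[symmetric, of f p t w] using one_plus_square_inner_pos[of t "w p"]
    by simp
  then show ?thesis using one_plus_square_inner_pos[of t "w p"] by simp
qed

lemma normalized_variation_0: "normalized_variation f w 0 = f"
  by (simp add: normalized_variation_def fun_eq_iff)

lemma sphere_variation_normalized:
  assumes A: "smooth_atlas A" and f: "smooth_map A f" "\<And>p. norm (f p) = 1"
    and w: "smooth_map A w" "\<And>p. w p \<bullet> f p = 0" "\<And>p. p \<notin> D \<Longrightarrow> w p = 0"
  shows "sphere_variation A D f \<epsilon> (normalized_variation f w)"
  unfolding sphere_variation_def
proof (intro conjI ballI allI impI)
  show "case c of (U, x) \<Rightarrow> smooth_on ({-\<epsilon><..<\<epsilon>} \<times> U) (\<lambda>(t, u). normalized_variation f w t (x u))" if "c \<in> A" for c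
  proof (cases c)
    case (Pair U x)
    show ?thesis unfolding Pair prod.case
      by (rule smooth_on_normalized_variation)
        (use that[unfolded Pair] f(1) w(1) atlas_chart(1)[OF A] in \<open>auto simp: smooth_map_def\<close>)
  qed
  show "norm (normalized_variation f w t p) = 1" for t p
    by (rule norm_normalized_variation) (rule f(2), rule w(2))
  show "normalized_variation f w 0 = f" by (rule normalized_variation_0)
  show "normalized_variation f w t p = f p" if "p \<notin> D" for t p
    using w(3)[OF that] by (simp add: normalized_variation_def)
qed

lemma smooth_map_normalized_variation:
  assumes A: "smooth_atlas A" and "smooth_map A f" "smooth_map A w"
  shows "smooth_map A (normalized_variation f w t)"
  unfolding smooth_map_def
proof clarify
  fix U x assume U: "(U, x) \<in> A"
  then have s: "smooth_on U (f \<circ> x)" "smooth_on U (w \<circ> x)" using assms by (auto simp: smooth_map_def)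
  have o: "open U" using atlas_chart(1)[OF A U] .
  have "smooth_on U (\<lambda>u. ((1 + t\<^sup>2 * ((w \<circ> x) u \<bullet> (w \<circ> x) u)) powr (- (1/2))) *\<^sub>R ((f \<circ> x) u + t *\<^sub>R (w \<circ> x) u))"
    by (intro smooth_on_scaleR[OF o] smooth_on_powr_compose[OF o] smooth_on_add[OF o] smooth_on_mult[OF o]
        smooth_on_inner[OF o] smooth_on_const s) (rule one_plus_square_inner_pos)
  then show "smooth_on U (normalized_variation f w t \<circ> x)"
    by (simp add: normalized_variation_def o_def)
qed

text \<open>
  The difference of the quadratic polynomial and \<open>E\<close> has a minimum at \<open>0\<close>.
\<close>

lemma quadratic_upper_bound_deriv:
  fixes E :: "real \<Rightarrow> real"
  assumes "(E has_real_derivative 0) (at 0)" "E 0 = \<alpha>" "\<And>t. E t \<le> \<alpha> + 2 * t * \<beta> + t\<^sup>2 * \<gamma>"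
  shows "\<beta> = 0"
proof -
  have "((\<lambda>t. \<alpha> + 2 * t * \<beta> + t\<^sup>2 * \<gamma> - E t) has_real_derivative 2 * \<beta>) (at 0)"
    using assms(1) by (auto intro!: derivative_eq_intros)
  then have "2 * \<beta> = 0"
    by (rule DERIV_local_min[of _ _ _ 1]) (use assms(2,3) in \<open>auto simp: algebra_simps\<close>)
  then show ?thesis by simp
qed

text \<open>
  By the radial projection inequality the energy of the normalized variation is bounded by the
  energy of \<open>f + th\<close>, which is quadratic in \<open>t\<close> and has the required integral as half of
  its linear coefficient.
\<close>

lemma harmonic_weak_equation:
  fixes F :: "'m::{t2_space,second_countable_topology} \<Rightarrow> 'b::euclidean_space"
    and f :: "'m \<Rightarrow> 'c::euclidean_space"
  assumes A: "smooth_atlas A" "(U, x) \<in> A" and F: "immersion A F"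
    and harm: "harmonic_to_sphere A F f"
    and K: "cbox a b \<subseteq> U" "box a b \<noteq> {}"
    and h: "smooth_on U h" "\<And>u. u \<in> U - cbox a b \<Longrightarrow> h u = 0" "\<And>u. u \<in> U \<Longrightarrow> h u \<bullet> f (x u) = 0"
  shows "integral (cbox a b) (\<lambda>u. area_density (F \<circ> x) u * dirichlet_form (F \<circ> x) (f \<circ> x) h u) = 0"
proof -
  note cx = atlas_chart[OF A]
  let ?D = "x ` cbox a b" and ?M = "area_measure A F" and ?X = "F \<circ> x" and ?N = "f \<circ> x"
  define w where "w = extend_chart U x h"
  define G where "G = normalized_variation f w"
  have f: "smooth_map A f" "norm (f p) = 1" for p using harm by (auto simp: harmonic_to_sphere_def)
  have N: "smooth_on U ?N" using f(1) A(2) by (auto simp: smooth_map_def)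
  have wx: "w (x u) = h u" if "u \<in> U" for u
    using that cx(3) by (simp add: w_def extend_chart_chart)
  have w: "smooth_map A w"
    unfolding w_def by (rule smooth_map_extend_chart[OF A compact_cbox K(1) h(1,2)])
  have wf: "w p \<bullet> f p = 0" for p
  proof (cases "p \<in> x ` U")
    case True
    then show ?thesis using wx h(3) by auto
  qed (simp add: w_def extend_chart_def)
  have w0: "w p = 0" if "p \<notin> ?D" for p
  proof (cases "p \<in> x ` U")
    case True
    then obtain u where "u \<in> U" "p = x u" by blast
    moreover then have "u \<notin> cbox a b" using that by auto
    ultimately show ?thesis using wx h(2) by auto
  qed (simp add: w_def extend_chart_def)
  have var: "sphere_variation A ?D f 1 G"
    unfolding G_def by (rule sphere_variation_normalized[OF A(1) f w wf w0])
  have deriv: "((\<lambda>t. energy A F ?D (G t)) has_real_derivative 0) (at 0)"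
    using harm var compact_subdomain_chart[OF A K] zero_less_one
    unfolding harmonic_to_sphere_def by blast
  \<comment> \<open>the energy density of \<open>f + th\<close>\<close>
  define q where "q t = (\<lambda>u. dirichlet_form ?X ?N ?N u + 2 * t * dirichlet_form ?X ?N h u + t\<^sup>2 * dirichlet_form ?X h h u)" for t
  have dpos: "det (first_form ?X u) > 0" if "u \<in> U" for u using immersion_chart(2)[OF F A(2) that] .
  have bound: "norm_diff_sq A F (G t) (x u) \<le> q t u" if u: "u \<in> U" for t u
  proof -
    let ?r = "\<lambda>u. sqrt (1 + t\<^sup>2 * (h u \<bullet> h u))"
    have Gs: "smooth_map A (G t)" unfolding G_def by (rule smooth_map_normalized_variation[OF A(1) f(1) w])
    then have Gx: "smooth_on U (G t \<circ> x)" using A(2) by (auto simp: smooth_map_def)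
    have rs: "smooth_on U (\<lambda>u. (1 + t\<^sup>2 * (h u \<bullet> h u)) powr (1/2))"
      by (intro smooth_on_powr_compose[OF cx(1)] smooth_on_add[OF cx(1)] smooth_on_mult[OF cx(1)]
        smooth_on_inner[OF cx(1)] smooth_on_const h(1)) (rule one_plus_square_inner_pos)
    have r: "smooth_on U ?r"
      by (rule smooth_on_cong[OF cx(1) _ rs]) (simp add: powr_half_sqrt less_imp_le[OF one_plus_square_inner_pos])
    have eq: "?r v *\<^sub>R (G t \<circ> x) v = ?N v + t *\<^sub>R h v" if "v \<in> U" for v
      using normalized_variation_scaled[of t w "x v" f] wx[OF that] by (simp add: G_def)
    have eqd: "pd i (\<lambda>v. ?r v *\<^sub>R (G t \<circ> x) v) u = pd i (\<lambda>v. ?N v + t *\<^sub>R h v) u" for i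
      by (rule pd_cong[OF cx(1) u eq], assumption,
          rule smooth_on_differentiable[OF smooth_on_scaleR[OF cx(1) r Gx] u])
    have one: "(G t \<circ> x) v \<bullet> (G t \<circ> x) v = 1" for v
      using norm_normalized_variation[of f "x v" w t] f(2) wf by (simp add: G_def norm_eq_1)
    have "norm_diff_sq A F (G t) (x u) = dirichlet_form ?X (G t \<circ> x) (G t \<circ> x) u"
      by (rule norm_diff_sq_chart[OF A F Gs u])
    also have "\<dots> \<le> dirichlet_form ?X (\<lambda>v. ?r v *\<^sub>R (G t \<circ> x) v) (\<lambda>v. ?r v *\<^sub>R (G t \<circ> x) v) u"
      by (rule dirichlet_form_radial_projection[OF dpos[OF u] smooth_on_differentiable[OF r u] _
           smooth_on_differentiable[OF Gx u] cx(1) u one]) simp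
    also have "\<dots> = dirichlet_form ?X (\<lambda>v. ?N v + t *\<^sub>R h v) (\<lambda>v. ?N v + t *\<^sub>R h v) u"
      by (simp only: dirichlet_form_def eqd)
    also have "\<dots> = q t u"
      unfolding q_def
      by (rule dirichlet_form_add_scaled[OF smooth_on_differentiable[OF N u] smooth_on_differentiable[OF h(1) u]])
    finally show ?thesis .
  qed
  have cont: "continuous_on U (dirichlet_form ?X ?N ?N)" "continuous_on U (dirichlet_form ?X ?N h)"
    "continuous_on U (dirichlet_form ?X h h)" "continuous_on U (area_density ?X)"
    using dpos by (auto intro!: continuous_on_dirichlet_form continuous_on_area_density cx(1) immersion_chart(1)[OF F A(2)] N h(1)
         simp: less_imp_neq[symmetric])
  have qc: "continuous_on (cbox a b) (q t)" for t
    unfolding q_def using cont K(1) by (intro continuous_intros) (auto intro: continuous_on_subset)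
  have qx: "extend_chart U x (q t) (x u) = q t u" if "u \<in> cbox a b" for t u
    using that K(1) cx(3) by (intro extend_chart_chart) auto
  note int_q = area_integral_chart[OF A F compact_cbox K(1) qc qx]
  let ?J = "\<lambda>g. integral (cbox a b) (\<lambda>u. area_density ?X u * g u)"
  have iq: "?J (q t) = ?J (dirichlet_form ?X ?N ?N) + 2 * t * ?J (dirichlet_form ?X ?N h) + t\<^sup>2 * ?J (dirichlet_form ?X h h)" for t
  proof -
    have i: "(\<lambda>u. area_density ?X u * g u) integrable_on cbox a b" if "continuous_on U g" for g
      using that cont(4) K(1) by (intro integrable_continuous continuous_on_mult) (auto intro: continuous_on_subset)
    have hi: "((\<lambda>u. area_density ?X u * dirichlet_form ?X ?N ?N u
        + (2 * t) * (area_density ?X u * dirichlet_form ?X ?N h u) + t\<^sup>2 * (area_density ?X u * dirichlet_form ?X h h u))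
      has_integral ?J (dirichlet_form ?X ?N ?N) + 2 * t * ?J (dirichlet_form ?X ?N h) + t\<^sup>2 * ?J (dirichlet_form ?X h h)) (cbox a b)"
      by (intro has_integral_add has_integral_mult_right integrable_integral i cont)
    have eq: "(\<lambda>u. area_density ?X u * dirichlet_form ?X ?N ?N u
        + (2 * t) * (area_density ?X u * dirichlet_form ?X ?N h u) + t\<^sup>2 * (area_density ?X u * dirichlet_form ?X h h u))
      = (\<lambda>u. area_density ?X u * q t u)"
      by (simp add: q_def fun_eq_iff algebra_simps)
    show ?thesis using integral_unique[OF hi] unfolding eq .
  qed
  have E: "energy A F ?D (G t) \<le> ?J (q t)" for t
  proof -
    have "energy A F ?D (G t) \<le> (LINT p:?D|?M. extend_chart U x (q t) p)"
      unfolding energy_def set_lebesgue_integral_def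
    proof (rule integral_mono')
      show "integrable ?M (\<lambda>p. indicator ?D p *\<^sub>R extend_chart U x (q t) p)"
        using int_q(1) unfolding set_integrable_def .
      have "norm_diff_sq A F (G t) p \<le> extend_chart U x (q t) p \<and> 0 \<le> extend_chart U x (q t) p" if "p \<in> ?D" for p
      proof -
        obtain u where u: "u \<in> cbox a b" "p = x u" using \<open>p \<in> ?D\<close> by blast
        then have uU: "u \<in> U" using K(1) by blast
        have "0 \<le> norm_diff_sq A F (G t) (x u)"
          unfolding norm_diff_sq_chart[OF A F smooth_map_normalized_variation[OF A(1) f(1) w, folded G_def] uU]
          by (rule dirichlet_form_nonneg[OF dpos[OF uU]])
        with bound[OF uU, of t] qx[OF u(1)] show ?thesis by (simp add: u(2))
      qed
      then show "indicator ?D p *\<^sub>R norm_diff_sq A F (G t) p \<le> indicator ?D p *\<^sub>R extend_chart U x (q t) p"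
        "0 \<le> indicator ?D p *\<^sub>R extend_chart U x (q t) p" for p
        by (auto simp: indicator_def)
    qed
    then show ?thesis by (simp add: int_q(2))
  qed
  \<comment> \<open>at \<open>t = 0\<close> the bound is attained\<close>
  have E0: "energy A F ?D (G 0) = ?J (dirichlet_form ?X ?N ?N)"
    unfolding energy_def G_def normalized_variation_0
    by (rule area_integral_chart(2)[OF A F compact_cbox K(1)])
      (use cont(1) K(1) in \<open>auto intro: continuous_on_subset norm_diff_sq_chart[OF A F f(1)]\<close>)
  show ?thesis
    by (rule quadratic_upper_bound_deriv[OF deriv E0]) (use E in \<open>simp add: iq\<close>)
qed

section \<open>The Euler-Lagrange equation\<close>

text \<open>
  The integral of a compactly supported function is invariant under translation. Differentiating
  \<open>\<integral> \<Psi>(u + tv) du\<close> at \<open>t = 0\<close> therefore gives zero. Applied to products it yields integration by parts.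
\<close>

lemma integral_directional_derivative_zero:
  fixes \<Psi> :: "'a::euclidean_space \<Rightarrow> real"
  assumes s: "smooth_on UNIV \<Psi>" and z: "\<And>u. u \<notin> cbox a b \<Longrightarrow> \<Psi> u = 0"
  shows "integral (cbox a b) (\<lambda>u. frechet_derivative \<Psi> (at u) v) = 0"
proof -
  let ?D = "\<lambda>u. frechet_derivative \<Psi> (at u) v"
  have cD: "continuous_on S ?D" for S
    by (rule continuous_on_subset[OF smooth_on_continuous_on[OF smooth_on_frechet_derivative[OF s]]]) simp
  have cP: "continuous_on S \<Psi>" for S
    by (rule continuous_on_subset[OF smooth_on_continuous_on[OF s]]) simp
  have "compact ((\<lambda>(t, w). w - t *\<^sub>R v) ` ({-1..1::real} \<times> cbox a b))"
    unfolding case_prod_unfold by (intro compact_continuous_image continuous_intros compact_Times) auto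
  then obtain c where c: "(\<lambda>(t, w). w - t *\<^sub>R v) ` ({-1..1::real} \<times> cbox a b) \<subseteq> cbox (- c) c"
    using bounded_subset_cbox_symmetric compact_imp_bounded by metis
  have sub: "cbox (a - t *\<^sub>R v) (b - t *\<^sub>R v) \<subseteq> cbox (- c) c" if "t \<in> {-1..1}" for t
  proof
    fix u assume "u \<in> cbox (a - t *\<^sub>R v) (b - t *\<^sub>R v)"
    then have "u + t *\<^sub>R v \<in> cbox a b" by (auto simp: mem_box inner_simps algebra_simps)
    with that have "(\<lambda>(t, w). w - t *\<^sub>R v) (t, u + t *\<^sub>R v) \<in> cbox (- c) c" using c by blast
    then show "u \<in> cbox (- c) c" by simp
  qed
  \<comment> \<open>all translates by \<open>tv\<close> with \<open>|t| \<le> 1\<close> are supported in the same large box\<close>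
  define I where "I t = integral (cbox (- c) c) (\<lambda>u. \<Psi> (u + t *\<^sub>R v))" for t
  have I: "I t = integral (cbox a b) \<Psi>" if "t \<in> {-1..1}" for t
  proof -
    have "(\<Psi> has_integral integral (cbox a b) \<Psi>) (cbox a b)"
      by (intro integrable_integral integrable_continuous cP)
    from has_integral_shift_cbox[OF this, of "t *\<^sub>R v"]
    have "((\<lambda>u. \<Psi> (u + t *\<^sub>R v)) has_integral integral (cbox a b) \<Psi>) (cbox (- c) c)"
      by (rule has_integral_on_superset[OF _ _ sub[OF that]])
        (intro z, auto simp: mem_box inner_simps algebra_simps)
    then show ?thesis unfolding I_def by (rule integral_unique)
  qed
  have "(I has_field_derivative integral (cbox (- c) c) (\<lambda>u. ?D (u + 0 *\<^sub>R v))) (at 0 within {-1..1})"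
    unfolding I_def
  proof (rule leibniz_rule_field_derivative)
    show "((\<lambda>t. \<Psi> (u + t *\<^sub>R v)) has_field_derivative ?D (u + t *\<^sub>R v)) (at t within {-1..1})" for t u
    proof -
      have d: "(\<Psi> has_derivative frechet_derivative \<Psi> (at (u + t *\<^sub>R v))) (at (u + t *\<^sub>R v))"
        using smooth_on_differentiable[OF s] by (simp add: frechet_derivative_works)
      have "((\<lambda>t. u + t *\<^sub>R v) has_derivative (\<lambda>r. r *\<^sub>R v)) (at t)"
        by (auto intro!: derivative_eq_intros)
      from diff_chain_at[OF this d]
      have "((\<lambda>t. \<Psi> (u + t *\<^sub>R v)) has_derivative (\<lambda>r. frechet_derivative \<Psi> (at (u + t *\<^sub>R v)) (r *\<^sub>R v))) (at t)"
        by (simp add: o_def)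
      moreover have "linear (frechet_derivative \<Psi> (at (u + t *\<^sub>R v)))" using d has_derivative_linear by blast
      ultimately have "((\<lambda>t. \<Psi> (u + t *\<^sub>R v)) has_field_derivative ?D (u + t *\<^sub>R v)) (at t)"
        by (simp add: has_field_derivative_def linear_scale mult_commute_abs)
      then show ?thesis by (rule has_field_derivative_at_within)
    qed
    show "(\<lambda>u. \<Psi> (u + t *\<^sub>R v)) integrable_on cbox (- c) c" for t
      by (intro integrable_continuous continuous_on_compose2[OF cP[of UNIV]] continuous_intros) auto
    show "continuous_on ({-1..1} \<times> cbox (- c) c) (\<lambda>(t, u). ?D (u + t *\<^sub>R v))"
      unfolding case_prod_unfold
      by (intro continuous_on_compose2[OF cD[of UNIV]] continuous_intros) auto
  qed auto
  moreover have "at (0::real) within {-1..1} = at 0"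
    by (rule at_within_Icc_at) auto
  ultimately have d1: "(I has_field_derivative integral (cbox (- c) c) ?D) (at 0)" by simp
  have "((\<lambda>t. integral (cbox a b) \<Psi>) has_field_derivative 0) (at 0)" by simp
  then have d2: "(I has_field_derivative 0) (at 0)"
    by (rule has_field_derivative_transform_within_open[of _ _ _ "{-1<..<1}"]) (auto simp: I)
  have i0: "integral (cbox (- c) c) ?D = 0" using DERIV_unique[OF d1 d2] .
  have "(?D has_integral integral (cbox a b) ?D) (cbox (- c) c)"
  proof (rule has_integral_on_superset)
    show "(?D has_integral integral (cbox a b) ?D) (cbox a b)"
      by (intro integrable_integral integrable_continuous cD)
    show "?D u = 0" if "u \<notin> cbox a b" for u
    proof -
      have "\<Psi> differentiable (at u)" using smooth_on_differentiable[OF s] by simp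
      moreover have "open (- cbox a b)" by (simp add: open_Compl closed_cbox)
      ultimately have "frechet_derivative \<Psi> (at u) = frechet_derivative (\<lambda>u. 0) (at u)"
        by (rule frechet_derivative_transform_within_open) (use that z in auto)
      then show ?thesis by simp
    qed
    show "cbox a b \<subseteq> cbox (- c) c" using sub[of 0] by simp
  qed
  then show ?thesis using i0 by (simp add: integral_unique)
qed

lemma integral_pd_zero:
  fixes \<Psi> :: "real^2 \<Rightarrow> real"
  assumes "open U" "cbox a b \<subseteq> U" "smooth_on U \<Psi>" "\<And>u. u \<in> U - cbox a b \<Longrightarrow> \<Psi> u = 0"
  shows "integral (cbox a b) (pd i \<Psi>) = 0"
proof -
  let ?E = "\<lambda>u. if u \<in> U then \<Psi> u else 0"
  have s: "smooth_on UNIV ?E"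
    by (rule smooth_on_extend_by_zero[OF assms(1) closed_cbox assms(3,4,2)])
  have "integral (cbox a b) (pd i ?E) = 0"
    unfolding pd_def[abs_def] by (rule integral_directional_derivative_zero[OF s]) (use assms(4) in auto)
  moreover have "pd i \<Psi> u = pd i ?E u" if "u \<in> cbox a b" for u
    using that assms(2) by (intro pd_cong[OF assms(1)] smooth_on_differentiable[OF assms(3)]) auto
  ultimately show ?thesis using Henstock_Kurzweil_Integration.integral_cong[of "cbox a b" "pd i \<Psi>" "pd i ?E"] by simp
qed

text \<open>
  The Hodge star of \<open>df\<close>, up to the sign convention, for the metric induced by \<open>X\<close>: the \<open>i\<close>-th component is \<open>df(J e\<^sub>i)\<close>, where \<open>J\<close>
  is the rotation by a right angle in that metric.
\<close>

definition star_pd :: "2 \<Rightarrow> (real^2 \<Rightarrow> 'b::euclidean_space) \<Rightarrow> (real^2 \<Rightarrow> 'c::euclidean_space) \<Rightarrow> real^2 \<Rightarrow> 'c" where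
  "star_pd i X f u = (1 / area_density X u) *\<^sub>R
    ((pd i X u \<bullet> pd 1 X u) *\<^sub>R pd 2 f u - (pd i X u \<bullet> pd 2 X u) *\<^sub>R pd 1 f u)"

lemma smooth_on_star_pd:
  assumes "open U" "smooth_on U X" "\<And>u. u \<in> U \<Longrightarrow> det (first_form X u) > 0" "smooth_on U f"
  shows "smooth_on U (star_pd i X f)"
  unfolding star_pd_def[abs_def]
  by (intro smooth_on_scaleR smooth_on_diff smooth_on_inner smooth_on_pd smooth_on_inverse_area_density assms)

text \<open>
  The identity \<open>\<langle>df, dh\<rangle> dA = *df \<and> dh\<close>, evaluated on the coordinate vectors. It moves the metric
  from the test function \<open>h\<close> to \<open>f\<close>, ready for integration by parts.
\<close>

lemma dirichlet_form_star_pd: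
  assumes "det (first_form X u) > 0"
  shows "area_density X u * dirichlet_form X f h u = star_pd 1 X f u \<bullet> pd 2 h u - star_pd 2 X f u \<bullet> pd 1 h u"
proof -
  have w: "area_density X u \<noteq> 0" using assms by (simp add: area_density_def)
  show ?thesis
    unfolding dirichlet_form_def star_pd_def area_density_sq[OF assms, symmetric]
    using w by (simp add: inner_diff_left inner_commute[of "pd 2 X u" "pd 1 X u"] power2_eq_square field_simps)
qed

text \<open>
  The vector in parentheses is, up to sign and the area density, the tension of \<open>f\<close>, written as
  \<open>d(*df)\<close>. If its product with \<open>V\<close> were not zero at \<open>u0\<close>, it would keep its sign on a small box;
  the test field \<open>h\<close>, a bump function of this box times \<open>V\<close>, contradicts the weak equation
  after integration by parts.
\<close>

lemma harmonic_tension_orthogonal: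
  fixes F :: "'m::{t2_space,second_countable_topology} \<Rightarrow> 'b::euclidean_space"
    and f :: "'m \<Rightarrow> 'c::euclidean_space"
  assumes A: "smooth_atlas A" "(U, x) \<in> A" and F: "immersion A F"
    and harm: "harmonic_to_sphere A F f"
    and V: "smooth_on U V" "\<And>u. u \<in> U \<Longrightarrow> V u \<bullet> f (x u) = 0" and u0: "u0 \<in> U"
  shows "(pd 1 (star_pd 2 (F \<circ> x) (f \<circ> x)) u0 - pd 2 (star_pd 1 (F \<circ> x) (f \<circ> x)) u0) \<bullet> V u0 = 0"
proof (rule ccontr)
  let ?X = "F \<circ> x" and ?P1 = "star_pd 1 (F \<circ> x) (f \<circ> x)" and ?P2 = "star_pd 2 (F \<circ> x) (f \<circ> x)"
  define k where "k u = (pd 1 ?P2 u - pd 2 ?P1 u) \<bullet> V u" for u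
  assume "(pd 1 ?P2 u0 - pd 2 ?P1 u0) \<bullet> V u0 \<noteq> 0"
  then have k0: "k u0 \<noteq> 0" by (simp add: k_def)
  \<comment> \<open>multiplying by the sign treats both cases at once\<close>
  define \<sigma> where "\<sigma> = sgn (k u0)"
  have o: "open U" using atlas_chart(1)[OF A] .
  have X: "smooth_on U ?X" "\<And>u. u \<in> U \<Longrightarrow> det (first_form ?X u) > 0"
    using immersion_chart[OF F A(2)] by auto
  have N: "smooth_on U (f \<circ> x)" using harm A(2) by (auto simp: harmonic_to_sphere_def smooth_map_def)
  have P: "smooth_on U ?P1" "smooth_on U ?P2" by (intro smooth_on_star_pd o X N; assumption)+
  have k: "continuous_on U k"
    unfolding k_def[abs_def]
    by (intro smooth_on_continuous_on smooth_on_inner smooth_on_diff smooth_on_pd o P V)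
  have "open (U \<inter> (\<lambda>u. \<sigma> * k u) -` {0<..})"
    using k o by (intro continuous_open_preimage continuous_intros) auto
  moreover have "u0 \<in> U \<inter> (\<lambda>u. \<sigma> * k u) -` {0<..}"
    using u0 k0 by (auto simp: \<sigma>_def sgn_if)
  ultimately obtain a b where ab: "cbox a b \<subseteq> U \<inter> (\<lambda>u. \<sigma> * k u) -` {0<..}" "u0 \<in> box a b"
    using open_contains_cbox by metis
  have K: "cbox a b \<subseteq> U" "box a b \<noteq> {}" using ab by auto
  define h where "h u = bump a b u *\<^sub>R V u" for u
  have h: "smooth_on U h" unfolding h_def[abs_def]
    by (intro smooth_on_scaleR o V smooth_on_subset[OF smooth_on_bump]) auto
  have h0: "h u = 0" if "u \<in> U - cbox a b" for u using that bump_outside by (auto simp: h_def)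
  have weak: "integral (cbox a b) (\<lambda>u. area_density ?X u * dirichlet_form ?X (f \<circ> x) h u) = 0"
    by (rule harmonic_weak_equation[OF A F harm K h h0]) (auto simp: h_def V)
  have eq: "area_density ?X u * dirichlet_form ?X (f \<circ> x) h u
      = pd 2 (\<lambda>u. ?P1 u \<bullet> h u) u - pd 1 (\<lambda>u. ?P2 u \<bullet> h u) u + bump a b u * k u" if "u \<in> U" for u
    using that unfolding dirichlet_form_star_pd[OF X(2)[OF that]]
    by (subst (1 2) pd_inner) (auto simp: smooth_on_differentiable[OF P(1)] smooth_on_differentiable[OF P(2)]
      smooth_on_differentiable[OF h] k_def h_def inner_diff_left algebra_simps)
  have z: "integral (cbox a b) (pd i (\<lambda>u. P u \<bullet> h u)) = 0"
    and zi: "pd i (\<lambda>u. P u \<bullet> h u) integrable_on cbox a b" if "smooth_on U P" for P i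
  proof -
    have s: "smooth_on U (\<lambda>u. P u \<bullet> h u)" by (intro smooth_on_inner o that h)
    show "integral (cbox a b) (pd i (\<lambda>u. P u \<bullet> h u)) = 0"
      by (rule integral_pd_zero[OF o K(1) s]) (use h0 in simp)
    show "pd i (\<lambda>u. P u \<bullet> h u) integrable_on cbox a b"
      by (intro integrable_continuous continuous_on_subset[OF smooth_on_continuous_on[OF smooth_on_pd[OF s]] K(1)])
  qed
  have cb: "continuous_on (cbox a b) (\<lambda>u. bump a b u * k u)"
    by (intro continuous_on_mult continuous_on_subset[OF k K(1)]
      continuous_on_subset[OF smooth_on_continuous_on[OF smooth_on_bump]]) auto
  have "((\<lambda>u. pd 2 (\<lambda>u. ?P1 u \<bullet> h u) u - pd 1 (\<lambda>u. ?P2 u \<bullet> h u) u + bump a b u * k u) has_integral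
     0 - 0 + integral (cbox a b) (\<lambda>u. bump a b u * k u)) (cbox a b)"
    using integrable_integral[OF zi[OF P(1), of 2]] integrable_integral[OF zi[OF P(2), of 1]]
    unfolding z[OF P(1)] z[OF P(2)]
    by (intro has_integral_add has_integral_diff integrable_integral integrable_continuous cb)
  then have hi: "((\<lambda>u. area_density ?X u * dirichlet_form ?X (f \<circ> x) h u) has_integral
      integral (cbox a b) (\<lambda>u. bump a b u * k u)) (cbox a b)"
    unfolding diff_zero add_0_left by (rule has_integral_eq[rotated]) (use eq K(1) in auto)
  have "integral (cbox a b) (\<lambda>u. bump a b u * k u) = 0"
    using integral_unique[OF hi] unfolding weak by (rule sym)
  then have "integral (cbox a b) (\<lambda>u. \<sigma> * (bump a b u * k u)) = 0" by simp
  moreover have "0 \<le> \<sigma> * (bump a b u * k u)" if "u \<in> cbox a b" for u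
  proof -
    have "u \<in> (\<lambda>u. \<sigma> * k u) -` {0<..}" using that ab(1) by blast
    then have "0 \<le> \<sigma> * k u" by simp
    then have "0 \<le> bump a b u * (\<sigma> * k u)" by (rule mult_nonneg_nonneg[OF bump_nonneg])
    then show ?thesis by (simp add: algebra_simps)
  qed
  ultimately have "\<sigma> * (bump a b u0 * k u0) = 0"
    using integral_cbox_eq_0_iff[OF continuous_on_mult_left[OF cb] K(2), of \<sigma>] ab(2) box_subset_cbox by blast
  then show False using bump_pos[OF ab(2)] k0 by (simp add: \<sigma>_def sgn_if split: if_splits)
qed

section \<open>The normal space and the second fundamental form\<close>

lemma tangent_plane_eq:
  fixes X :: "real^2 \<Rightarrow> 'b::euclidean_space"
  assumes "X differentiable (at u)"
  shows "tangent_plane X u = {s *\<^sub>R pd 1 X u + t *\<^sub>R pd 2 X u | s t. True}"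
proof -
  have lin: "linear (frechet_derivative X (at u))" by (rule linear_frechet_derivative[OF assms])
  have *: "frechet_derivative X (at u) (s *\<^sub>R axis 1 1 + t *\<^sub>R axis 2 1) = s *\<^sub>R pd 1 X u + t *\<^sub>R pd 2 X u" for s t
    by (simp only: linear_add[OF lin] linear_scale[OF lin] pd_def)
  have **: "a = a $ 1 *\<^sub>R axis 1 1 + a $ 2 *\<^sub>R axis 2 1" for a :: "real^2"
    by (simp add: vec_eq_iff forall_2 axis_def)
  show ?thesis
  proof (intro set_eqI iffI)
    fix v assume "v \<in> tangent_plane X u"
    then obtain a where a: "v = frechet_derivative X (at u) a" by (auto simp: tangent_plane_def)
    have "v = a $ 1 *\<^sub>R pd 1 X u + a $ 2 *\<^sub>R pd 2 X u"
      unfolding a by (subst **) (rule *)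
    then show "v \<in> {s *\<^sub>R pd 1 X u + t *\<^sub>R pd 2 X u | s t. True}" by blast
  next
    fix v assume "v \<in> {s *\<^sub>R pd 1 X u + t *\<^sub>R pd 2 X u | s t. True}"
    then obtain s t where "v = s *\<^sub>R pd 1 X u + t *\<^sub>R pd 2 X u" by blast
    then have "v = frechet_derivative X (at u) (s *\<^sub>R axis 1 1 + t *\<^sub>R axis 2 1)" by (simp only: *)
    then show "v \<in> tangent_plane X u" by (simp add: tangent_plane_def)
  qed
qed

lemma mem_normal_space:
  fixes X :: "real^2 \<Rightarrow> 'b::euclidean_space"
  assumes "X differentiable (at u)"
  shows "n \<in> normal_space X u \<longleftrightarrow> n \<bullet> pd 1 X u = 0 \<and> n \<bullet> pd 2 X u = 0" (is "?L \<longleftrightarrow> ?R")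
proof
  assume ?L
  then have *: "orthogonal (s *\<^sub>R pd 1 X u + t *\<^sub>R pd 2 X u) n" for s t
    unfolding normal_space_def orthogonal_comp_def tangent_plane_eq[OF assms] by blast
  show ?R using *[of 1 0] *[of 0 1] by (simp add: orthogonal_def inner_commute)
next
  assume ?R
  then show ?L
    unfolding normal_space_def orthogonal_comp_def tangent_plane_eq[OF assms]
    by (auto simp: orthogonal_def inner_add_left inner_add_right inner_commute)
qed

text \<open>
  Replaces the definite description by a rule for products: a normal vector does not see the
  tangential part.
\<close>

lemma normal_part_inner:
  fixes X :: "real^2 \<Rightarrow> 'b::euclidean_space"
  assumes "X differentiable (at u)"
  shows "normal_part X u v \<in> normal_space X u"
    and "n \<in> normal_space X u \<Longrightarrow> normal_part X u v \<bullet> n = v \<bullet> n"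
proof -
  let ?T = "tangent_plane X u"
  have sub: "subspace ?T"
    unfolding tangent_plane_def using linear_frechet_derivative[OF assms]
    by (rule linear_subspace_image[OF _ subspace_UNIV])
  have orth: "n \<in> normal_space X u \<Longrightarrow> t \<in> ?T \<Longrightarrow> t \<bullet> n = 0" for n t
    by (auto simp: normal_space_def orthogonal_comp_def orthogonal_def)
  have subN: "subspace (normal_space X u)" unfolding normal_space_def by (rule subspace_orthogonal_comp)
  have "\<exists>!w. w \<in> normal_space X u \<and> v - w \<in> ?T"
  proof (rule ex_ex1I)
    obtain y z where yz: "y \<in> span ?T" "\<And>w. w \<in> span ?T \<Longrightarrow> orthogonal z w" "v = y + z"
      using orthogonal_subspace_decomp_exists by blast
    have "z \<in> normal_space X u"
      using yz(2) span_superset[of ?T] by (auto simp: normal_space_def orthogonal_comp_def orthogonal_commute)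
    moreover have "v - z \<in> ?T" using yz(1,3) span_eq_iff[THEN iffD2, OF sub] by simp
    ultimately show "\<exists>w. w \<in> normal_space X u \<and> v - w \<in> ?T" by blast
  next
    fix w w' assume a: "w \<in> normal_space X u \<and> v - w \<in> ?T" "w' \<in> normal_space X u \<and> v - w' \<in> ?T"
    then have "w - w' \<in> normal_space X u" using subspace_diff[OF subN] by blast
    moreover have "w - w' \<in> ?T" using subspace_diff[OF sub, of "v - w'" "v - w"] a by simp
    ultimately have "(w - w') \<bullet> (w - w') = 0" using orth by blast
    then show "w = w'" by simp
  qed
  then have w: "normal_part X u v \<in> normal_space X u \<and> v - normal_part X u v \<in> ?T"
    unfolding normal_part_def by (rule theI')
  then show "normal_part X u v \<in> normal_space X u" by blast
  show "normal_part X u v \<bullet> n = v \<bullet> n" if "n \<in> normal_space X u"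
    using orth[OF that, of "v - normal_part X u v"] w by (simp add: inner_diff_left)
qed

lemma second_form_axis:
  "second_form X u (axis i 1) (axis j 1) = normal_part X u (pd i (pd j X) u)"
  by (simp add: second_form_def pd_def[abs_def])

text \<open>
  The vanishing of the mean curvature vector, tested against a normal vector \<open>n\<close> and multiplied by
  the determinant of the metric. Second derivatives of \<open>X\<close> take the place of the second
  fundamental form because \<open>n\<close> is normal.
\<close>

lemma minimal_normal_trace:
  fixes X :: "real^2 \<Rightarrow> 'b::euclidean_space"
  assumes X: "open U" "smooth_on U X" and u: "u \<in> U" and d: "det (first_form X u) > 0"
    and min: "mean_curvature X u = 0" and n: "n \<bullet> pd 1 X u = 0" "n \<bullet> pd 2 X u = 0"
  shows "(pd 2 X u \<bullet> pd 2 X u) * (n \<bullet> pd 1 (pd 1 X) u) - 2 * (pd 1 X u \<bullet> pd 2 X u) * (n \<bullet> pd 1 (pd 2 X) u)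
    + (pd 1 X u \<bullet> pd 1 X u) * (n \<bullet> pd 2 (pd 2 X) u) = 0"
proof -
  have df: "X differentiable (at u)" by (rule smooth_on_differentiable[OF X(2) u])
  have N: "n \<in> normal_space X u" using n mem_normal_space[OF df] by blast
  have b: "second_form X u (axis i 1) (axis j 1) \<bullet> n = n \<bullet> pd i (pd j X) u" for i j
    unfolding second_form_axis normal_part_inner(2)[OF df N] by (rule inner_commute)
  have "metric_trace X u (\<lambda>i j. second_form X u (axis i 1) (axis j 1)) = 0"
    using min by (simp add: mean_curvature_def)
  then have "(pd 2 X u \<bullet> pd 2 X u) *\<^sub>R second_form X u (axis 1 1) (axis 1 1)
     - (pd 1 X u \<bullet> pd 2 X u) *\<^sub>R (second_form X u (axis 1 1) (axis 2 1) + second_form X u (axis 2 1) (axis 1 1))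
     + (pd 1 X u \<bullet> pd 1 X u) *\<^sub>R second_form X u (axis 2 1) (axis 2 1) = 0" (is "?v = 0")
    using d by (subst (asm) metric_trace_2) auto
  then have "?v \<bullet> n = 0" by simp
  then show ?thesis
    using pd_commute[OF X(1) u X(2), of 2 1]
    by (simp add: inner_add_left inner_diff_left b algebra_simps)
qed

lemma span_second_form_orthogonal:
  fixes X :: "real^2 \<Rightarrow> 'b::euclidean_space"
  assumes X: "open U" "smooth_on U X" and u: "u \<in> U"
    and sp: "span {second_form X u a b | a b. True} = normal_space X u"
    and n: "n \<bullet> pd 1 X u = 0" "n \<bullet> pd 2 X u = 0"
    and o: "\<And>i j. n \<bullet> pd i (pd j X) u = 0"
  shows "n = 0"
proof -
  have df: "X differentiable (at u)" by (rule smooth_on_differentiable[OF X(2) u])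
  have N: "n \<in> normal_space X u" using n mem_normal_space[OF df] by blast
  have ax: "a = a $ 1 *\<^sub>R axis 1 1 + a $ 2 *\<^sub>R axis 2 1" for a :: "real^2"
    by (simp add: vec_eq_iff forall_2 axis_def)
  have lc: "frechet_derivative Z (at w) a = a $ 1 *\<^sub>R pd 1 Z w + a $ 2 *\<^sub>R pd 2 Z w"
    if "Z differentiable (at w)" for Z :: "real^2 \<Rightarrow> 'b" and w a
  proof -
    have lin: "linear (frechet_derivative Z (at w))" by (rule linear_frechet_derivative[OF that])
    show ?thesis
      by (subst ax) (simp only: linear_add[OF lin] linear_scale[OF lin] pd_def)
  qed
  have "orthogonal n v" if "v \<in> {second_form X u a b | a b. True}" for v
  proof -
    obtain a c where v: "v = second_form X u a c" using \<open>v \<in> _\<close> by auto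
    let ?Z = "\<lambda>w. frechet_derivative X (at w) c"
    have sZ: "smooth_on U ?Z" by (rule smooth_on_frechet_derivative[OF X(2)])
    have pdX: "pd i X differentiable (at u)" for i by (rule smooth_on_differentiable[OF smooth_on_pd[OF X(2)] u])
    have cc: "(\<lambda>w. c $ k) differentiable (at u)" for k by simp
    have s: "(\<lambda>w. c $ k *\<^sub>R pd k X w) differentiable (at u)" for k
      by (rule smooth_on_differentiable[OF smooth_on_scaleR[OF X(1) smooth_on_const smooth_on_pd[OF X(2)]] u])
    have "pd i ?Z u = pd i (\<lambda>w. c $ 1 *\<^sub>R pd 1 X w + c $ 2 *\<^sub>R pd 2 X w) u" for i
      by (rule pd_cong[OF X(1) u _ smooth_on_differentiable[OF sZ u]])
        (rule lc[OF smooth_on_differentiable[OF X(2)]])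
    also have "\<dots> i = c $ 1 *\<^sub>R pd i (pd 1 X) u + c $ 2 *\<^sub>R pd i (pd 2 X) u" for i
      by (simp add: pd_add[OF s s] pd_scaleR[OF cc pdX] pd_const)
    finally have "pd i ?Z u \<bullet> n = 0" for i
      using o by (simp add: inner_add_left inner_add_right inner_commute)
    then have "frechet_derivative ?Z (at u) a \<bullet> n = 0"
      by (simp add: lc[OF smooth_on_differentiable[OF sZ u]] inner_add_left)
    then show ?thesis
      unfolding v second_form_def orthogonal_def using normal_part_inner(2)[OF df N] by (metis inner_commute)
  qed
  then have "orthogonal n n"
    using orthogonal_to_span[of n "{second_form X u a b | a b. True}" n] N unfolding sp by blast
  then show ?thesis by (simp add: orthogonal_def)
qed

section \<open>Trace-free symmetric forms and frames\<close>

text \<open>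
  The symmetric form \<open>b\<close> is trace-free for the metric with coefficients \<open>E, F, G\<close>. Its determinant is
  minus a positive definite quadratic form in \<open>b\<close>.
\<close>

lemma tracefree_sym_det_nonzero:
  fixes E F G b11 b12 b22 :: real
  assumes d: "E * G - F\<^sup>2 > 0" and E: "E > 0" and tr: "G * b11 - 2 * F * b12 + E * b22 = 0"
    and det: "b11 * b22 - b12\<^sup>2 = 0"
  shows "b11 = 0 \<and> b12 = 0 \<and> b22 = 0"
proof -
  have "(E * b12 - F * b11)\<^sup>2 + (E * G - F\<^sup>2) * b11\<^sup>2 = - (E * E * (b11 * b22 - b12\<^sup>2)) + E * b11 * (G * b11 - 2 * F * b12 + E * b22)"
    by algebra
  also have "\<dots> = 0" unfolding tr det by simp
  finally have s: "(E * b12 - F * b11)\<^sup>2 + (E * G - F\<^sup>2) * b11\<^sup>2 = 0" .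
  have "0 \<le> (E * G - F\<^sup>2) * b11\<^sup>2" using d by simp
  with s have "(E * G - F\<^sup>2) * b11\<^sup>2 = 0" "(E * b12 - F * b11)\<^sup>2 = 0"
    using zero_le_power2[of "E * b12 - F * b11"] by linarith+
  then have "b11 = 0" "E * b12 = 0" using d by auto
  with E tr show ?thesis by auto
qed

text \<open>
  Invertibility of the operator \<open>g\<^sup>-\<^sup>1 b\<close> for a nonzero trace-free symmetric form \<open>b\<close>.
\<close>

lemma tracefree_sym_kernel:
  fixes E F G b11 b12 b22 w1 w2 :: real
  assumes d: "E * G - F\<^sup>2 > 0" and E: "E > 0" and tr: "G * b11 - 2 * F * b12 + E * b22 = 0"
    and ne: "\<not> (b11 = 0 \<and> b12 = 0 \<and> b22 = 0)"
    and e1: "w1 * (G * b11 - F * b12) + w2 * (E * b12 - F * b11) = 0"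
    and e2: "w1 * (G * b12 - F * b22) + w2 * (E * b22 - F * b12) = 0"
  shows "w1 = 0 \<and> w2 = 0"
proof -
  have nz: "(E * G - F\<^sup>2) * (b11 * b22 - b12\<^sup>2) \<noteq> 0"
    using tracefree_sym_det_nonzero[OF d E tr] ne d by auto
  have "w1 * ((E * G - F\<^sup>2) * (b11 * b22 - b12\<^sup>2)) = (E * b22 - F * b12) * (w1 * (G * b11 - F * b12) + w2 * (E * b12 - F * b11))
      - (E * b12 - F * b11) * (w1 * (G * b12 - F * b22) + w2 * (E * b22 - F * b12))" by algebra
  moreover have "w2 * ((E * G - F\<^sup>2) * (b11 * b22 - b12\<^sup>2)) = (G * b11 - F * b12) * (w1 * (G * b12 - F * b22) + w2 * (E * b22 - F * b12))
      - (G * b12 - F * b22) * (w1 * (G * b11 - F * b12) + w2 * (E * b12 - F * b11))" by algebra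
  ultimately show ?thesis unfolding e1 e2 using nz by auto
qed

text \<open>
  The last hypothesis says that the operators \<open>g\<^sup>-\<^sup>1 h\<close> and \<open>g\<^sup>-\<^sup>1 b\<close> commute. The conclusion is that
  all minors of \<open>(h, b)\<close> vanish. By the trace conditions all minors are multiples of
  \<open>h11 * b12 - h12 * b11\<close>, and the commutator is twice the determinant of the metric times that minor,
  up to a positive factor.
\<close>

lemma tracefree_sym_commuting_parallel:
  fixes E F G h11 h12 h22 b11 b12 b22 :: real
  assumes d: "E * G - F\<^sup>2 > 0" and E: "E > 0"
    and th: "G * h11 - 2 * F * h12 + E * h22 = 0" and tb: "G * b11 - 2 * F * b12 + E * b22 = 0"
    and comm: "G * (h11 * b12 - h12 * b11) + E * (h12 * b22 - h22 * b12) + F * (h22 * b11 - h11 * b22) = 0"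
  shows "h11 * b12 = h12 * b11" "h12 * b22 = h22 * b12" "h11 * b22 = h22 * b11"
proof -
  have 1: "E * (h12 * b22 - h22 * b12) = G * (h11 * b12 - h12 * b11)" using th tb by algebra
  have 2: "E * (h22 * b11 - h11 * b22) = - 2 * F * (h11 * b12 - h12 * b11)" using th tb by algebra
  have "2 * (E * G - F\<^sup>2) * (h11 * b12 - h12 * b11) = 0" using 1 2 comm by algebra
  then have c: "h11 * b12 - h12 * b11 = 0" using d by simp
  show "h11 * b12 = h12 * b11" using c by simp
  show "h12 * b22 = h22 * b12" "h11 * b22 = h22 * b11" using 1 2 E unfolding c by auto
qed

text \<open>
  Otherwise \<open>X1\<close>, \<open>X2\<close> made orthogonal to \<open>X1\<close>, \<open>N\<close>, \<open>\<xi>\<close> and \<open>v\<close> would be five nonzero pairwise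
  orthogonal vectors in a space of dimension four.
\<close>

lemma orthogonal_frame_complete:
  fixes X1 X2 N \<xi> v :: "real^4"
  assumes d: "(X1 \<bullet> X1) * (X2 \<bullet> X2) - (X1 \<bullet> X2)\<^sup>2 > 0"
    and N: "N \<noteq> 0" "N \<bullet> X1 = 0" "N \<bullet> X2 = 0"
    and \<xi>: "\<xi> \<noteq> 0" "\<xi> \<bullet> X1 = 0" "\<xi> \<bullet> X2 = 0" "\<xi> \<bullet> N = 0"
    and v: "v \<bullet> X1 = 0" "v \<bullet> X2 = 0" "v \<bullet> N = 0" "v \<bullet> \<xi> = 0"
  shows "v = 0"
proof (rule ccontr)
  assume v0: "v \<noteq> 0"
  define Y where "Y = (X1 \<bullet> X1) *\<^sub>R X2 - (X1 \<bullet> X2) *\<^sub>R X1"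
  have "X1 \<noteq> 0" using d by auto
  have "Y \<bullet> X2 \<noteq> 0" using d by (simp add: Y_def inner_diff_left power2_eq_square)
  then have "Y \<noteq> 0" by auto
  have Y: "Y \<bullet> X1 = 0" "Y \<bullet> N = 0" "Y \<bullet> \<xi> = 0" "Y \<bullet> v = 0"
    using N \<xi> v by (simp_all add: Y_def inner_diff_left inner_diff_right inner_commute)
  let ?S = "{X1, Y, N, \<xi>, v}"
  note nz = \<open>X1 \<noteq> 0\<close> \<open>Y \<noteq> 0\<close> N(1) \<xi>(1) v0
  note oo = Y N(2) \<xi>(2,4) v(1,3,4)
  have ne: "a \<noteq> b" if "a \<bullet> b = 0" "a \<noteq> 0" for a b :: "real^4" using that by auto
  have "pairwise orthogonal ?S"
    unfolding pairwise_insert using oo by (auto simp: orthogonal_def inner_commute pairwise_def)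
  then have "independent ?S" using nz by (intro pairwise_orthogonal_independent) auto
  then have "card ?S \<le> 4" using independent_card_le by fastforce
  moreover have "card ?S = 5"
    using ne[OF oo(1) nz(2)] ne[OF oo(2) nz(2)] ne[OF oo(3) nz(2)] ne[OF oo(4) nz(2)] ne[OF oo(5) nz(3)]
      ne[OF oo(6) nz(4)] ne[OF oo(7) nz(4)] ne[OF oo(8) nz(5)] ne[OF oo(9) nz(5)] ne[OF oo(10) nz(5)]
    by (simp add: card_insert_if)
  ultimately show False by simp
qed

lemma ex_unit_orthogonal_to_three:
  fixes X1 X2 N :: "real^4"
  obtains \<xi> where "norm \<xi> = 1" "\<xi> \<bullet> X1 = 0" "\<xi> \<bullet> X2 = 0" "\<xi> \<bullet> N = 0"
proof -
  have "dim {X1, X2, N} \<le> card {X1, X2, N}" by (rule dim_le_card') simp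
  also have "\<dots> \<le> 3" by (simp add: card_insert_if)
  finally have "dim {X1, X2, N} < DIM(real^4)" by simp
  then obtain z where z: "z \<noteq> 0" "\<And>y. y \<in> span {X1, X2, N} \<Longrightarrow> orthogonal z y"
    using orthogonal_to_subspace_exists by blast
  have o: "z \<bullet> y = 0" if "y \<in> {X1, X2, N}" for y
    using z(2)[OF span_base[OF that]] by (simp add: orthogonal_def)
  show ?thesis
    by (rule that[of "(1 / norm z) *\<^sub>R z"]) (use z(1) o in auto)
qed

lemma frame_decomposition:
  fixes X1 X2 N \<xi> v :: "real^4"
  assumes d: "(X1 \<bullet> X1) * (X2 \<bullet> X2) - (X1 \<bullet> X2)\<^sup>2 > 0"
    and N: "N \<noteq> 0" "N \<bullet> X1 = 0" "N \<bullet> X2 = 0"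
    and \<xi>: "norm \<xi> = 1" "\<xi> \<bullet> X1 = 0" "\<xi> \<bullet> X2 = 0" "\<xi> \<bullet> N = 0"
    and v: "v \<bullet> N = 0"
  defines "D \<equiv> (X1 \<bullet> X1) * (X2 \<bullet> X2) - (X1 \<bullet> X2)\<^sup>2"
  shows "v = (((X2 \<bullet> X2) * (v \<bullet> X1) - (X1 \<bullet> X2) * (v \<bullet> X2)) / D) *\<^sub>R X1
    + (((X1 \<bullet> X1) * (v \<bullet> X2) - (X1 \<bullet> X2) * (v \<bullet> X1)) / D) *\<^sub>R X2 + (v \<bullet> \<xi>) *\<^sub>R \<xi>" (is "v = ?a *\<^sub>R X1 + ?b *\<^sub>R X2 + _")
proof -
  have D: "D \<noteq> 0" using d by (simp add: D_def)
  have \<xi>0: "\<xi> \<noteq> 0" "\<xi> \<bullet> \<xi> = 1" using \<xi>(1) by (auto simp: norm_eq_1)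
  have c: "X2 \<bullet> X1 = X1 \<bullet> X2" "N \<bullet> \<xi> = 0" "X1 \<bullet> \<xi> = 0" "X2 \<bullet> \<xi> = 0" "X1 \<bullet> N = 0" "X2 \<bullet> N = 0"
    using \<xi> N by (simp_all add: inner_commute)
  have a1: "?a * (X1 \<bullet> X1) + ?b * (X1 \<bullet> X2) = v \<bullet> X1"
  proof -
    have "?a * (X1 \<bullet> X1) + ?b * (X1 \<bullet> X2) = (v \<bullet> X1) * D / D"
      unfolding D_def by (simp add: add_divide_distrib[symmetric] algebra_simps power2_eq_square)
    then show ?thesis using D by simp
  qed
  have a2: "?a * (X1 \<bullet> X2) + ?b * (X2 \<bullet> X2) = v \<bullet> X2"
  proof -
    have "?a * (X1 \<bullet> X2) + ?b * (X2 \<bullet> X2) = (v \<bullet> X2) * D / D"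
      unfolding D_def by (simp add: add_divide_distrib[symmetric] algebra_simps power2_eq_square)
    then show ?thesis using D by simp
  qed
  define a b where "a = ?a" and "b = ?b"
  have "v - (a *\<^sub>R X1 + b *\<^sub>R X2 + (v \<bullet> \<xi>) *\<^sub>R \<xi>) = 0"
    by (rule orthogonal_frame_complete[OF d N \<xi>0(1) \<xi>(2-4)])
      (simp_all add: inner_diff_left inner_add_left c \<xi>0(2) \<xi> N a1[folded a_def b_def] a2[folded a_def b_def] v)
  then show ?thesis by (simp add: a_def b_def)
qed

section \<open>Harmonic unit normals of minimal surfaces\<close>

text \<open>
  A parametrized minimal surface \<open>X\<close> whose second fundamental form spans the normal spaces, with a
  unit normal field \<open>N\<close> whose tension has no tangential part. The conditions on the second
  fundamental form are expressed by products of second derivatives with normal vectors \<open>n\<close>.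
\<close>

locale harmonic_gauss_chart =
  fixes U :: "(real^2) set" and X N :: "real^2 \<Rightarrow> real^4"
  assumes open_U: "open U" and smooth_X: "smooth_on U X" and smooth_N: "smooth_on U N"
    and det_pos: "u \<in> U \<Longrightarrow> det (first_form X u) > 0"
    and unit_N: "u \<in> U \<Longrightarrow> N u \<bullet> N u = 1"
    and normal_N: "u \<in> U \<Longrightarrow> N u \<bullet> pd i X u = 0"
    and trace_zero: "u \<in> U \<Longrightarrow> n \<bullet> pd 1 X u = 0 \<Longrightarrow> n \<bullet> pd 2 X u = 0 \<Longrightarrow>
      (pd 2 X u \<bullet> pd 2 X u) * (n \<bullet> pd 1 (pd 1 X) u) - 2 * (pd 1 X u \<bullet> pd 2 X u) * (n \<bullet> pd 1 (pd 2 X) u)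
      + (pd 1 X u \<bullet> pd 1 X u) * (n \<bullet> pd 2 (pd 2 X) u) = 0"
    and full_normal: "u \<in> U \<Longrightarrow> n \<bullet> pd 1 X u = 0 \<Longrightarrow> n \<bullet> pd 2 X u = 0 \<Longrightarrow>
      (\<And>i j. n \<bullet> pd i (pd j X) u = 0) \<Longrightarrow> n = 0"
    and tension: "u \<in> U \<Longrightarrow> (pd 1 (star_pd 2 X N) u - pd 2 (star_pd 1 X N) u) \<bullet> pd k X u = 0"
begin

abbreviation "E u \<equiv> pd 1 X u \<bullet> pd 1 X u"
abbreviation "F u \<equiv> pd 1 X u \<bullet> pd 2 X u"
abbreviation "G u \<equiv> pd 2 X u \<bullet> pd 2 X u"
abbreviation "W \<equiv> area_density X"

lemma gram_pos: "u \<in> U \<Longrightarrow> E u * G u - (F u)\<^sup>2 > 0"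
  using det_pos by (simp add: det_first_form)

lemma E_pos: "u \<in> U \<Longrightarrow> E u > 0"
  using gram_pos[of u] by (metis diff_gt_0_iff_gt inner_gt_zero_iff inner_zero_left mult_zero_left not_less zero_le_power2)

lemma W_pos: "u \<in> U \<Longrightarrow> W u > 0"
  using det_pos by (simp add: area_density_def)

lemma W_sq: "u \<in> U \<Longrightarrow> W u * W u = E u * G u - F u * F u"
  using area_density_sq[OF det_pos] by (simp add: det_first_form power2_eq_square)

lemma smooth_W: "smooth_on U W" and smooth_inverse_W: "smooth_on U (\<lambda>u. 1 / W u)"
  using smooth_on_area_density[OF open_U smooth_X] smooth_on_inverse_area_density[OF open_U smooth_X] det_pos by blast+

lemma smooth_star: "smooth_on U (star_pd i X X)" "smooth_on U (star_pd i X N)"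
  using smooth_on_star_pd[OF open_U smooth_X] smooth_X smooth_N det_pos by blast+

lemmas smooth = smooth_X smooth_N smooth_on_pd[OF smooth_X] smooth_on_pd[OF smooth_N]
  smooth_W smooth_inverse_W smooth_star

lemmas diff = smooth[THEN smooth_on_differentiable]

lemma sym_X: "u \<in> U \<Longrightarrow> pd 2 (pd 1 X) u = pd 1 (pd 2 X) u"
  by (rule pd_commute[OF open_U _ smooth_X])

lemma sym_N: "u \<in> U \<Longrightarrow> pd 2 (pd 1 N) u = pd 1 (pd 2 N) u"
  by (rule pd_commute[OF open_U _ smooth_N])

lemma pd_eq_const:
  assumes "u \<in> U" "\<And>v. v \<in> U \<Longrightarrow> f v = c" shows "pd i f u = 0"
proof -
  have "pd i (\<lambda>u. c) u = pd i f u" by (rule pd_cong[OF open_U assms(1)]) (simp_all add: assms(2))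
  then show ?thesis by (simp add: pd_const)
qed

lemma pd_N_inner_N: "u \<in> U \<Longrightarrow> pd i N u \<bullet> N u = 0"
  using pd_eq_const[of u "\<lambda>u. N u \<bullet> N u" 1 i] unit_N
  by (simp add: pd_inner smooth_on_differentiable[OF smooth_N] inner_commute)

lemma weingarten: "u \<in> U \<Longrightarrow> pd i N u \<bullet> pd j X u = - (N u \<bullet> pd i (pd j X) u)"
  using pd_eq_const[of u "\<lambda>u. N u \<bullet> pd j X u" 0 i] normal_N
  by (simp add: pd_inner smooth_on_differentiable[OF smooth_N] smooth_on_differentiable[OF smooth_on_pd[OF smooth_X]] add_eq_0_iff)

lemma shape_sym: "u \<in> U \<Longrightarrow> pd 2 N u \<bullet> pd 1 X u = pd 1 N u \<bullet> pd 2 X u"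
  by (simp add: weingarten sym_X)

lemma shape_trace:
  assumes "u \<in> U"
  shows "G u * (pd 1 N u \<bullet> pd 1 X u) - 2 * F u * (pd 1 N u \<bullet> pd 2 X u) + E u * (pd 2 N u \<bullet> pd 2 X u) = 0"
  using trace_zero[OF assms normal_N[OF assms] normal_N[OF assms]] by (simp add: weingarten[OF assms])

text \<open>
  The shape operator of \<open>N\<close> is symmetric and trace-free, hence anticommutes with the rotation by a
  right angle.
\<close>

lemma star_N_inner:
  assumes u: "u \<in> U"
  shows "star_pd i X N u \<bullet> pd k X u = pd i N u \<bullet> star_pd k X X u"
proof -
  have *: "(pd i X u \<bullet> pd 1 X u) * (pd 2 N u \<bullet> pd k X u) - (pd i X u \<bullet> pd 2 X u) * (pd 1 N u \<bullet> pd k X u)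
    = (pd k X u \<bullet> pd 1 X u) * (pd i N u \<bullet> pd 2 X u) - (pd k X u \<bullet> pd 2 X u) * (pd i N u \<bullet> pd 1 X u)"
    using exhaust_2[of i] exhaust_2[of k] shape_sym[OF u] shape_trace[OF u]
    by (elim disjE) (simp_all add: inner_commute[of "pd 2 X u" "pd 1 X u"] algebra_simps)
  then show ?thesis
    by (simp add: star_pd_def inner_diff_left inner_diff_right)
qed

text \<open>
  This is the derivative of \<open>star_N_inner\<close>, alternated in \<open>i\<close> and the direction of differentiation.
  The second derivatives of \<open>N\<close> cancel, on the left because the tension is normal and on the right
  by symmetry.
\<close>

lemma codazzi_harmonic:
  assumes u: "u \<in> U"
  shows "star_pd 2 X N u \<bullet> pd 1 (pd k X) u - star_pd 1 X N u \<bullet> pd 2 (pd k X) u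
    = pd 2 N u \<bullet> pd 1 (star_pd k X X) u - pd 1 N u \<bullet> pd 2 (star_pd k X X) u"
proof -
  have "pd j (\<lambda>u. star_pd i X N u \<bullet> pd k X u) u = pd j (\<lambda>u. pd i N u \<bullet> star_pd k X X u) u" for i j
    by (rule pd_cong[OF open_U u star_N_inner]) (simp_all add: diff u)
  then have *: "star_pd i X N u \<bullet> pd j (pd k X) u + pd j (star_pd i X N) u \<bullet> pd k X u
     = pd i N u \<bullet> pd j (star_pd k X X) u + pd j (pd i N) u \<bullet> star_pd k X X u" for i j
    by (simp add: pd_inner diff u)
  show ?thesis
    using *[of 2 1] *[of 1 2] tension[OF u, of k] sym_N[OF u] by (simp add: inner_diff_left)
qed

lemma pd_star_X_normal:
  assumes u: "u \<in> U" and n: "n \<bullet> pd 1 X u = 0" "n \<bullet> pd 2 X u = 0"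
  shows "pd j (star_pd k X X) u \<bullet> n = (1 / W u) *
    ((pd k X u \<bullet> pd 1 X u) * (pd j (pd 2 X) u \<bullet> n) - (pd k X u \<bullet> pd 2 X u) * (pd j (pd 1 X) u \<bullet> n))"
proof -
  have s: "smooth_on U (\<lambda>u. (pd k X u \<bullet> pd l X u) *\<^sub>R pd m X u)" "smooth_on U (\<lambda>u. pd k X u \<bullet> pd l X u)" for l m
    by (intro smooth_on_scaleR smooth_on_inner open_U smooth)+
  note ds = s[THEN smooth_on_differentiable, OF u]
  have sd: "smooth_on U (\<lambda>u. (pd k X u \<bullet> pd 1 X u) *\<^sub>R pd 2 X u - (pd k X u \<bullet> pd 2 X u) *\<^sub>R pd 1 X u)"
    by (intro smooth_on_diff s open_U)
  show ?thesis
    unfolding star_pd_def[abs_def] pd_scaleR[OF diff(6)[OF u] smooth_on_differentiable[OF sd u]]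
      pd_diff[OF ds(1) ds(1)] pd_scaleR[OF ds(2) diff(3)[OF u]]
    using n by (simp add: inner_add_right inner_diff_right inner_commute[of _ n])
qed

lemma star_X_inner:
  assumes u: "u \<in> U"
  shows "star_pd 1 X X u \<bullet> pd 1 X u = 0" "star_pd 2 X X u \<bullet> pd 2 X u = 0"
    "star_pd 1 X X u \<bullet> pd 2 X u = W u" "star_pd 2 X X u \<bullet> pd 1 X u = - W u"
proof -
  have w: "W u \<noteq> 0" using W_pos[OF u] by simp
  have c: "pd 2 X u \<bullet> pd 1 X u = F u" by (rule inner_commute)
  show "star_pd 1 X X u \<bullet> pd 1 X u = 0" "star_pd 2 X X u \<bullet> pd 2 X u = 0"
    by (simp_all add: star_pd_def inner_diff_left c)
  show "star_pd 1 X X u \<bullet> pd 2 X u = W u" "star_pd 2 X X u \<bullet> pd 1 X u = - W u"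
    using w W_sq[OF u] by (simp_all add: star_pd_def inner_diff_left c field_simps)
qed

lemma pd_W:
  assumes u: "u \<in> U"
  shows "pd j W u = star_pd 1 X X u \<bullet> pd j (pd 2 X) u - star_pd 2 X X u \<bullet> pd j (pd 1 X) u"
proof -
  have s: "smooth_on U (\<lambda>u. pd k X u \<bullet> pd l X u)" for k l by (intro smooth_on_inner open_U smooth)
  note ds = s[THEN smooth_on_differentiable, OF u]
  have sm: "smooth_on U (\<lambda>u. (pd k X u \<bullet> pd l X u) * (pd m X u \<bullet> pd n X u))" for k l m n
    by (intro smooth_on_mult s open_U)
  note dm = sm[THEN smooth_on_differentiable, OF u]
  have "pd j (\<lambda>u. W u * W u) u = pd j (\<lambda>u. E u * G u - F u * F u) u"
    by (rule pd_cong[OF open_U u W_sq])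
      (simp_all add: smooth_on_differentiable[OF smooth_on_mult[OF open_U smooth(5,5)] u])
  then have "2 * W u * pd j W u = 2 * (G u * (pd j (pd 1 X) u \<bullet> pd 1 X u) + E u * (pd j (pd 2 X) u \<bullet> pd 2 X u)
      - F u * (pd j (pd 1 X) u \<bullet> pd 2 X u + pd j (pd 2 X) u \<bullet> pd 1 X u))"
    unfolding pd_mult[OF diff(5)[OF u] diff(5)[OF u]] pd_diff[OF dm dm] pd_mult[OF ds ds]
      pd_inner[OF diff(3)[OF u] diff(3)[OF u]]
    by (simp add: inner_commute algebra_simps)
  then have "W u * pd j W u = G u * (pd j (pd 1 X) u \<bullet> pd 1 X u) + E u * (pd j (pd 2 X) u \<bullet> pd 2 X u)
      - F u * (pd j (pd 1 X) u \<bullet> pd 2 X u + pd j (pd 2 X) u \<bullet> pd 1 X u)" by simp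
  then have *: "pd j W u = (G u * (pd j (pd 1 X) u \<bullet> pd 1 X u) + E u * (pd j (pd 2 X) u \<bullet> pd 2 X u)
      - F u * (pd j (pd 1 X) u \<bullet> pd 2 X u + pd j (pd 2 X) u \<bullet> pd 1 X u)) / W u"
    using W_pos[OF u] by (simp add: eq_divide_eq mult.commute)
  show ?thesis
    unfolding * using W_pos[OF u]
    by (simp add: star_pd_def inner_diff_left inner_diff_right inner_commute field_simps)
qed

text \<open>
  The rotation is parallel for the Levi-Civita connection: the tangential part of the derivative of
  the rotated coordinate field is the rotation of the tangential part of its derivative. It follows
  by differentiating the constant multiples of \<open>W\<close> in \<open>star_X_inner\<close>.
\<close>

lemma pd_star_X_tangential:
  assumes u: "u \<in> U"
  shows "pd j (star_pd k X X) u \<bullet> pd l X u = - (pd j (pd k X) u \<bullet> star_pd l X X u)"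
proof -
  \<comment> \<open>the Levi-Civita symbol\<close>
  define e :: real where "e = (if k = l then 0 else if k = 1 then 1 else -1)"
  have *: "star_pd k X X v \<bullet> pd l X v = e * W v" if "v \<in> U" for v
    using exhaust_2[of k] exhaust_2[of l] star_X_inner[OF that] by (auto simp: e_def)
  have "pd j (\<lambda>v. star_pd k X X v \<bullet> pd l X v) u = pd j (\<lambda>v. e * W v) u"
    by (rule pd_cong[OF open_U u *]) (simp_all add: diff u)
  then have "star_pd k X X u \<bullet> pd j (pd l X) u + pd j (star_pd k X X) u \<bullet> pd l X u = e * pd j W u"
    by (simp add: pd_inner pd_mult pd_const diff u)
  then show ?thesis
    unfolding pd_W[OF u] using exhaust_2[of k] exhaust_2[of l]
    by (elim disjE) (simp_all add: e_def inner_commute algebra_simps)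
qed

lemma pd_N_decomposition:
  assumes u: "u \<in> U" and \<xi>: "norm \<xi> = 1" "\<xi> \<bullet> pd 1 X u = 0" "\<xi> \<bullet> pd 2 X u = 0" "\<xi> \<bullet> N u = 0"
  shows "pd i N u =
      ((G u * (pd i N u \<bullet> pd 1 X u) - F u * (pd i N u \<bullet> pd 2 X u)) / (W u * W u)) *\<^sub>R pd 1 X u
    + ((E u * (pd i N u \<bullet> pd 2 X u) - F u * (pd i N u \<bullet> pd 1 X u)) / (W u * W u)) *\<^sub>R pd 2 X u
    + (pd i N u \<bullet> \<xi>) *\<^sub>R \<xi>"
proof -
  have "N u \<noteq> 0" using unit_N[OF u] by auto
  from frame_decomposition[OF gram_pos[OF u] this normal_N[OF u] normal_N[OF u] \<xi> pd_N_inner_N[OF u]]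
  show ?thesis unfolding W_sq[OF u] power2_eq_square .
qed

text \<open>
  Insert the decomposition of \<open>dN\<close> into \<open>codazzi_harmonic\<close>. The tangential contributions cancel
  because the rotation is parallel. What remains is that the shape operator of \<open>\<xi>\<close>
  annihilates the form with components \<open>w 1\<close>, \<open>w 2\<close>.
\<close>

lemma pd_N_tangential:
  assumes u: "u \<in> U" and \<xi>: "norm \<xi> = 1" "\<xi> \<bullet> pd 1 X u = 0" "\<xi> \<bullet> pd 2 X u = 0" "\<xi> \<bullet> N u = 0"
  shows "pd i N u \<bullet> \<xi> = 0"
proof -
  define a where "a i = (G u * (pd i N u \<bullet> pd 1 X u) - F u * (pd i N u \<bullet> pd 2 X u)) / (W u * W u)" for i
  define b where "b i = (E u * (pd i N u \<bullet> pd 2 X u) - F u * (pd i N u \<bullet> pd 1 X u)) / (W u * W u)" for i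
  define w where "w i = pd i N u \<bullet> \<xi>" for i
  have N: "pd i N u = a i *\<^sub>R pd 1 X u + b i *\<^sub>R pd 2 X u + w i *\<^sub>R \<xi>" for i
    unfolding a_def b_def w_def by (rule pd_N_decomposition[OF u \<xi>])
  have W0: "W u \<noteq> 0" using W_pos[OF u] by simp
  have tr: "a 1 + b 2 = 0"
  proof -
    have "a 1 + b 2 = (G u * (pd 1 N u \<bullet> pd 1 X u) - 2 * F u * (pd 1 N u \<bullet> pd 2 X u) + E u * (pd 2 N u \<bullet> pd 2 X u)) / (W u * W u)"
      unfolding a_def b_def shape_sym[OF u] by (simp add: add_divide_distrib[symmetric] algebra_simps)
    then show ?thesis unfolding shape_trace[OF u] by simp
  qed
  have sym: "E u * a 2 + F u * b 2 = F u * a 1 + G u * b 1"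
  proof -
    have "pd 2 N u \<bullet> pd 1 X u = E u * a 2 + F u * b 2" "pd 1 N u \<bullet> pd 2 X u = F u * a 1 + G u * b 1"
      unfolding N using \<xi> by (simp_all add: inner_add_left inner_commute[of "pd 2 X u" "pd 1 X u"])
    then show ?thesis using shape_sym[OF u] by simp
  qed
  have trb: "G u * (\<xi> \<bullet> pd 1 (pd 1 X) u) - 2 * F u * (\<xi> \<bullet> pd 1 (pd 2 X) u) + E u * (\<xi> \<bullet> pd 2 (pd 2 X) u) = 0"
    by (rule trace_zero[OF u \<xi>(2,3)])
  have Y: "pd 2 N u \<bullet> pd 1 (star_pd k X X) u - pd 1 N u \<bullet> pd 2 (star_pd k X X) u =
      - a 2 * (pd 1 (pd k X) u \<bullet> star_pd 1 X X u) - b 2 * (pd 1 (pd k X) u \<bullet> star_pd 2 X X u)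
      + w 2 * (pd 1 (star_pd k X X) u \<bullet> \<xi>)
      - (- a 1 * (pd 2 (pd k X) u \<bullet> star_pd 1 X X u) - b 1 * (pd 2 (pd k X) u \<bullet> star_pd 2 X X u)
      + w 1 * (pd 2 (star_pd k X X) u \<bullet> \<xi>))" for k
  proof -
    have t: "pd l X u \<bullet> pd j (star_pd k X X) u = - (pd j (pd k X) u \<bullet> star_pd l X X u)" for j l
      using pd_star_X_tangential[OF u, of j k l] by (simp add: inner_commute)
    show ?thesis unfolding N by (simp add: inner_add_left t inner_commute[of \<xi>])
  qed
  have main: "W u * (star_pd 2 X N u \<bullet> pd 1 (pd k X) u - star_pd 1 X N u \<bullet> pd 2 (pd k X) u)
    = W u * (pd 2 N u \<bullet> pd 1 (star_pd k X X) u - pd 1 N u \<bullet> pd 2 (star_pd k X X) u)" for k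
    by (simp only: codazzi_harmonic[OF u])
  have WY: "W u * (star_pd i X X u \<bullet> v) = (pd i X u \<bullet> pd 1 X u) * (pd 2 X u \<bullet> v) - (pd i X u \<bullet> pd 2 X u) * (pd 1 X u \<bullet> v)" for v i
    using W0 by (simp add: star_pd_def inner_diff_left)
  have WP: "W u * (star_pd i X N u \<bullet> v) = (pd i X u \<bullet> pd 1 X u) * (a 2 * (pd 1 X u \<bullet> v) + b 2 * (pd 2 X u \<bullet> v) + w 2 * (\<xi> \<bullet> v))
     - (pd i X u \<bullet> pd 2 X u) * (a 1 * (pd 1 X u \<bullet> v) + b 1 * (pd 2 X u \<bullet> v) + w 1 * (\<xi> \<bullet> v))" for v i
    using W0 unfolding star_pd_def N by (simp add: inner_diff_left inner_add_left)
  have WX: "W u * (pd j (star_pd k X X) u \<bullet> \<xi>) =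
    (pd k X u \<bullet> pd 1 X u) * (pd j (pd 2 X) u \<bullet> \<xi>) - (pd k X u \<bullet> pd 2 X u) * (pd j (pd 1 X) u \<bullet> \<xi>)" for j k
    unfolding pd_star_X_normal[OF u \<xi>(2,3)] using W0 by simp
  have eq: "W u * (star_pd 2 X N u \<bullet> pd 1 (pd k X) u) - W u * (star_pd 1 X N u \<bullet> pd 2 (pd k X) u)
    = - a 2 * (W u * (pd 1 (pd k X) u \<bullet> star_pd 1 X X u)) - b 2 * (W u * (pd 1 (pd k X) u \<bullet> star_pd 2 X X u))
      + w 2 * (W u * (pd 1 (star_pd k X X) u \<bullet> \<xi>))
      - (- a 1 * (W u * (pd 2 (pd k X) u \<bullet> star_pd 1 X X u)) - b 1 * (W u * (pd 2 (pd k X) u \<bullet> star_pd 2 X X u))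
      + w 1 * (W u * (pd 2 (star_pd k X X) u \<bullet> \<xi>)))" for k
    using main[of k] unfolding Y by (simp add: algebra_simps)
  have c: "pd 2 X u \<bullet> pd 1 X u = F u" "pd i (pd j X) u \<bullet> v = v \<bullet> pd i (pd j X) u" for i j v
    by (rule inner_commute)+
  have a1: "a 1 = - b 2" using tr by simp
  \<comment> \<open>the tangential coefficients of \<open>*dN\<close> are those of \<open>dN\<close> with \<open>*dX\<close> in place of \<open>dX\<close>, up to sign\<close>
  have key: "(F u * (a 2 * p + b 2 * q + w 2 * r) - G u * (a 1 * p + b 1 * q + w 1 * r))
     = - a 2 * (E u * q - F u * p) - b 2 * (F u * q - G u * p) + (F u * w 2 - G u * w 1) * r" for p q r
    using sym a1 by algebra
  have key': "(E u * (a 2 * p + b 2 * q + w 2 * r) - F u * (a 1 * p + b 1 * q + w 1 * r))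
     = - a 1 * (E u * q - F u * p) - b 1 * (F u * q - G u * p) + (E u * w 2 - F u * w 1) * r" for p q r
    using sym a1 by algebra
  let ?b11 = "\<xi> \<bullet> pd 1 (pd 1 X) u" and ?b12 = "\<xi> \<bullet> pd 1 (pd 2 X) u" and ?b22 = "\<xi> \<bullet> pd 2 (pd 2 X) u"
  note s = sym_X[OF u]
  have e1: "(F u * w 2 - G u * w 1) * ?b11 - (E u * w 2 - F u * w 1) * ?b12
     = w 2 * (E u * ?b12 - F u * ?b11) - w 1 * (E u * ?b22 - F u * ?b12)"
    using eq[of 1] unfolding WY WP WX s c key key' by (simp add: algebra_simps)
  have e2: "(F u * w 2 - G u * w 1) * ?b12 - (E u * w 2 - F u * w 1) * ?b22
     = w 2 * (F u * ?b12 - G u * ?b11) - w 1 * (F u * ?b22 - G u * ?b12)"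
    using eq[of 2] unfolding WY WP WX s c key key' by (simp add: algebra_simps)
  have e1': "w 1 * (G u * ?b11 - F u * ?b12) + w 2 * (E u * ?b12 - F u * ?b11) = 0"
    using e1 trb by algebra
  have e2': "w 1 * (G u * ?b12 - F u * ?b22) + w 2 * (E u * ?b22 - F u * ?b12) = 0"
    using e2 trb by algebra
  have ne: "\<not> (?b11 = 0 \<and> ?b12 = 0 \<and> ?b22 = 0)"
  proof
    assume z: "?b11 = 0 \<and> ?b12 = 0 \<and> ?b22 = 0"
    have "\<xi> = 0"
    proof (rule full_normal[OF u \<xi>(2,3)])
      show "\<xi> \<bullet> pd i (pd j X) u = 0" for i j
        using z s exhaust_2[of i] exhaust_2[of j] by auto
    qed
    then show False using \<xi>(1) by simp
  qed
  have "w 1 = 0 \<and> w 2 = 0"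
    by (rule tracefree_sym_kernel[OF gram_pos[OF u] E_pos[OF u] trb ne e1' e2'])
  then show ?thesis using exhaust_2[of i] by (auto simp: w_def)
qed

text \<open>
  Since \<open>dN\<close> is tangential throughout \<open>U\<close>, the normal part of its derivative involves only the
  second fundamental form, and the symmetry of the second derivatives of \<open>N\<close> becomes the
  Ricci equation: the shape operators of \<open>N\<close> and \<open>\<xi>\<close> commute. So they are proportional, which
  contradicts the spanning hypothesis at any point of \<open>U\<close>.
\<close>

lemma empty_domain: "U = {}"
proof (rule ccontr)
  assume "U \<noteq> {}"
  then obtain u where u: "u \<in> U" by blast
  define a where "a i v = (1 / W v) * ((1 / W v) * (G v * (pd i N v \<bullet> pd 1 X v) - F v * (pd i N v \<bullet> pd 2 X v)))" for i v
  define b where "b i v = (1 / W v) * ((1 / W v) * (E v * (pd i N v \<bullet> pd 2 X v) - F v * (pd i N v \<bullet> pd 1 X v)))" for i v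
  have sa: "smooth_on U (a i)" "smooth_on U (b i)" for i
    unfolding a_def[abs_def] b_def[abs_def]
    by (intro smooth_on_mult smooth_on_diff smooth_on_inner open_U smooth)+
  have N: "pd i N v = a i v *\<^sub>R pd 1 X v + b i v *\<^sub>R pd 2 X v" if v: "v \<in> U" for i v
  proof -
    obtain z where z: "norm z = 1" "z \<bullet> pd 1 X v = 0" "z \<bullet> pd 2 X v = 0" "z \<bullet> N v = 0"
      using ex_unit_orthogonal_to_three by blast
    show ?thesis
      using pd_N_decomposition[OF v z, of i] unfolding pd_N_tangential[OF v z] a_def b_def by simp
  qed
  obtain \<xi> where \<xi>: "norm \<xi> = 1" "\<xi> \<bullet> pd 1 X u = 0" "\<xi> \<bullet> pd 2 X u = 0" "\<xi> \<bullet> N u = 0"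
    using ex_unit_orthogonal_to_three by blast
  have dN: "pd j (pd i N) u \<bullet> \<xi> = a i u * (\<xi> \<bullet> pd j (pd 1 X) u) + b i u * (\<xi> \<bullet> pd j (pd 2 X) u)" for i j
  proof -
    have ss: "smooth_on U (\<lambda>v. a i v *\<^sub>R pd 1 X v)" "smooth_on U (\<lambda>v. b i v *\<^sub>R pd 2 X v)"
      by (intro smooth_on_scaleR sa open_U smooth)+
    note d = ss[THEN smooth_on_differentiable, OF u] and da = sa[THEN smooth_on_differentiable, OF u]
    have "pd j (pd i N) u = pd j (\<lambda>v. a i v *\<^sub>R pd 1 X v + b i v *\<^sub>R pd 2 X v) u"
      by (rule pd_cong[OF open_U u N diff(4)[OF u]])
    also have "\<dots> = (a i u *\<^sub>R pd j (pd 1 X) u + pd j (a i) u *\<^sub>R pd 1 X u) + (b i u *\<^sub>R pd j (pd 2 X) u + pd j (b i) u *\<^sub>R pd 2 X u)"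
      unfolding pd_add[OF d] pd_scaleR[OF da(1) diff(3)[OF u]] pd_scaleR[OF da(2) diff(3)[OF u]] ..
    finally show ?thesis using \<xi> by (simp add: inner_add_right inner_commute[of _ \<xi>])
  qed
  let ?h11 = "N u \<bullet> pd 1 (pd 1 X) u" and ?h12 = "N u \<bullet> pd 1 (pd 2 X) u" and ?h22 = "N u \<bullet> pd 2 (pd 2 X) u"
  let ?b11 = "\<xi> \<bullet> pd 1 (pd 1 X) u" and ?b12 = "\<xi> \<bullet> pd 1 (pd 2 X) u" and ?b22 = "\<xi> \<bullet> pd 2 (pd 2 X) u"
  note s = sym_X[OF u]
  have trb: "G u * ?b11 - 2 * F u * ?b12 + E u * ?b22 = 0" by (rule trace_zero[OF u \<xi>(2,3)])
  have trh: "G u * ?h11 - 2 * F u * ?h12 + E u * ?h22 = 0" by (rule trace_zero[OF u normal_N[OF u] normal_N[OF u]])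
  have W0: "W u \<noteq> 0" using W_pos[OF u] by simp
  have "a 1 u * ?b12 + b 1 u * ?b22 = a 2 u * ?b11 + b 2 u * ?b12"
    using dN[of 2 1] dN[of 1 2] sym_N[OF u] s by simp
  then have "W u * (W u * (a 1 u * ?b12 + b 1 u * ?b22)) = W u * (W u * (a 2 u * ?b11 + b 2 u * ?b12))" by simp
  moreover have "W u * (W u * a i u) = G u * (pd i N u \<bullet> pd 1 X u) - F u * (pd i N u \<bullet> pd 2 X u)"
     "W u * (W u * b i u) = E u * (pd i N u \<bullet> pd 2 X u) - F u * (pd i N u \<bullet> pd 1 X u)" for i
    using W0 by (simp_all add: a_def b_def)
  ultimately have "(G u * (- ?h11) - F u * (- ?h12)) * ?b12 + (E u * (- ?h12) - F u * (- ?h11)) * ?b22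
     = (G u * (- ?h12) - F u * (- ?h22)) * ?b11 + (E u * (- ?h22) - F u * (- ?h12)) * ?b12"
    by (simp add: weingarten[OF u] s distrib_left mult.assoc[symmetric])
  then have comm: "G u * (?h11 * ?b12 - ?h12 * ?b11) + E u * (?h12 * ?b22 - ?h22 * ?b12) + F u * (?h22 * ?b11 - ?h11 * ?b22) = 0"
    by (simp add: algebra_simps)
  note par = tracefree_sym_commuting_parallel[OF gram_pos[OF u] E_pos[OF u] trh trb comm]
  have zero: "p = 0 \<and> q = 0" if "p * ?h11 + q * ?b11 = 0" "p * ?h12 + q * ?b12 = 0" "p * ?h22 + q * ?b22 = 0" for p q
  proof -
    have "p *\<^sub>R N u + q *\<^sub>R \<xi> = 0"
    proof (rule full_normal[OF u])
      show "(p *\<^sub>R N u + q *\<^sub>R \<xi>) \<bullet> pd i (pd j X) u = 0" for i j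
        using that s exhaust_2[of i] exhaust_2[of j] by (auto simp: inner_add_left)
    qed (use \<xi> normal_N[OF u] in \<open>simp_all add: inner_add_left\<close>)
    then have "(p *\<^sub>R N u + q *\<^sub>R \<xi>) \<bullet> N u = 0" "(p *\<^sub>R N u + q *\<^sub>R \<xi>) \<bullet> \<xi> = 0" by simp_all
    then show ?thesis using \<xi> unit_N[OF u] by (auto simp: inner_add_left inner_add_right inner_commute norm_eq_1)
  qed
  \<comment> \<open>the normal vectors \<open>b\<^sub>i\<^sub>j N - h\<^sub>i\<^sub>j \<xi>\<close> are orthogonal to the second fundamental form\<close>
  have "?b11 = 0 \<and> - ?h11 = 0" by (rule zero) (use par in \<open>simp_all add: algebra_simps\<close>)
  moreover have "?b12 = 0 \<and> - ?h12 = 0" by (rule zero) (use par in \<open>simp_all add: algebra_simps\<close>)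
  ultimately have "?h11 = 0" "?h12 = 0" "?h22 = 0" using trh E_pos[OF u] by auto
  then show False using zero[of 1 0] by simp
qed

end

section \<open>Non-harmonicity\<close>

theorem corollary1p2:
  fixes A :: "'m::{t2_space,second_countable_topology} atlas"
    and F :: "'m \<Rightarrow> real^4"
    and \<eta> :: "'m \<Rightarrow> real^4"
  assumes "smooth_atlas A"
    and "immersion A F"
    and "minimal A F"
    and "second_form_spans_normal A F"
    and "unit_normal_section A F \<eta>"
  shows "\<not> harmonic_to_sphere A F \<eta>"
proof
  assume harm: "harmonic_to_sphere A F \<eta>"
  \<comment> \<open>a type has an element, so the surface is not empty\<close>
  have "(undefined :: 'm) \<in> (\<Union>(U, x)\<in>A. x ` U)"
    using assms(1) by (simp add: smooth_atlas_def)
  then obtain U x where A: "(U, x) \<in> A" and ne: "U \<noteq> {}" by auto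
  let ?X = "F \<circ> x" and ?N = "\<eta> \<circ> x"
  have U: "open U" using atlas_chart(1)[OF assms(1) A] .
  have X: "smooth_on U ?X" using immersion_chart(1)[OF assms(2) A] .
  have det: "det (first_form ?X u) > 0" if "u \<in> U" for u
    using immersion_chart(2)[OF assms(2) A that] .
  have dX: "?X differentiable (at u)" if "u \<in> U" for u by (rule smooth_on_differentiable[OF X that])
  have N: "smooth_on U ?N" using assms(5) A by (auto simp: unit_normal_section_def smooth_map_def)
  have normal: "?N u \<bullet> pd i ?X u = 0" if "u \<in> U" for u i
  proof -
    have "?N u \<in> normal_space ?X u" using assms(5) A that by (auto simp: unit_normal_section_def)
    then show ?thesis using mem_normal_space[OF dX[OF that]] exhaust_2[of i] by auto
  qed
  have "harmonic_gauss_chart U ?X ?N"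
  proof
    fix u assume u: "u \<in> U"
    show "det (first_form ?X u) > 0" by (rule det[OF u])
    have "norm (?N u) = 1" using assms(5) by (simp add: unit_normal_section_def)
    then show "?N u \<bullet> ?N u = 1" by (simp add: norm_eq_1)
    show "?N u \<bullet> pd i ?X u = 0" for i by (rule normal[OF u])
    have "mean_curvature ?X u = 0" using assms(3) A u by (auto simp: minimal_def)
    then show "(pd 2 ?X u \<bullet> pd 2 ?X u) * (n \<bullet> pd 1 (pd 1 ?X) u) - 2 * (pd 1 ?X u \<bullet> pd 2 ?X u) * (n \<bullet> pd 1 (pd 2 ?X) u)
      + (pd 1 ?X u \<bullet> pd 1 ?X u) * (n \<bullet> pd 2 (pd 2 ?X) u) = 0"
      if "n \<bullet> pd 1 ?X u = 0" "n \<bullet> pd 2 ?X u = 0" for n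
      using minimal_normal_trace[OF U X u det[OF u]] that by blast
    have "span {second_form ?X u a b | a b. True} = normal_space ?X u"
      using assms(4) A u by (auto simp: second_form_spans_normal_def)
    then show "n = 0" if "n \<bullet> pd 1 ?X u = 0" "n \<bullet> pd 2 ?X u = 0" "\<And>i j. n \<bullet> pd i (pd j ?X) u = 0" for n
      using span_second_form_orthogonal[OF U X u] that by blast
    show "(pd 1 (star_pd 2 ?X ?N) u - pd 2 (star_pd 1 ?X ?N) u) \<bullet> pd k ?X u = 0" for k
      by (rule harmonic_tension_orthogonal[OF assms(1) A assms(2) harm smooth_on_pd[OF X] _ u])
        (use normal in \<open>simp add: inner_commute\<close>)
  qed (fact U X N)+
  then have "U = {}" by (rule harmonic_gauss_chart.empty_domain)
  with ne show False by simp
qed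

end
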